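(* The number of connected components of the smooth region $\mathcal G_S$ of the $2\times k$-periodic Aztec diamond (defined in the context) is $k'-1$.
   Context: Let $k\ge1$ be an integer and $\alpha_1,\dots,\alpha_k,\beta_1,\dots,\beta_k>0$ with $\alpha_1\cdots\alpha_k=\beta_1\cdots\beta_k$ (the weights of the $2\times k$-periodic Aztec diamond). Let (ordered product, $m=1$ leftmost) \[ \Phi(z) = \frac{1}{(1-z^{-1})^k}\prod_{m=1}^k \begin{pmatrix}1 & \alpha_m z^{-1}\\ \alpha_m^{-1} & 1\end{pmatrix} \begin{pmatrix}1 & \beta_mz^{-1}\\ \beta_m^{-1} & 1\end{pmatrix}, \qquad p(z)=\big((z-1)^k\operatorname{Tr}\Phi(z)\big)^2-4(z-1)^{2k}. \] $p$ is a real polynomial of degree $2k-1$ whose zeros $s_0,\dots,s_{2(k-1)}$ (with multiplicity) satisfy $0=s_0>s_1\ge s_2>s_3\ge s_4>\dots>s_{2k-3}\ge s_{2(k-1)}$. Write $p=q^2p_0$ with $q,p_0$ polynomials with only simple zeros and $q$ monic; let $0=x_0>x_1>\dots>x_{2(k'-1)}$ be the zeros of $p_0$, so $1\le k'\le k$, $\deg p_0=2k'-1$, $\deg q=k-k'$. This defines $k'$. $\mathcal R$ is the compact Riemann surface $\{(z,w)\in\mathbb C^2: w^2=p_0(z)\}$ together with the point $(\infty,\infty)$; its genus is $k'-1$. For $\ell=1,\dots,k'-1$ let $C_\ell^+=\{(z,w)\in\mathcal R: z\in[x_{2\ell},x_{2\ell-1}]\}$. On $\mathcal R$ let $\rho(z,w)=\frac12\operatorname{Tr}\Phi(z)+\frac{q(z)w}{2(z-1)^k}$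 (meromorphic) and, for $(\chi,\eta)\in(-1,1)^2$, \[ F(z,w;\chi,\eta)=\frac k4(\eta+1)\log z-\frac k2\log(z-1)-\frac\chi2\log\rho(z,w). \] $F$ is multivalued but its differential is a well-defined meromorphic differential on $\mathcal R$; a critical point of $F$ is a zero of this differential (in local coordinates). The smooth region $\mathcal G_S$ is the set of $(\chi,\eta)\in(-1,1)^2$ such that $F(\cdot;\chi,\eta)$ has four distinct critical points in $C_\ell^+$ for some $\ell\in\{1,\dots,k'-1\}$. *)

theory Defs
  imports "HOL-Complex_Analysis.Complex_Analysis" "HOL-Computational_Algebra.Polynomial"
begin

definition aztec_factor :: "real \<Rightarrow> complex \<Rightarrow> complex^2^2" where
  "aztec_factor a z = vector [vector [1, of_real a * inverse z], vector [inverse (of_real a), 1]]"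

(* The weights are indexed by m = 1, ..., k; values outside this range are never used.
   foldr keeps the order of the matrix product, with m = 1 leftmost, and
   mat c is c times the identity matrix. *)
definition aztec_Phi ::
  "nat \<Rightarrow> (nat \<Rightarrow> real) \<Rightarrow> (nat \<Rightarrow> real) \<Rightarrow> complex \<Rightarrow> complex^2^2" where
  "aztec_Phi k \<alpha> \<beta> z =
     mat (1 / (1 - inverse z) ^ k) **
     foldr (**) (map (\<lambda>m. aztec_factor (\<alpha> m) z ** aztec_factor (\<beta> m) z) [1..<Suc k]) (mat 1)"

(* The expression defining p; for z different from 0 and 1 it agrees with a polynomial. *)
definition aztec_p ::
  "nat \<Rightarrow> (nat \<Rightarrow> real) \<Rightarrow> (nat \<Rightarrow> real) \<Rightarrow> complex \<Rightarrow> complex" where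
  "aztec_p k \<alpha> \<beta> z =
     ((z - 1) ^ k * trace (aztec_Phi k \<alpha> \<beta> z))\<^sup>2 - 4 * (z - 1) ^ (2 * k)"

(* The finite points of the Riemann surface w^2 = p0(z).  The point at infinity is not
   represented: the ovals below, on which critical points are counted, are bounded. *)
definition curve :: "complex poly \<Rightarrow> (complex \<times> complex) set" where
  "curve p0 = {(z, w). w\<^sup>2 = poly p0 z}"

definition oval :: "complex poly \<Rightarrow> real \<Rightarrow> real \<Rightarrow> (complex \<times> complex) set" where
  "oval p0 a b = {(z, w) \<in> curve p0. z \<in> complex_of_real ` {a..b}}"

definition aztec_rho ::
  "nat \<Rightarrow> (nat \<Rightarrow> real) \<Rightarrow> (nat \<Rightarrow> real) \<Rightarrow> complex poly \<Rightarrow> complex \<Rightarrow> complex \<Rightarrow> complex" where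
  "aztec_rho k \<alpha> \<beta> q z w =
     trace (aztec_Phi k \<alpha> \<beta> z) / 2 + poly q z * w / (2 * (z - 1) ^ k)"

(* The inverse of a holomorphic chart of the curve centred at P: t |-> (Z t, W t).
   When p0 has only simple zeros the curve is smooth, and a holomorphic map into it with
   nonzero velocity is a chart inverse near 0.  At a branch point this forces
   deriv Z 0 = 0, so that w, and not z, is the coordinate there. *)
definition local_parametrization ::
  "complex poly \<Rightarrow> complex \<times> complex \<Rightarrow> (complex \<Rightarrow> complex) \<Rightarrow> (complex \<Rightarrow> complex) \<Rightarrow> bool" where
  "local_parametrization p0 P Z W \<longleftrightarrow>
     (\<exists>e>0. Z holomorphic_on ball 0 e \<and> W holomorphic_on ball 0 e \<and>
            (\<forall>t\<in>ball 0 e. (Z t, W t) \<in> curve p0)) \<and>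
     (Z 0, W 0) = P \<and> (deriv Z 0 \<noteq> 0 \<or> deriv W 0 \<noteq> 0)"

definition dlog :: "(complex \<Rightarrow> complex) \<Rightarrow> complex \<Rightarrow> complex" where
  "dlog f t = deriv f t / f t"

(* The coefficient of dt in the pullback along t |-> (Z t, W t) of the differential of
   F = k/4 (eta+1) log z - k/2 log (z-1) - chi/2 log rho.  Only logarithmic derivatives
   occur, so the choice of branches of the logarithms is irrelevant. *)
definition aztec_dF ::
  "nat \<Rightarrow> (nat \<Rightarrow> real) \<Rightarrow> (nat \<Rightarrow> real) \<Rightarrow> complex poly \<Rightarrow> real \<Rightarrow> real \<Rightarrow>
   (complex \<Rightarrow> complex) \<Rightarrow> (complex \<Rightarrow> complex) \<Rightarrow> complex \<Rightarrow> complex" where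
  "aztec_dF k \<alpha> \<beta> q chi eta Z W t =
     of_nat k / 4 * (of_real eta + 1) * dlog Z t
     - of_nat k / 2 * dlog (\<lambda>s. Z s - 1) t
     - of_real chi / 2 * dlog (\<lambda>s. aztec_rho k \<alpha> \<beta> q (Z s) (W s)) t"

(* The zero is expressed by a limit because dF is meromorphic: with x / 0 = 0, the
   value at a pole would be meaningless.  The condition does not depend on the
   parametrization. *)
definition aztec_critical_point ::
  "nat \<Rightarrow> (nat \<Rightarrow> real) \<Rightarrow> (nat \<Rightarrow> real) \<Rightarrow> complex poly \<Rightarrow> complex poly \<Rightarrow> real \<Rightarrow> real \<Rightarrow>
   complex \<times> complex \<Rightarrow> bool" where
  "aztec_critical_point k \<alpha> \<beta> q p0 chi eta P \<longleftrightarrow>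
     (\<exists>Z W. local_parametrization p0 P Z W \<and>
            (aztec_dF k \<alpha> \<beta> q chi eta Z W \<longlongrightarrow> 0) (at 0))"

definition smooth_region ::
  "nat \<Rightarrow> (nat \<Rightarrow> real) \<Rightarrow> (nat \<Rightarrow> real) \<Rightarrow> complex poly \<Rightarrow> complex poly \<Rightarrow>
   nat \<Rightarrow> (nat \<Rightarrow> real) \<Rightarrow> (real \<times> real) set" where
  "smooth_region k \<alpha> \<beta> q p0 k' x =
     {(chi, eta) \<in> {-1<..<1} \<times> {-1<..<1}.
        \<exists>l\<in>{1..k' - 1}.
          card {P \<in> oval p0 (x (2 * l)) (x (2 * l - 1)).
                  aztec_critical_point k \<alpha> \<beta> q p0 chi eta P} = 4}"

end

theory Submission
  imports Defs "HOL-Computational_Algebra.Fundamental_Theorem_Algebra"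
begin

text \<open>
  Write \<open>Tr \<Phi> = t / (z - 1)^k\<close>, \<open>p = q\<^sup>2 p\<^sub>0\<close> and \<open>(z - 1) t' - k t = q h\<close>.  On the \<open>l\<close>-th oval, a point
  \<open>(z, w)\<close> is critical iff \<open>(\<eta> (z - 1) - (z + 1)) w = (2/k) \<chi> z h(z)\<close>, that is, iff the line of slope
  \<open>\<plusminus>\<chi>\<close> and height \<open>\<eta>\<close> meets the planar curve \<open>(u, e)\<close> with \<open>e = (z + 1) / (z - 1)\<close> and
  \<open>u = \<plusminus> (2/k) z h / ((z - 1) \<surd>p\<^sub>0)\<close>.  Squaring the equation gives a polynomial of degree \<open>2k' + 1\<close> that
  vanishes at \<open>0\<close>, and also at \<open>1\<close> if \<open>\<chi> = \<plusminus>1\<close>, while every oval carries at least two of its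
  roots, because \<open>h\<close> has opposite signs at the ends of the oval.  Hence each oval has at most four critical
  points, at most one oval has four, and for \<open>\<chi> = \<plusminus>1\<close> each oval has just two.  The last fact makes \<open>u\<close>
  monotone, and then four critical points occur exactly if the line crosses the curve three times.  This is
  an open condition, it survives rotating the line about its middle crossing to slope \<open>0\<close>, and for \<open>\<chi> = 0\<close>
  it describes an interval of heights; so each oval contributes one component.

  That \<open>h\<close> changes sign needs \<open>q \<noteq> 0\<close> on the ovals.  If \<open>q\<close> vanished there, \<open>Tr \<Phi>\<close> would take values of
  \<open>[-2, 2]\<close> off the negative axis, which is impossible because outside of it \<open>\<Phi>\<close> strictly increases a
  Hermitian form and so has no unimodular eigenvalue.
\<close>

section \<open>Lines meeting a monotone planar curve\<close>

text \<open>The critical equation comes from d log rho = h dz / ((z - 1) w). Since det \<Phi> = 1,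
  rho is an eigenvalue of \<Phi> and becomes 1 / rho under w -> -w, and the factor q cancels from
  the logarithmic derivative. At the two points over z = 1 this differential has residues k and -k,
  whence h(1)^2 = k^2 p0(1); this is the source of the additional root 1 for slopes 1 and -1. The
  root 0 stems from the branch point x_0 = 0.

  The obstacle is that "four distinct critical points" speaks of a cardinality, from which neither
  openness nor connectedness can be read off: a priori, three intersections might include a
  tangency. The count over all lines at once excludes this, because a nearby line of slope still in
  (0, 1) would then meet the curve four times. No derivative of the curve is needed, only its
  behaviour at the ends of the oval and bounds on the numbers of intersections.\<close>

locale line_family =
  fixes a b :: real and e u :: "real \<Rightarrow> real"
  assumes ab: "a < b"
    and cont_e: "continuous_on {a<..<b} e"
    and cont_u: "continuous_on {a<..<b} u"
    and e_dec: "\<And>s t. a < s \<Longrightarrow> s < t \<Longrightarrow> t < b \<Longrightarrow> e t < e s"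
    and e_bound: "\<And>s. a < s \<Longrightarrow> s < b \<Longrightarrow> \<bar>e s\<bar> < 1"
    and u_top: "filterlim u at_top (at_right a)"
    and u_bot: "filterlim u at_bot (at_left b)"
begin

text \<open>The intersections of the curve s |-> (\<open>u s\<close>, \<open>e s\<close>) with a
  line of slope \<open>chi\<close>; the sign of \<open>D\<close> tells on which side of the line the
  curve runs.\<close>

definition K :: "real \<Rightarrow> real \<Rightarrow> real set" where
  "K chi eta = {s \<in> {a<..<b}. e s = eta + chi * u s}"

definition D :: "real \<Rightarrow> real \<Rightarrow> real \<Rightarrow> real" where
  "D chi eta s = e s - (eta + chi * u s)"

lemma K_D: "s \<in> K chi eta \<longleftrightarrow> a < s \<and> s < b \<and> D chi eta s = 0"
  by (auto simp: K_def D_def)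

lemma cont_D: "continuous_on {a<..<b} (D chi eta)"
  unfolding D_def by (intro continuous_intros cont_e cont_u)

text \<open>At the left end \<open>u\<close> tends to infinity while \<open>e\<close> stays below 1,
  so a line of positive slope lies above the curve there.\<close>

lemma D_neg_left:
  assumes "chi > 0" "a < c" "c < b"
  obtains s where "a < s" "s < c" "D chi eta s < 0"
proof -
  have "eventually (\<lambda>s. u s > (1 - eta) / chi) (at_right a)"
    using u_top by (simp add: filterlim_at_top_dense)
  moreover have "eventually (\<lambda>s. s \<in> {a<..<c}) (at_right a)"
    using assms(2) by (rule eventually_at_right_real)
  ultimately have "eventually (\<lambda>s. u s > (1 - eta) / chi \<and> s \<in> {a<..<c}) (at_right a)"
    by (rule eventually_conj)
  then obtain s where s: "u s > (1 - eta) / chi" "s \<in> {a<..<c}"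
    using eventually_happens' [OF trivial_limit_at_right_real] by blast
  have "chi * u s > 1 - eta"
    using s(1) assms(1) by (simp add: field_simps)
  moreover have "e s < 1"
    using e_bound[of s] s(2) assms(3) by auto
  ultimately have "D chi eta s < 0" by (simp add: D_def)
  then show ?thesis using that s(2) by auto
qed

lemma D_pos_right:
  assumes "chi > 0" "a < c" "c < b"
  obtains s where "c < s" "s < b" "D chi eta s > 0"
proof -
  have "eventually (\<lambda>s. u s < (-1 - eta) / chi) (at_left b)"
    using u_bot by (simp add: filterlim_at_bot_dense)
  moreover have "eventually (\<lambda>s. s \<in> {c<..<b}) (at_left b)"
    using assms(3) by (rule eventually_at_left_real)
  ultimately have "eventually (\<lambda>s. u s < (-1 - eta) / chi \<and> s \<in> {c<..<b}) (at_left b)"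
    by (rule eventually_conj)
  then obtain s where s: "u s < (-1 - eta) / chi" "s \<in> {c<..<b}"
    using eventually_happens' [OF trivial_limit_at_left_real] by blast
  have "chi * u s < -1 - eta"
    using s(1) assms(1) by (simp add: field_simps)
  moreover have "e s > -1"
    using e_bound[of s] s(2) assms(2) by auto
  ultimately have "D chi eta s > 0" by (simp add: D_def)
  then show ?thesis using that s(2) by auto
qed

lemma D_zero_between:
  assumes "a < s" "s < t" "t < b" "D chi eta s * D chi eta t < 0"
  obtains r where "s < r" "r < t" "r \<in> K chi eta"
proof -
  have c: "continuous_on {s..t} (D chi eta)"
    using cont_D by (rule continuous_on_subset) (use assms in auto)
  have "\<exists>r. s \<le> r \<and> r \<le> t \<and> D chi eta r = 0"
  proof (cases "D chi eta s < 0")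
    case True
    then have "D chi eta t > 0" using assms(4) by (simp add: mult_less_0_iff)
    with True show ?thesis
      using IVT'[of "D chi eta" s 0 t] c assms(2) by auto
  next
    case False
    then have "D chi eta s > 0" "D chi eta t < 0" using assms(4) by (auto simp: mult_less_0_iff)
    then show ?thesis
      using IVT2'[of "D chi eta" t 0 s] c assms(2) by auto
  qed
  then obtain r where r: "s \<le> r" "r \<le> t" "D chi eta r = 0" by auto
  have "r \<noteq> s" "r \<noteq> t" using r(3) assms(4) by auto
  then show ?thesis using that[of r] r assms by (auto simp: K_D)
qed

lemma K_nonempty:
  assumes "chi \<noteq> 0"
  shows "K chi eta \<noteq> {}"
proof -
  define c where "c = (a + b) / 2"
  have c: "a < c" "c < b" using ab by (auto simp: c_def)
  have pos: "K chi eta \<noteq> {}" if chi: "chi > 0" for chi eta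
  proof -
    obtain s where s: "a < s" "s < c" "D chi eta s < 0" using D_neg_left[OF chi c] .
    obtain t where t: "c < t" "t < b" "D chi eta t > 0" using D_pos_right[OF chi c] .
    show ?thesis using D_zero_between[of s t chi eta] s t by (force simp: mult_less_0_iff)
  qed
  show ?thesis
  proof (cases "chi > 0")
    case True then show ?thesis by (rule pos)
  next
    case False
    then have chi: "- chi > 0" using assms by simp
    \<comment> \<open>For negative slope the two ends exchange their roles. Reflecting the line does
      not reflect \<open>e\<close>; shifting the height by 2 makes up for this because |e| <
      1.\<close>
    obtain s where s: "a < s" "s < c" "D (- chi) (- eta - 2) s < 0" using D_neg_left[OF chi c] .
    obtain t where t: "c < t" "t < b" "D (- chi) (- eta + 2) t > 0" using D_pos_right[OF chi c] .
    have "D chi eta s > 0"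
      using s(3) e_bound[of s] s c by (simp add: D_def)
    moreover have "D chi eta t < 0"
      using t(3) e_bound[of t] t c by (simp add: D_def)
    ultimately show ?thesis using D_zero_between[of s t chi eta] s t by (force simp: mult_less_0_iff)
  qed
qed

end

section \<open>Consequences of bounds on the number of intersections\<close>

locale sigmoid_family = line_family +
  assumes K1: "\<And>eta. finite (K 1 eta) \<and> card (K 1 eta) \<le> 2"
    and K3: "\<And>chi eta. 0 < chi \<Longrightarrow> chi < 1 \<Longrightarrow> finite (K chi eta) \<and> card (K chi eta) \<le> 3"
begin

text \<open>The function \<open>e - u\<close> runs from minus to plus infinity. If it took a value
  twice, it would take some value three times, against the bound for slope 1.\<close>

lemma inj_D1:
  assumes "a < s" "s < t" "t < b"
  shows "D 1 0 s \<noteq> D 1 0 t"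
proof
  assume eq: "D 1 0 s = D 1 0 t"
  have not3: False if "x1 < x2" "x2 < x3" "x1 \<in> K 1 v" "x2 \<in> K 1 v" "x3 \<in> K 1 v" for v x1 x2 x3
  proof -
    have "card {x1, x2, x3} \<le> card (K 1 v)"
      using that K1[of v] by (intro card_mono) auto
    then show False using that K1[of v] by simp
  qed
  define v where "v = D 1 0 s"
  define m where "m = (s + t) / 2"
  have m: "s < m" "m < t" using assms by (auto simp: m_def)
  have Dv: "D 1 r x = D 1 0 x - r" for r x by (simp add: D_def)
  consider "D 1 0 m = v" | "D 1 0 m > v" | "D 1 0 m < v" by linarith
  then show False
  proof cases
    case 1
    then show ?thesis
      using not3[of s m t v] m assms eq by (auto simp: K_D Dv[of v] v_def[symmetric])
  next
    case 2
    \<comment> \<open>A level inside the hump is passed on both sides of \<open>m\<close>, and once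
      more on the way to plus infinity at the right end.\<close>
    define r where "r = (D 1 0 m + v) / 2"
    have r: "v < r" "r < D 1 0 m" using 2 by (auto simp: r_def)
    obtain x1 where x1: "s < x1" "x1 < m" "x1 \<in> K 1 r"
      using D_zero_between[of s m 1 r] r m assms by (auto simp: Dv[of r] v_def mult_less_0_iff)
    obtain x2 where x2: "m < x2" "x2 < t" "x2 \<in> K 1 r"
      using D_zero_between[of m t 1 r] r m assms eq by (auto simp: Dv[of r] v_def mult_less_0_iff)
    obtain y where y: "t < y" "y < b" "D 1 r y > 0"
      using D_pos_right[of 1 t r] assms by auto
    obtain x3 where x3: "t < x3" "x3 < y" "x3 \<in> K 1 r"
      using D_zero_between[of t y 1 r] r y assms eq by (auto simp: Dv[of r] v_def mult_less_0_iff)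
    show ?thesis using not3[of x1 x2 x3 r] x1 x2 x3 by auto
  next
    case 3
    \<comment> \<open>For a dip, the third passage is found near the left end, where the function
      comes from minus infinity.\<close>
    define r where "r = (D 1 0 m + v) / 2"
    have r: "r < v" "D 1 0 m < r" using 3 by (auto simp: r_def)
    obtain x1 where x1: "s < x1" "x1 < m" "x1 \<in> K 1 r"
      using D_zero_between[of s m 1 r] r m assms by (auto simp: Dv[of r] v_def mult_less_0_iff)
    obtain x2 where x2: "m < x2" "x2 < t" "x2 \<in> K 1 r"
      using D_zero_between[of m t 1 r] r m assms eq by (auto simp: Dv[of r] v_def mult_less_0_iff)
    obtain y where y: "a < y" "y < s" "D 1 r y < 0"
      using D_neg_left[of 1 s r] assms by auto
    obtain x3 where x3: "y < x3" "x3 < s" "x3 \<in> K 1 r"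
      using D_zero_between[of y s 1 r] r y assms eq by (auto simp: Dv[of r] v_def mult_less_0_iff)
    show ?thesis using not3[of x3 x1 x2 r] x1 x2 x3 by auto
  qed
qed

text \<open>Being injective, \<open>e - u\<close> increases, and \<open>u\<close> is the decreasing
  function \<open>e\<close> minus this increasing one.\<close>

lemma u_dec:
  assumes "a < s" "s < t" "t < b"
  shows "u t < u s"
proof (rule ccontr)
  assume "\<not> u t < u s"
  moreover have "e t < e s" using e_dec assms by auto
  ultimately have lt: "D 1 0 t < D 1 0 s" by (simp add: D_def)
  define r where "r = (D 1 0 t + D 1 0 s) / 2"
  have r: "D 1 0 t < r" "r < D 1 0 s" using lt by (auto simp: r_def)
  have Dv: "D 1 r x = D 1 0 x - r" for r x by (simp add: D_def)
  obtain x1 where x1: "s < x1" "x1 < t" "x1 \<in> K 1 r"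
    using D_zero_between[of s t 1 r] r assms by (auto simp: Dv[of r] mult_less_0_iff)
  obtain y where y: "t < y" "y < b" "D 1 r y > 0"
    using D_pos_right[of 1 t r] assms by auto
  obtain x2 where x2: "t < x2" "x2 < y" "x2 \<in> K 1 r"
    using D_zero_between[of t y 1 r] r y assms by (auto simp: Dv[of r] mult_less_0_iff)
  have "D 1 0 x1 = D 1 0 x2" using x1 x2 by (auto simp: K_D Dv[of r])
  then show False using inj_D1[of x1 x2] x1 x2 assms y by auto
qed

text \<open>For negative slope, \<open>D\<close> is a sum of decreasing terms and has at most one
  zero.\<close>

lemma K_neg:
  assumes "chi > 0"
  obtains s where "K (- chi) eta = {s}"
proof -
  obtain s where s: "s \<in> K (- chi) eta"
    using K_nonempty[of "- chi" eta] assms by auto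
  have dec: "D (- chi) eta y < D (- chi) eta x" if "a < x" "x < y" "y < b" for x y
    using u_dec[OF that] e_dec[OF that] assms by (simp add: D_def add_strict_mono)
  have "x = s" if "x \<in> K (- chi) eta" for x
    using dec[of x s] dec[of s x] that s by (cases x s rule: linorder_cases) (auto simp: K_D)
  then have "K (- chi) eta = {s}" using s by blast
  then show ?thesis using that by blast
qed

text \<open>Slope 0 is exceptional: \<open>chi\<close> and \<open>- chi\<close> coincide, and the
  two ends of the oval become critical, so that a single intersection already accounts for four
  critical points.\<close>

definition region :: "(real \<times> real) set" where
  "region = {(chi, eta). \<bar>chi\<bar> < 1 \<and> \<bar>eta\<bar> < 1 \<and>
     (if chi = 0 then K 0 eta \<noteq> {} else card (K chi eta) + card (K (- chi) eta) = 4)}"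

text \<open>For positive slope this order of signs is the reverse of the one near the ends. It
  forces three intersections and, unlike a cardinality, is stable under small changes of the
  line.\<close>

definition crossing :: "real \<Rightarrow> real \<Rightarrow> bool" where
  "crossing chi eta \<longleftrightarrow> (\<exists>s t. a < s \<and> s < t \<and> t < b \<and> D chi eta s > 0 \<and> D chi eta t < 0)"

lemma card3_crossing:
  assumes chi: "0 < chi" "chi < 1" and "card (K chi eta) = 3"
  shows "crossing chi eta"
proof -
  have fin: "finite (K chi eta)" using K3 chi by auto
  obtain x1 x2 x3 where x: "x1 < x2" "x2 < x3" "{x1, x2, x3} = K chi eta"
  proof -
    let ?L = "sorted_list_of_set (K chi eta)"
    have L: "length ?L = 3" "sorted_wrt (<) ?L" "set ?L = K chi eta"
      using fin assms(3) by (auto simp: strict_sorted_list_of_set)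
    then obtain x1 x2 x3 where L': "?L = [x1, x2, x3]"
      unfolding numeral_3_eq_3 length_Suc_conv length_0_conv by blast
    show ?thesis using that[of x1 x2 x3] L(2,3) unfolding L' by auto
  qed
  have xK: "x1 \<in> K chi eta" "x2 \<in> K chi eta" "x3 \<in> K chi eta" using x(3) by auto
  have xab: "a < x1" "x3 < b" "a < x2" "x2 < b" "x1 < b" "a < x3" using xK by (auto simp: K_D)
  define m where "m = (x2 + x3) / 2"
  have m: "x2 < m" "m < x3" using x by (auto simp: m_def)
  have mne: "D chi eta m \<noteq> 0"
  proof
    assume "D chi eta m = 0"
    then have "m \<in> {x1, x2, x3}" unfolding x(3) using m xab by (auto simp: K_D)
    then show False using x(1,2) m by auto
  qed
  define l where "l = (x1 + x2) / 2"
  have l: "x1 < l" "l < x2" using x by (auto simp: l_def)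
  have lne: "D chi eta l \<noteq> 0"
  proof
    assume "D chi eta l = 0"
    then have "l \<in> {x1, x2, x3}" unfolding x(3) using l xab by (auto simp: K_D)
    then show False using x(1,2) l by auto
  qed
  text \<open>Rotating the line about its middle intersection point towards slope \<open>0\<close> creates a
    crossing on either side of the outer points, so only one more may remain in between.\<close>
  define E where "E d s = D (chi - d) (eta + d * u x2) s" for d s
  have E: "E d s = D chi eta s + d * (u s - u x2)" for d s
    by (simp add: E_def D_def algebra_simps)
  have four: False
    if "0 < d" "d < chi" "y \<in> K (chi - d) (eta + d * u x2)" "x1 < y" "y < x3" "y \<noteq> x2" for d y
  proof -
    let ?c = "chi - d" and ?h = "eta + d * u x2"
    have c: "0 < ?c" "?c < 1" using that chi by auto
    have "E d x1 > 0" using u_dec[of x1 x2] x xab xK that by (simp add: E K_D)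
    moreover obtain s where s: "a < s" "s < x1" "D ?c ?h s < 0"
      using D_neg_left[of ?c x1 ?h] c xab by auto
    ultimately obtain z1 where z1: "s < z1" "z1 < x1" "z1 \<in> K ?c ?h"
      using D_zero_between[of s x1 ?c ?h] xab by (auto simp: E_def mult_less_0_iff)
    have "E d x3 < 0" using u_dec[of x2 x3] x xab xK that by (simp add: E K_D mult_less_0_iff)
    moreover obtain t where t: "x3 < t" "t < b" "D ?c ?h t > 0"
      using D_pos_right[of ?c x3 ?h] c xab by auto
    ultimately obtain z3 where z3: "x3 < z3" "z3 < t" "z3 \<in> K ?c ?h"
      using D_zero_between[of x3 t ?c ?h] xab by (auto simp: E_def mult_less_0_iff)
    have "E d x2 = 0" using xK by (simp add: E K_D)
    then have x2: "x2 \<in> K ?c ?h" using xab by (simp add: K_D E_def)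
    have f: "finite (K ?c ?h)" "card (K ?c ?h) \<le> 3" using K3 c by auto
    have "card {z1, x2, z3, y} \<le> card (K ?c ?h)"
      using f z1 z3 x2 that by (intro card_mono) auto
    moreover have "z1 \<noteq> x2" "z1 \<noteq> z3" "z1 \<noteq> y" "x2 \<noteq> z3" "x2 \<noteq> y" "z3 \<noteq> y"
      using z1 z3 x that by auto
    ultimately show False using f by simp
  qed
  have "D chi eta l > 0"
  proof (rule ccontr)
    assume "\<not> ?thesis"
    with lne have neg: "D chi eta l < 0" by simp
    have ul: "u l - u x2 > 0" using u_dec[of l x2] l xab by auto
    \<comment> \<open>So small that the slope stays positive and that \<open>D\<close> loses at most
      half of its size at \<open>l\<close>, hence keeps its sign.\<close>
    define d where "d = min (chi / 2) (- D chi eta l / (2 * (u l - u x2)))"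
    have d: "0 < d" "d < chi" using chi neg ul by (auto simp: d_def field_simps min_def)
    have "d * (u l - u x2) \<le> (- D chi eta l / (2 * (u l - u x2))) * (u l - u x2)"
      using ul by (intro mult_right_mono) (auto simp: d_def)
    also have "\<dots> = - D chi eta l / 2" using ul by (simp add: nonzero_eq_divide_eq del: right_diff_distrib_numeral)
    finally have El: "E d l < 0" using neg by (simp add: E)
    have "E d x1 > 0" using u_dec[of x1 x2] x xab xK d by (simp add: E K_D)
    then obtain y where "x1 < y" "y < l" "y \<in> K (chi - d) (eta + d * u x2)"
      using D_zero_between[of x1 l "chi - d" "eta + d * u x2"] El l xab
      by (auto simp: E_def mult_less_0_iff)
    then show False using four[of d y] d l x by auto
  qed
  moreover have "D chi eta m < 0"
  proof (rule ccontr)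
    assume "\<not> ?thesis"
    with mne have pos: "D chi eta m > 0" by simp
    have um: "u x2 - u m > 0" using u_dec[of x2 m] m xab by auto
    define d where "d = min (chi / 2) (D chi eta m / (2 * (u x2 - u m)))"
    have d: "0 < d" "d < chi" using chi pos um by (auto simp: d_def field_simps min_def)
    have "d * (u x2 - u m) \<le> (D chi eta m / (2 * (u x2 - u m))) * (u x2 - u m)"
      using um by (intro mult_right_mono) (auto simp: d_def)
    also have "\<dots> = D chi eta m / 2" using um by (simp add: nonzero_eq_divide_eq del: right_diff_distrib_numeral)
    finally have "d * (u x2 - u m) < D chi eta m" using pos by simp
    then have Em: "E d m > 0" by (simp add: E algebra_simps)
    have "E d x3 < 0" using u_dec[of x2 x3] x xab xK d by (simp add: E K_D mult_less_0_iff)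
    then obtain y where "m < y" "y < x3" "y \<in> K (chi - d) (eta + d * u x2)"
      using D_zero_between[of m x3 "chi - d" "eta + d * u x2"] Em m xab
      by (auto simp: E_def mult_less_0_iff)
    then show False using four[of d y] d m x by auto
  qed
  ultimately show ?thesis
    unfolding crossing_def using l m xab by (intro exI[of _ l] exI[of _ m]) auto
qed

text \<open>From left to right the signs are -, +, -, +, which gives three zeros, and
  \<open>K3\<close> allows no more.\<close>

lemma crossing_card3:
  assumes chi: "0 < chi" "chi < 1" and "crossing chi eta"
  shows "card (K chi eta) = 3"
proof -
  obtain s t where st: "a < s" "s < t" "t < b" "D chi eta s > 0" "D chi eta t < 0"
    using assms(3) by (auto simp: crossing_def)
  obtain s' where s': "a < s'" "s' < s" "D chi eta s' < 0"
    using D_neg_left[of chi s eta] chi st by auto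
  obtain t' where t': "t < t'" "t' < b" "D chi eta t' > 0"
    using D_pos_right[of chi t eta] chi st by auto
  obtain x1 where x1: "s' < x1" "x1 < s" "x1 \<in> K chi eta"
    using D_zero_between[of s' s chi eta] s' st by (auto simp: mult_less_0_iff)
  obtain x2 where x2: "s < x2" "x2 < t" "x2 \<in> K chi eta"
    using D_zero_between[of s t chi eta] st by (auto simp: mult_less_0_iff)
  obtain x3 where x3: "t < x3" "x3 < t'" "x3 \<in> K chi eta"
    using D_zero_between[of t t' chi eta] t' st by (auto simp: mult_less_0_iff)
  have "card {x1, x2, x3} \<le> card (K chi eta)"
    using K3[OF chi] x1 x2 x3 by (intro card_mono) auto
  moreover have "card {x1, x2, x3} = 3" using x1 x2 x3 by simp
  ultimately show ?thesis using K3[OF chi, of eta] by simp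
qed

text \<open>A horizontal line can only be crossed downwards, since \<open>e\<close> strictly
  decreases.\<close>

lemma crossing_zero: "crossing 0 eta \<longleftrightarrow> K 0 eta \<noteq> {}"
proof
  assume "crossing 0 eta"
  then obtain s t where st: "a < s" "s < t" "t < b" "D 0 eta s > 0" "D 0 eta t < 0"
    by (auto simp: crossing_def)
  then show "K 0 eta \<noteq> {}"
    using D_zero_between[of s t 0 eta] by (auto simp: mult_less_0_iff)
next
  assume "K 0 eta \<noteq> {}"
  then obtain r where r: "a < r" "r < b" "D 0 eta r = 0" by (auto simp: K_D)
  define s where "s = (a + r) / 2"
  define t where "t = (r + b) / 2"
  have st: "a < s" "s < r" "r < t" "t < b" using r by (auto simp: s_def t_def)
  have "e r < e s" "e t < e r" using e_dec st r by auto
  then show "crossing 0 eta" unfolding crossing_def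
    using st r by (intro exI[of _ s] exI[of _ t]) (auto simp: D_def)
qed

lemma region_eq: "region = {(chi, eta). \<bar>chi\<bar> < 1 \<and> \<bar>eta\<bar> < 1 \<and> crossing \<bar>chi\<bar> eta}"
proof -
  have main: "card (K chi eta) + card (K (- chi) eta) = 4 \<longleftrightarrow> crossing chi eta"
    if chi: "0 < chi" "chi < 1" for chi eta
  proof -
    obtain s where "K (- chi) eta = {s}" using K_neg chi by blast
    then have "card (K (- chi) eta) = 1" by simp
    then show ?thesis
      using crossing_card3[OF chi, of eta] card3_crossing[OF chi, of eta] by auto
  qed
  have "(if chi = 0 then K 0 eta \<noteq> {} else card (K chi eta) + card (K (- chi) eta) = 4)
      \<longleftrightarrow> crossing \<bar>chi\<bar> eta" if "\<bar>chi\<bar> < 1" for chi eta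
  proof -
    consider "chi = 0" | "chi > 0" | "chi < 0" by linarith
    then show ?thesis
    proof cases
      case 1 then show ?thesis by (simp add: crossing_zero)
    next
      case 2 then show ?thesis using main[of chi eta] that by simp
    next
      case 3 then show ?thesis using main[of "- chi" eta] that by (simp add: add.commute)
    qed
  qed
  then show ?thesis
    unfolding region_def by (intro Collect_cong) (simp only: split_beta, blast)
qed

text \<open>For fixed \<open>s\<close> and \<open>t\<close> the sign conditions are open in slope
  and height; the region is their union over all pairs.\<close>

lemma open_region: "open region"
proof -
  have "region = (\<Union>s\<in>{a<..<b}. \<Union>t\<in>{s<..<b}.
      {p. \<bar>fst p\<bar> < 1 \<and> \<bar>snd p\<bar> < 1 \<and> D \<bar>fst p\<bar> (snd p) s > 0 \<and> D \<bar>fst p\<bar> (snd p) t < 0})"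
    by (force simp: region_eq crossing_def)
  moreover have "open {p. \<bar>fst p\<bar> < 1 \<and> \<bar>snd p\<bar> < 1 \<and>
      D \<bar>fst p\<bar> (snd p) s > 0 \<and> D \<bar>fst p\<bar> (snd p) t < 0}" for s t
    unfolding D_def by (intro open_Collect_conj open_Collect_less continuous_intros)
  ultimately show ?thesis by (simp add: open_UN)
qed

section \<open>Connectedness by rotating lines\<close>

definition axis :: "(real \<times> real) set" where
  "axis = (\<lambda>s. (0, e s)) ` {a<..<b}"

lemma axis_subset: "axis \<subseteq> region"
  using e_bound by (auto simp: axis_def region_def K_def)

lemma connected_axis: "connected axis"
  unfolding axis_def by (intro connected_continuous_image continuous_intros cont_e) auto

lemma axis_nonempty: "axis \<noteq> {}"
  using ab by (simp add: axis_def)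

text \<open>Rotating the line about a middle intersection point until its slope vanishes stays inside
  the region.\<close>
lemma region_to_axis:
  assumes "P \<in> region"
  obtains Q where "Q \<in> axis" "closed_segment Q P \<subseteq> region"
proof -
  obtain chi eta where P: "P = (chi, eta)" by (cases P)
  have chi: "\<bar>chi\<bar> < 1" "\<bar>eta\<bar> < 1" "crossing \<bar>chi\<bar> eta" using assms by (auto simp: P region_eq)
  obtain s t where st: "a < s" "s < t" "t < b" "D \<bar>chi\<bar> eta s > 0" "D \<bar>chi\<bar> eta t < 0"
    using chi(3) by (auto simp: crossing_def)
  obtain r where r: "s < r" "r < t" "r \<in> K \<bar>chi\<bar> eta"
    using D_zero_between[of s t "\<bar>chi\<bar>" eta] st by (auto simp: mult_less_0_iff)
  have er: "e r = eta + \<bar>chi\<bar> * u r" using r by (auto simp: K_def)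
  have u: "u r < u s" "u t < u r" using u_dec st r by auto
  have e1: "\<bar>e r\<bar> < 1" using e_bound st r by auto
  have "closed_segment (0, e r) P \<subseteq> region"
  proof
    fix R assume "R \<in> closed_segment (0, e r) P"
    then obtain l where l: "0 \<le> l" "l \<le> 1" "R = (1 - l) *\<^sub>R (0, e r) + l *\<^sub>R P"
      by (auto simp: in_segment)
    then have R: "R = (l * chi, (1 - l) * e r + l * eta)" by (simp add: P)
    have "\<bar>l * chi\<bar> < 1"
    proof -
      have "\<bar>l * chi\<bar> \<le> \<bar>chi\<bar>"
        using l by (simp add: abs_mult mult_left_le_one_le)
      then show ?thesis using chi(1) by linarith
    qed
    moreover have "\<bar>(1 - l) * e r + l * eta\<bar> < 1"
    proof (cases "l = 0")
      case False
      have "\<bar>(1 - l) * e r + l * eta\<bar> \<le> (1 - l) * \<bar>e r\<bar> + l * \<bar>eta\<bar>"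
        using l by (intro order_trans[OF abs_triangle_ineq]) (simp add: abs_mult)
      also have "\<dots> < (1 - l) * 1 + l * 1"
        using l False chi e1 by (intro add_le_less_mono mult_left_mono mult_strict_left_mono) auto
      finally show ?thesis by simp
    qed (use e1 in simp)
    moreover have "crossing \<bar>l * chi\<bar> ((1 - l) * e r + l * eta)"
    proof -
      \<comment> \<open>All lines on the segment pass through the intersection at \<open>r\<close>.
        Lowering the slope adds a term with the sign of \<open>u y - u r\<close>, which is positive
        at \<open>s\<close> and negative at \<open>t\<close>.\<close>
      have eq: "D \<bar>l * chi\<bar> ((1 - l) * e r + l * eta) y
          = D \<bar>chi\<bar> eta y + (1 - l) * \<bar>chi\<bar> * (u y - u r)" for y
        using l by (simp add: D_def er abs_mult algebra_simps)
      have "D \<bar>l * chi\<bar> ((1 - l) * e r + l * eta) s > 0"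
        unfolding eq using st u l by (intro add_pos_nonneg) auto
      moreover have "D \<bar>l * chi\<bar> ((1 - l) * e r + l * eta) t < 0"
        unfolding eq using st u l
        by (intro add_neg_nonpos) (auto intro!: mult_nonneg_nonpos mult_nonneg_nonneg)
      ultimately show ?thesis unfolding crossing_def using st by blast
    qed
    ultimately show "R \<in> region" by (simp add: R region_eq)
  qed
  moreover have "(0, e r) \<in> axis" using st r by (auto simp: axis_def)
  ultimately show ?thesis using that by blast
qed

text \<open>The axis together with one segment ending in it is connected, and the region is a union
  of such sets, which all contain the axis.\<close>

lemma connected_region: "connected region"
proof -
  have ex: "\<exists>Q. Q \<in> axis \<and> closed_segment Q P \<subseteq> region" if "P \<in> region" for P
    using region_to_axis[OF that] by blast
  then obtain Q where Q: "Q P \<in> axis" "closed_segment (Q P) P \<subseteq> region" if "P \<in> region" for P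
    by metis
  have "region = \<Union>((\<lambda>P. axis \<union> closed_segment (Q P) P) ` region)"
  proof
    show "region \<subseteq> \<Union>((\<lambda>P. axis \<union> closed_segment (Q P) P) ` region)"
      by auto
    show "\<Union>((\<lambda>P. axis \<union> closed_segment (Q P) P) ` region) \<subseteq> region"
      using Q(2) axis_subset by blast
  qed
  moreover have "connected (\<Union>((\<lambda>P. axis \<union> closed_segment (Q P) P) ` region))"
  proof (rule connected_Union)
    fix S assume "S \<in> (\<lambda>P. axis \<union> closed_segment (Q P) P) ` region"
    then obtain P where P: "P \<in> region" "S = axis \<union> closed_segment (Q P) P" by blast
    have "Q P \<in> axis \<inter> closed_segment (Q P) P" using Q(1)[OF P(1)] by simp
    then show "connected S"
      unfolding P(2) by (intro connected_Un connected_axis connected_segment) auto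
  next
    show "\<Inter>((\<lambda>P. axis \<union> closed_segment (Q P) P) ` region) \<noteq> {}"
      using axis_nonempty by blast
  qed
  ultimately show ?thesis by simp
qed

lemma region_nonempty: "region \<noteq> {}"
  using axis_subset axis_nonempty by auto

end

section \<open>Counting critical points on the ovals\<close>

text \<open>Here n = k' - 1, \<open>P\<close> is the real form of p0 and \<open>H\<close> is h
  scaled by 2/k; the last assumption is h(1)^2 = k^2 p0(1) after this scaling.\<close>

locale oval_data =
  fixes n :: nat and x :: "nat \<Rightarrow> real" and P H :: "real poly"
  assumes x0: "x 0 = 0"
    and x_dec: "\<And>i. i < 2 * n \<Longrightarrow> x (Suc i) < x i"
    and degP: "degree P \<le> 2 * n + 1"
    and degH: "degree H \<le> n"
    and P_root: "\<And>i. i \<le> 2 * n \<Longrightarrow> poly P (x i) = 0"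
    and P_pos: "\<And>l s. l \<in> {1..n} \<Longrightarrow> x (2 * l) < s \<Longrightarrow> s < x (2 * l - 1) \<Longrightarrow> poly P s > 0"
    and H_sign: "\<And>l. l \<in> {1..n} \<Longrightarrow> poly H (x (2 * l)) * poly H (x (2 * l - 1)) < 0"
    and H_one: "(poly H 1)\<^sup>2 = 4 * poly P 1"
begin

definition ea :: "nat \<Rightarrow> real" where "ea l = x (2 * l)"
definition eb :: "nat \<Rightarrow> real" where "eb l = x (2 * l - 1)"

definition e :: "real \<Rightarrow> real" where "e s = (s + 1) / (s - 1)"
text \<open>The sign makes \<open>u\<close> tend to plus infinity at the left end of every oval;
  changing it amounts to exchanging the sheets.\<close>

definition u :: "nat \<Rightarrow> real \<Rightarrow> real" where
  "u l s = sgn (poly H (ea l)) * (s * poly H s / (s - 1)) * inverse (sqrt (poly P s))"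

abbreviation Kl :: "nat \<Rightarrow> real \<Rightarrow> real \<Rightarrow> real set" where
  "Kl l \<equiv> line_family.K (ea l) (eb l) e (u l)"

definition crit :: "nat \<Rightarrow> real \<Rightarrow> real \<Rightarrow> (real \<times> real) set" where
  "crit l chi eta = {(s, w). ea l \<le> s \<and> s \<le> eb l \<and> w\<^sup>2 = poly P s \<and>
      (eta * (s - 1) - (s + 1)) * w = chi * s * poly H s}"

lemma x_less: "i < j \<Longrightarrow> j \<le> 2 * n \<Longrightarrow> x j < x i"
proof (induction j)
  case (Suc j)
  have "x (Suc j) < x j" using Suc.prems(2) by (intro x_dec) linarith
  moreover have "x j \<le> x i" using Suc by (cases "i = j") auto
  ultimately show ?case by linarith
qed simp

lemma x_neg: "0 < i \<Longrightarrow> i \<le> 2 * n \<Longrightarrow> x i < 0"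
  using x_less[of 0 i] x0 by simp

section \<open>The critical equation on a single oval\<close>

context
  fixes l assumes l: "l \<in> {1..n}"
begin

lemma ab: "ea l < eb l" "eb l < 0"
  using x_less[of "2 * l - 1" "2 * l"] x_neg[of "2 * l - 1"] l by (auto simp: ea_def eb_def)

lemma P_pos': "ea l < s \<Longrightarrow> s < eb l \<Longrightarrow> poly P s > 0"
  using P_pos[OF l] by (auto simp: ea_def eb_def)

lemma P_end: "poly P (ea l) = 0" "poly P (eb l) = 0"
  using l by (auto simp: ea_def eb_def intro!: P_root)

lemma H_end: "poly H (ea l) * poly H (eb l) < 0" "poly H (ea l) \<noteq> 0" "poly H (eb l) \<noteq> 0"
  using H_sign[OF l] by (auto simp: ea_def eb_def)

text \<open>\<open>s / (s - 1)\<close> is positive for negative \<open>s\<close> and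
  \<open>H\<close> changes sign over the oval, so the numerator is positive at the left end and
  negative at the right one, while \<open>P\<close> vanishes at both.\<close>

lemma u_tendsto: "filterlim (u l) at_top (at_right (ea l))" "filterlim (u l) at_bot (at_left (eb l))"
proof -
  define f where "f s = sgn (poly H (ea l)) * (s * poly H s / (s - 1))" for s
  have u: "u l = (\<lambda>s. f s * inverse (sqrt (poly P s)))"
    by (auto simp: u_def f_def)
  have contf: "isCont f s" if "s < 0" for s
    using that unfolding f_def by (intro continuous_intros) auto
  have contP: "isCont (\<lambda>s. sqrt (poly P s)) s" for s
    by (intro continuous_intros)
  have quot: "ea l / (ea l - 1) > 0" "eb l / (eb l - 1) > 0"
    using ab by (auto intro: divide_neg_neg)
  have "f (ea l) = (ea l / (ea l - 1)) * \<bar>poly H (ea l)\<bar>"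
    by (simp add: f_def abs_sgn field_simps)
  then have fa: "f (ea l) > 0" using quot H_end by (simp only: zero_less_mult_iff zero_less_abs_iff) simp
  have "f (eb l) = (eb l / (eb l - 1)) * (sgn (poly H (ea l)) * poly H (eb l))"
    by (simp add: f_def)
  moreover have "sgn (poly H (ea l)) * poly H (eb l) < 0"
    using H_end by (auto simp: sgn_if mult_less_0_iff)
  ultimately have fb: "f (eb l) < 0" using quot by (simp only: mult_pos_neg)
  have "eventually (\<lambda>s. sqrt (poly P s) > 0) (at_right (ea l))"
    using eventually_at_right_real[OF ab(1)] by eventually_elim (auto intro: P_pos')
  moreover have "((\<lambda>s. sqrt (poly P s)) \<longlongrightarrow> 0) (at_right (ea l))"
    using contP[of "ea l"] P_end by (auto simp: isCont_def intro: filterlim_at_split[THEN iffD1, THEN conjunct2])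
  ultimately have "filterlim (\<lambda>s. inverse (sqrt (poly P s))) at_top (at_right (ea l))"
    by (intro filterlim_inverse_at_top)
  moreover have "(f \<longlongrightarrow> f (ea l)) (at_right (ea l))"
    using contf[of "ea l"] ab by (auto simp: isCont_def intro: filterlim_at_split[THEN iffD1, THEN conjunct2])
  ultimately show "filterlim (u l) at_top (at_right (ea l))"
    unfolding u using fa by (intro filterlim_tendsto_pos_mult_at_top)
  have "eventually (\<lambda>s. sqrt (poly P s) > 0) (at_left (eb l))"
    using eventually_at_left_real[OF ab(1)] by eventually_elim (auto intro: P_pos')
  moreover have "((\<lambda>s. sqrt (poly P s)) \<longlongrightarrow> 0) (at_left (eb l))"
    using contP[of "eb l"] P_end by (auto simp: isCont_def intro: filterlim_at_split[THEN iffD1, THEN conjunct1])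
  ultimately have "filterlim (\<lambda>s. inverse (sqrt (poly P s))) at_top (at_left (eb l))"
    by (intro filterlim_inverse_at_top)
  moreover have "(f \<longlongrightarrow> f (eb l)) (at_left (eb l))"
    using contf[of "eb l"] ab by (auto simp: isCont_def intro: filterlim_at_split[THEN iffD1, THEN conjunct1])
  ultimately show "filterlim (u l) at_bot (at_left (eb l))"
    unfolding u using fb by (intro filterlim_tendsto_neg_mult_at_bot)
qed

lemma line_family_oval: "line_family (ea l) (eb l) e (u l)"
proof
  have neg: "s < 0" if "s \<in> {ea l<..<eb l}" for s using that ab by auto
  show "continuous_on {ea l<..<eb l} e"
    unfolding e_def using neg by (intro continuous_intros) force
  have "sqrt (poly P s) \<noteq> 0" if "s \<in> {ea l<..<eb l}" for s using P_pos'[of s] that by auto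
  then show "continuous_on {ea l<..<eb l} (u l)"
    unfolding u_def using neg by (intro continuous_intros) force+
  show "e t < e s" if "ea l < s" "s < t" "t < eb l" for s t
    using that ab by (auto simp: e_def divide_simps) (auto simp: algebra_simps)
  show "\<bar>e s\<bar> < 1" if "ea l < s" "s < eb l" for s
    using that ab by (auto simp: e_def abs_if divide_simps)
qed (use ab u_tendsto in auto)

lemma K_iff: "s \<in> Kl l chi eta \<longleftrightarrow> ea l < s \<and> s < eb l \<and> e s = eta + chi * u l s"
  by (auto simp: line_family.K_def[OF line_family_oval])

lemma K_nonempty: "chi \<noteq> 0 \<Longrightarrow> Kl l chi eta \<noteq> {}"
  using line_family.K_nonempty[OF line_family_oval] .

lemma lin_e: "s < 0 \<Longrightarrow> eta * (s - 1) - (s + 1) = (s - 1) * (eta - e s)"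
  by (simp add: e_def field_simps)

lemma sgn_cases: "sgn (poly H (ea l)) = 1 \<or> sgn (poly H (ea l)) = -1"
  using H_end by (auto simp: sgn_if)

text \<open>On the sheets w = sqrt P and w = - sqrt P, division by (s - 1) w turns the equation into
  line equations with opposite slopes.\<close>

lemma crit_eq: 
  assumes "chi \<noteq> 0"
  shows "crit l chi eta =
     (\<lambda>s. (s, sqrt (poly P s))) ` Kl l (- chi * sgn (poly H (ea l))) eta \<union>
     (\<lambda>s. (s, - sqrt (poly P s))) ` Kl l (chi * sgn (poly H (ea l))) eta" (is "_ = ?R")
proof -
  let ?g = "sgn (poly H (ea l))"
  have gg: "?g * ?g = 1" using sgn_cases by auto
  have key: "(eta * (s - 1) - (s + 1)) * (d * sqrt (poly P s)) = chi * s * poly H s \<longleftrightarrow>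
      s \<in> Kl l (- d * chi * ?g) eta" if s: "ea l < s" "s < eb l" and d: "d = 1 \<or> d = -1" for s d
  proof -
    define r where "r = sqrt (poly P s)"
    have r: "r > 0" using P_pos'[OF s] by (simp add: r_def)
    have s1: "s < 0" using s ab by simp
    define m where "m = s * poly H s / (s - 1)"
    have m: "chi * s * poly H s = (s - 1) * (chi * m)" using s1 by (simp add: m_def)
    have "?g * u l s = (?g * ?g) * m * inverse r"
      by (simp add: u_def r_def m_def)
    then have u: "- d * chi * ?g * u l s = - d * chi * m / r"
      using gg by (simp add: divide_inverse mult.assoc)
    have "(eta * (s - 1) - (s + 1)) * (d * r) = chi * s * poly H s \<longleftrightarrow>
        (s - 1) * ((eta - e s) * d * r) = (s - 1) * (chi * m)"
      unfolding m lin_e[OF s1] by (simp only: mult_ac)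
    also have "\<dots> \<longleftrightarrow> (eta - e s) * d * r = chi * m"
      using s1 by simp
    also have "\<dots> \<longleftrightarrow> (eta - e s) * d = chi * m / r"
      using r by (simp add: eq_divide_eq)
    also have "\<dots> \<longleftrightarrow> e s = eta + (- d * chi * m / r)"
      using d by auto
    also have "\<dots> \<longleftrightarrow> s \<in> Kl l (- d * chi * ?g) eta"
      unfolding K_iff u using s by simp
    finally show ?thesis by (simp add: r_def)
  qed
  \<comment> \<open>At an end w = 0, and the equation would force \<open>H\<close> to vanish
    there.\<close>
  have ends: "ea l < s \<and> s < eb l" if "(s, w) \<in> crit l chi eta" for s w
  proof -
    have "s \<noteq> ea l" "s \<noteq> eb l" using that P_end H_end ab assms by (auto simp: crit_def)
    then show ?thesis using that by (auto simp: crit_def)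
  qed
  show ?thesis
  proof (rule set_eqI, clarify)
    fix s w
    show "(s, w) \<in> crit l chi eta \<longleftrightarrow> (s, w) \<in> ?R"
    proof
      assume c: "(s, w) \<in> crit l chi eta"
      then have s: "ea l < s" "s < eb l" using ends by auto
      have "w\<^sup>2 = (sqrt (poly P s))\<^sup>2" using c P_pos'[OF s] by (simp add: crit_def)
      then have "w = sqrt (poly P s) \<or> w = - sqrt (poly P s)" by (simp add: power2_eq_iff)
      then show "(s, w) \<in> ?R"
        using key[OF s, of 1] key[OF s, of "-1"] c by (auto simp: crit_def)
    next
      assume "(s, w) \<in> ?R"
      then obtain d where d: "d = 1 \<or> d = -1" "w = d * sqrt (poly P s)" "s \<in> Kl l (- d * chi * ?g) eta"
        by force
      then have s: "ea l < s" "s < eb l" by (auto simp: K_iff)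
      have "w\<^sup>2 = poly P s" using P_pos'[OF s] d by (auto simp: power_mult_distrib)
      then show "(s, w) \<in> crit l chi eta"
        using key[OF s d(1)] d s by (auto simp: crit_def)
    qed
  qed
qed

lemma card_crit:
  assumes "chi \<noteq> 0" "finite (Kl l chi eta)" "finite (Kl l (- chi) eta)"
  shows "card (crit l chi eta) = card (Kl l chi eta) + card (Kl l (- chi) eta)"
proof -
  let ?g = "sgn (poly H (ea l))"
  have fin: "finite (Kl l (chi * ?g) eta)" "finite (Kl l (- chi * ?g) eta)"
    using sgn_cases assms by auto
  have "card (crit l chi eta) = card (Kl l (- chi * ?g) eta) + card (Kl l (chi * ?g) eta)"
    unfolding crit_eq[OF assms(1)]
  proof (subst card_Un_disjoint)
    have "sqrt (poly P s) \<noteq> - sqrt (poly P s)" if "s \<in> Kl l c eta" for s c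
      using P_pos'[of s] that by (auto simp: K_iff)
    then show "(\<lambda>s. (s, sqrt (poly P s))) ` Kl l (- chi * ?g) eta \<inter>
        (\<lambda>s. (s, - sqrt (poly P s))) ` Kl l (chi * ?g) eta = {}" by auto
  qed (use fin in \<open>auto simp: card_image inj_on_def\<close>)
  then show ?thesis using sgn_cases by auto
qed

text \<open>Up to a nonzero factor the equation is now (eta - e s) w = 0. Both branch points always
  solve it; a height attained by \<open>e\<close> inside the oval adds the two points above its
  unique preimage.\<close>

lemma card_crit_0: "card (crit l 0 eta) = 4 \<longleftrightarrow> Kl l 0 eta \<noteq> {}"
proof
  assume c: "card (crit l 0 eta) = 4"
  show "Kl l 0 eta \<noteq> {}"
  proof
    assume K: "Kl l 0 eta = {}"
    have "crit l 0 eta \<subseteq> {(ea l, 0), (eb l, 0)}"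
    proof (rule subrelI)
      fix s w assume sw: "(s, w) \<in> crit l 0 eta"
      have s: "ea l \<le> s" "s \<le> eb l" "s < 0" using sw ab by (auto simp: crit_def)
      have nK: "\<not> (ea l < s \<and> s < eb l \<and> e s = eta)" using K K_iff[of s 0 eta] by auto
      show "(s, w) \<in> {(ea l, 0), (eb l, 0)}"
      proof (cases "s = ea l \<or> s = eb l")
        case True
        then have "w = 0" using sw P_end by (auto simp: crit_def)
        then show ?thesis using True by auto
      next
        case False
        then have "e s \<noteq> eta" "poly P s > 0" using nK s P_pos'[of s] by auto
        moreover have "(s - 1) * (eta - e s) * w = 0"
          using sw unfolding lin_e[OF s(3), symmetric] by (simp add: crit_def)
        ultimately have "w = 0" "poly P s > 0" using s by auto
        then show ?thesis using sw by (auto simp: crit_def)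
      qed
    qed
    then have "card (crit l 0 eta) \<le> card {(ea l, 0::real), (eb l, 0)}"
      by (intro card_mono) auto
    also have "\<dots> \<le> 2" by (simp add: card_insert_if)
    finally show False using c by simp
  qed
next
  assume "Kl l 0 eta \<noteq> {}"
  then obtain r where "r \<in> Kl l 0 eta" by blast
  then have r: "ea l < r" "r < eb l" "e r = eta" by (auto simp: K_iff)
  have Pr: "poly P r > 0" using P_pos' r by auto
  have "crit l 0 eta = {(ea l, 0), (eb l, 0), (r, sqrt (poly P r)), (r, - sqrt (poly P r))}"
  proof (rule set_eqI, clarify)
    fix s w
    have inj: "s = r" if "s < 0" "e s = e r"
    proof -
      have "(s + 1) * (r - 1) = (r + 1) * (s - 1)"
        using that r ab by (simp add: e_def frac_eq_eq)
      then show ?thesis by (simp add: algebra_simps)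
    qed
    show "(s, w) \<in> crit l 0 eta \<longleftrightarrow>
        (s, w) \<in> {(ea l, 0), (eb l, 0), (r, sqrt (poly P r)), (r, - sqrt (poly P r))}"
    proof
      assume sw: "(s, w) \<in> crit l 0 eta"
      have s: "ea l \<le> s" "s \<le> eb l" "s < 0" using sw ab by (auto simp: crit_def)
      have "(s - 1) * (eta - e s) * w = 0"
        using sw unfolding lin_e[OF s(3), symmetric] by (simp add: crit_def)
      then consider "w = 0" | "e s = eta" using s by auto
      then show "(s, w) \<in> {(ea l, 0), (eb l, 0), (r, sqrt (poly P r)), (r, - sqrt (poly P r))}"
      proof cases
        case 1
        then have "poly P s = 0" using sw by (simp add: crit_def)
        then have "\<not> (ea l < s \<and> s < eb l)" using P_pos'[of s] by auto
        then have "s = ea l \<or> s = eb l" using s by linarith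
        then show ?thesis using 1 by blast
      next
        case 2
        then have "s = r" using inj s r by auto
        moreover have "w\<^sup>2 = (sqrt (poly P s))\<^sup>2" using sw \<open>s = r\<close> Pr by (simp add: crit_def)
        ultimately show ?thesis by (simp add: power2_eq_iff)
      qed
    next
      assume "(s, w) \<in> {(ea l, 0), (eb l, 0), (r, sqrt (poly P r)), (r, - sqrt (poly P r))}"
      moreover have "eta * (r - 1) - (r + 1) = 0"
        using r ab by (simp add: lin_e)
      ultimately show "(s, w) \<in> crit l 0 eta"
        using P_end ab r Pr by (auto simp: crit_def)
    qed
  qed
  moreover have "sqrt (poly P r) \<noteq> - sqrt (poly P r)" using Pr by auto
  ultimately show "card (crit l 0 eta) = 4"
    using r ab by (simp add: card_insert_if)
qed

end

section \<open>Roots of the squared critical equation\<close>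

definition N :: "real \<Rightarrow> real \<Rightarrow> real poly" where
  "N chi eta = [: - (eta + 1), eta - 1 :]\<^sup>2 * P - smult (chi\<^sup>2) ([:0, 1:]\<^sup>2 * H\<^sup>2)"

lemma poly_N: "poly (N chi eta) s = (eta * (s - 1) - (s + 1))\<^sup>2 * poly P s - chi\<^sup>2 * s\<^sup>2 * (poly H s)\<^sup>2"
  by (simp add: N_def algebra_simps power2_eq_square)

lemma degree_N: "degree (N chi eta) \<le> 2 * n + 3"
proof -
  have "degree ([: - (eta + 1), eta - 1 :]\<^sup>2) \<le> 1 * 2"
    by (intro order_trans[OF degree_power_le] mult_right_mono) auto
  then have 1: "degree ([: - (eta + 1), eta - 1 :]\<^sup>2 * P) \<le> 2 * n + 3"
    using degP by (intro order_trans[OF degree_mult_le]) simp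
  have "degree (H\<^sup>2) \<le> 2 * n" using degH by (intro order_trans[OF degree_power_le]) simp
  moreover have "degree ([:0, 1:]\<^sup>2 :: real poly) \<le> 1 * 2"
    by (intro order_trans[OF degree_power_le] mult_right_mono) auto
  ultimately have 2: "degree (smult (chi\<^sup>2) ([:0, 1:]\<^sup>2 * H\<^sup>2)) \<le> 2 * n + 3"
    by (intro order_trans[OF degree_smult_le] order_trans[OF degree_mult_le]) simp
  show ?thesis unfolding N_def by (intro degree_diff_le 1 2)
qed

text \<open>At the left end of the first oval \<open>P\<close> vanishes and \<open>H\<close> does
  not.\<close>

lemma N_nonzero:
  assumes "chi \<noteq> 0" "n \<ge> 1"
  shows "N chi eta \<noteq> 0"
proof
  assume "N chi eta = 0"
  then have "poly (N chi eta) (ea 1) = 0" by simp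
  then show False using P_end(1)[of 1] H_end(2)[of 1] ab[of 1] assms by (simp add: poly_N)
qed

lemma N_root:
  assumes l: "l \<in> {1..n}" and s: "s \<in> Kl l chi eta \<union> Kl l (- chi) eta"
  shows "poly (N chi eta) s = 0"
proof -
  have s': "ea l < s" "s < eb l" using s by (auto simp: K_iff[OF l])
  have neg: "s < 0" using s' ab[OF l] by simp
  have P: "poly P s > 0" using P_pos'[OF l] s' by auto
  have "(eta - e s)\<^sup>2 = (chi * u l s)\<^sup>2" using s by (auto simp: K_iff[OF l] power2_eq_square)
  also have "\<dots> * poly P s = chi\<^sup>2 * (sgn (poly H (ea l)))\<^sup>2 * (s * poly H s / (s - 1))\<^sup>2 *
      (inverse (sqrt (poly P s)) * sqrt (poly P s))\<^sup>2"
    unfolding u_def power_mult_distrib using P by (simp add: mult_ac)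
  also have "\<dots> = chi\<^sup>2 * (s * poly H s / (s - 1))\<^sup>2"
    using sgn_cases[OF l] P by auto
  finally have "(s - 1)\<^sup>2 * ((eta - e s)\<^sup>2 * poly P s) = (s - 1)\<^sup>2 * (chi\<^sup>2 * (s * poly H s / (s - 1))\<^sup>2)"
    by simp
  also have "\<dots> = chi\<^sup>2 * s\<^sup>2 * (poly H s)\<^sup>2"
    using neg by (simp add: power_divide power_mult_distrib)
  finally show ?thesis
    using neg by (simp add: poly_N lin_e[OF l] power_mult_distrib)
qed

text \<open>A point on the lines of both slopes has u = 0 and e = eta. Then \<open>H\<close> and the
  linear factor vanish, both of which enter \<open>N\<close> squared, so the point may be counted
  once for either slope.\<close>

lemma N_double_root:
  assumes l: "l \<in> {1..n}" and s: "s \<in> Kl l chi eta \<inter> Kl l (- chi) eta"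
    and "N chi eta \<noteq> 0" "chi \<noteq> 0"
  shows "order s (N chi eta) \<ge> 2"
proof -
  have s': "ea l < s" "s < eb l" using s by (auto simp: K_iff[OF l])
  have neg: "s < 0" using s' ab[OF l] by simp
  have P: "poly P s > 0" using P_pos'[OF l] s' by auto
  have "u l s = 0" "e s = eta" using s assms(4) by (auto simp: K_iff[OF l])
  then have H: "poly H s = 0" and A: "eta * (s - 1) - (s + 1) = 0"
    using sgn_cases[OF l] neg P by (auto simp: u_def lin_e[OF l])
  have "[:-s, 1:] dvd H" using H by (simp add: poly_eq_0_iff_dvd)
  moreover have "[:-s, 1:] dvd [: - (eta + 1), eta - 1 :]"
    using A by (simp add: poly_eq_0_iff_dvd[symmetric] algebra_simps)
  ultimately have "[:-s, 1:]\<^sup>2 dvd N chi eta"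
    unfolding N_def by (intro dvd_diff dvd_mult2 dvd_smult dvd_mult dvd_power_same)
  then show ?thesis using assms(3) by (simp add: order_divides)
qed

lemma intervals_disjoint:
  assumes "l \<in> {1..n}" "l' \<in> {1..n}" "l \<noteq> l'"
  shows "{ea l<..<eb l} \<inter> {ea l'<..<eb l'} = {}"
proof -
  have "eb j < ea i" if "i < j" "j \<in> {1..n}" for i j
    using that x_less[of "2 * i" "2 * j - 1"] by (auto simp: ea_def eb_def)
  then have "eb l' < ea l \<or> eb l < ea l'" using assms by (metis linorder_neqE_nat)
  then show ?thesis by auto
qed

lemma finite_K:
  assumes "l \<in> {1..n}" "chi \<noteq> 0"
  shows "finite (Kl l chi eta)"
proof -
  have "Kl l chi eta \<subseteq> {s. poly (N chi eta) s = 0}" using N_root[OF assms(1)] by auto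
  moreover have "finite {s. poly (N chi eta) s = 0}"
    using assms by (intro poly_roots_finite N_nonzero) auto
  ultimately show ?thesis by (rule finite_subset)
qed

text \<open>The degree 2n + 3 bounds the roots with multiplicity, and the roots 0 and, for |chi| =
  1, also 1 lie outside all ovals.\<close>

lemma count:
  assumes "chi \<noteq> 0" "n \<ge> 1"
  shows "(\<Sum>l=1..n. card (Kl l chi eta) + card (Kl l (- chi) eta))
           \<le> (if \<bar>chi\<bar> = 1 then 2 * n + 1 else 2 * n + 2)"
proof -
  let ?N = "N chi eta"
  have N0: "?N \<noteq> 0" using N_nonzero assms by auto
  have finr: "finite {s. poly ?N s = 0}" using N0 by (rule poly_roots_finite)
  define U where "U l = Kl l chi eta \<union> Kl l (- chi) eta" for l
  have Usub: "U l \<subseteq> {s. poly ?N s = 0}" "U l \<subseteq> {ea l<..<eb l}" if "l \<in> {1..n}" for l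
    using N_root[OF that] K_iff[OF that] by (auto simp: U_def)
  have finU: "finite (U l)" if "l \<in> {1..n}" for l
    using finite_K[OF that] assms by (auto simp: U_def)
  have le: "card (Kl l chi eta) + card (Kl l (- chi) eta) \<le> (\<Sum>s\<in>U l. order s ?N)" if l: "l \<in> {1..n}" for l
  proof -
    let ?I = "Kl l chi eta \<inter> Kl l (- chi) eta"
    have f: "finite (Kl l chi eta)" "finite (Kl l (- chi) eta)" using finite_K[OF l] assms by auto
    have "card (Kl l chi eta) + card (Kl l (- chi) eta) = card (U l) + card ?I"
      unfolding U_def using card_Un_Int[OF f] .
    \<comment> \<open>The indicator charges common points of both lines twice, in keeping with their
      multiplicity.\<close>
    also have "\<dots> = (\<Sum>s\<in>U l. 1 + (if s \<in> ?I then 1 else 0))"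
    proof -
      have "(\<Sum>s\<in>U l. if s \<in> ?I then 1 else 0) = card (U l \<inter> ?I)"
        using finU[OF l] by (subst sum.inter_restrict[symmetric]) auto
      moreover have "U l \<inter> ?I = ?I" by (auto simp: U_def)
      ultimately show ?thesis by (simp only: sum.distrib sum_constant mult_1_right of_nat_id)
    qed
    also have "\<dots> \<le> (\<Sum>s\<in>U l. order s ?N)"
    proof (rule sum_mono)
      fix s assume s: "s \<in> U l"
      have "order s ?N \<noteq> 0" using Usub(1)[OF l] s N0 by (auto simp: order_root)
      then show "1 + (if s \<in> ?I then 1 else 0) \<le> order s ?N"
        using N_double_root[OF l _ N0 assms(1), of s] by auto
    qed
    finally show ?thesis .
  qed
  define V where "V = (if \<bar>chi\<bar> = 1 then {0, 1} else {0 :: real})"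
  have V: "V \<subseteq> {s. poly ?N s = 0}"
  proof -
    have "poly ?N 0 = 0" using P_root[of 0] x0 by (simp add: poly_N)
    moreover have "poly ?N 1 = 0" if "\<bar>chi\<bar> = 1"
    proof -
      have "chi\<^sup>2 = 1" using that by (simp add: power2_eq_1_iff abs_if split: if_splits)
      then show ?thesis using H_one by (simp add: poly_N)
    qed
    ultimately show ?thesis by (auto simp: V_def)
  qed
  have UV: "U l \<inter> V = {}" if "l \<in> {1..n}" for l
    using Usub(2)[OF that] ab[OF that] by (auto simp: V_def split: if_splits)
  have "(\<Sum>l=1..n. card (Kl l chi eta) + card (Kl l (- chi) eta)) + card V
      \<le> (\<Sum>l=1..n. \<Sum>s\<in>U l. order s ?N) + (\<Sum>s\<in>V. order s ?N)"
  proof (intro add_mono sum_mono le)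
    have "card V = (\<Sum>s\<in>V. 1)" by simp
    also have "\<dots> \<le> (\<Sum>s\<in>V. order s ?N)"
      using V N0 by (intro sum_mono) (auto simp: order_root Suc_le_eq)
    finally show "card V \<le> (\<Sum>s\<in>V. order s ?N)" .
  qed auto
  also have "(\<Sum>l=1..n. \<Sum>s\<in>U l. order s ?N) = (\<Sum>s\<in>(\<Union>l\<in>{1..n}. U l). order s ?N)"
  proof (rule sum.UNION_disjoint[symmetric])
    show "\<forall>i\<in>{1..n}. \<forall>j\<in>{1..n}. i \<noteq> j \<longrightarrow> U i \<inter> U j = {}"
      using Usub(2) intervals_disjoint by blast
  qed (use finU in auto)
  also have "\<dots> + (\<Sum>s\<in>V. order s ?N) = (\<Sum>s\<in>(\<Union>l\<in>{1..n}. U l) \<union> V. order s ?N)"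
    using finU UV by (intro sum.union_disjoint[symmetric]) (auto simp: V_def)
  also have "\<dots> \<le> (\<Sum>s | poly ?N s = 0. order s ?N)"
    by (intro sum_mono2 finr Un_least UN_least Usub(1) V) auto
  also have "\<dots> \<le> degree ?N" using N0 by (rule sum_order_le_degree)
  also have "\<dots> \<le> 2 * n + 3" by (rule degree_N)
  finally have "(\<Sum>l=1..n. card (Kl l chi eta) + card (Kl l (- chi) eta)) + card V \<le> 2 * n + 3" .
  then show ?thesis by (auto simp: V_def)
qed

section \<open>Distribution of the roots over the ovals\<close>

lemma card_K_ge:
  assumes "l \<in> {1..n}" "chi \<noteq> 0"
  shows "card (Kl l chi eta) \<ge> 1"
  using K_nonempty[OF assms] finite_K[OF assms] by (simp add: Suc_le_eq card_gt_0_iff)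

text \<open>The other n - 1 ovals take at least two each, which leaves 4 out of 2n + 2, and 3 out of
  2n + 1.\<close>

lemma count_one:
  assumes l: "l \<in> {1..n}" and chi: "chi \<noteq> 0"
  shows "card (Kl l chi eta) + card (Kl l (- chi) eta) \<le> (if \<bar>chi\<bar> = 1 then 3 else 4)"
proof -
  let ?c = "\<lambda>l. card (Kl l chi eta) + card (Kl l (- chi) eta)"
  have two_le: "2 \<le> ?c j" if "j \<in> {1..n}" for j
    using card_K_ge[OF that, of chi eta] card_K_ge[OF that, of "- chi" eta] chi by simp
  have "(\<Sum>j\<in>{1..n} - {l}. 2) \<le> (\<Sum>j\<in>{1..n} - {l}. ?c j)"
    by (intro sum_mono two_le) simp
  moreover have "(\<Sum>j=1..n. ?c j) = ?c l + (\<Sum>j\<in>{1..n} - {l}. ?c j)"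
    using l by (intro sum.remove) auto
  moreover have "(\<Sum>j\<in>{1..n} - {l}. 2::nat) = 2 * (n - 1)" using l by simp
  ultimately show ?thesis using count[OF chi, of eta] l by (auto split: if_splits)
qed

text \<open>The remaining n - 2 ovals take at least two each; the 6 that are left are too few for
  two ovals with four.\<close>

lemma count_two:
  assumes l: "l \<in> {1..n}" "l' \<in> {1..n}" "l \<noteq> l'" and chi: "chi \<noteq> 0"
  shows "card (Kl l chi eta) + card (Kl l (- chi) eta) +
      (card (Kl l' chi eta) + card (Kl l' (- chi) eta)) \<le> 6"
proof -
  let ?c = "\<lambda>l. card (Kl l chi eta) + card (Kl l (- chi) eta)"
  have two_le: "2 \<le> ?c j" if "j \<in> {1..n}" for j
    using card_K_ge[OF that, of chi eta] card_K_ge[OF that, of "- chi" eta] chi by simp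
  have "(\<Sum>j\<in>{1..n} - {l} - {l'}. 2) \<le> (\<Sum>j\<in>{1..n} - {l} - {l'}. ?c j)"
    by (intro sum_mono two_le) simp
  moreover have "(\<Sum>j=1..n. ?c j) = ?c l + (\<Sum>j\<in>{1..n} - {l}. ?c j)"
    using l by (intro sum.remove) auto
  moreover have "(\<Sum>j\<in>{1..n} - {l}. ?c j) = ?c l' + (\<Sum>j\<in>{1..n} - {l} - {l'}. ?c j)"
    using l by (intro sum.remove) auto
  moreover have "(\<Sum>j\<in>{1..n} - {l} - {l'}. 2::nat) = 2 * (n - 2)"
    using l by (simp add: card_Diff_singleton)
  moreover have "n \<ge> 2" using l by auto
  ultimately show ?thesis using count[OF chi, of eta] l by (auto split: if_splits)
qed

text \<open>The opposite slope uses up at least one intersection, which lowers the bounds 3 and 4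
  for both slopes together to 2 and 3 for one.\<close>

lemma sigmoid_family_oval:
  assumes l: "l \<in> {1..n}"
  shows "sigmoid_family (ea l) (eb l) e (u l)"
proof -
  interpret line_family "ea l" "eb l" e "u l" by (rule line_family_oval[OF l])
  show ?thesis
  proof
    show "finite (Kl l 1 eta) \<and> card (Kl l 1 eta) \<le> 2" for eta
      using count_one[OF l, of 1 eta] card_K_ge[OF l, of "-1" eta] finite_K[OF l, of 1] by auto
    show "finite (Kl l chi eta) \<and> card (Kl l chi eta) \<le> 3" if "0 < chi" "chi < 1" for chi eta
      using count_one[OF l, of chi eta] card_K_ge[OF l, of "- chi" eta] finite_K[OF l, of chi] that
      by auto
  qed
qed

section \<open>Components of the smooth region\<close>

definition smooth :: "nat \<Rightarrow> (real \<times> real) set" where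
  "smooth l = {(chi, eta) \<in> {-1<..<1} \<times> {-1<..<1}. card (crit l chi eta) = 4}"

lemma smooth_eq_region:
  assumes l: "l \<in> {1..n}"
  shows "smooth l = sigmoid_family.region (ea l) (eb l) e (u l)"
proof -
  have "card (crit l chi eta) = 4 \<longleftrightarrow> (if chi = 0 then Kl l 0 eta \<noteq> {}
      else card (Kl l chi eta) + card (Kl l (- chi) eta) = 4)" for chi eta
    using card_crit_0[OF l] card_crit[OF l, of chi eta] finite_K[OF l] by simp
  then show ?thesis
    unfolding smooth_def sigmoid_family.region_def[OF sigmoid_family_oval[OF l]]
    by (intro Collect_cong) (simp only: split_beta mem_Sigma_iff greaterThanLessThan_iff abs_less_iff, force)
qed

text \<open>For nonzero slope the count excludes two ovals with four. For slope 0 the height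
  determines the point: \<open>e\<close> is a Moebius map, hence injective across different ovals
  too.\<close>

lemma smooth_disjoint:
  assumes l: "l \<in> {1..n}" "l' \<in> {1..n}" "l \<noteq> l'"
  shows "smooth l \<inter> smooth l' = {}"
proof (rule ccontr)
  assume "smooth l \<inter> smooth l' \<noteq> {}"
  then obtain chi eta where c: "card (crit l chi eta) = 4" "card (crit l' chi eta) = 4"
    by (auto simp: smooth_def)
  show False
  proof (cases "chi = 0")
    case True
    then obtain s t where st: "s \<in> Kl l 0 eta" "t \<in> Kl l' 0 eta"
      using c card_crit_0[OF l(1)] card_crit_0[OF l(2)] by blast
    have st': "s < 0" "t < 0" "e s = e t" "s \<in> {ea l<..<eb l}" "t \<in> {ea l'<..<eb l'}"
      using st ab[OF l(1)] ab[OF l(2)] by (auto simp: K_iff[OF l(1)] K_iff[OF l(2)])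
    have "(s + 1) * (t - 1) = (t + 1) * (s - 1)"
      using st' by (simp add: e_def frac_eq_eq)
    then have "s = t" by (simp add: algebra_simps)
    then show False using intervals_disjoint[OF l] st' by blast
  next
    case False
    then show False
      using count_two[OF l False, of eta] c card_crit[OF l(1) False] card_crit[OF l(2) False]
        finite_K[OF l(1)] finite_K[OF l(2)] by auto
  qed
qed

text \<open>Open, connected, nonempty and pairwise disjoint sets are the components of their union,
  and being nonempty and disjoint they differ from each other.\<close>

theorem components_smooth:
  "components (\<Union>l\<in>{1..n}. smooth l) = smooth ` {1..n}" "card (smooth ` {1..n}) = n"
proof -
  have p: "open (smooth l) \<and> connected (smooth l) \<and> smooth l \<noteq> {}" if l: "l \<in> {1..n}" for l
  proof -
    interpret sigmoid_family "ea l" "eb l" e "u l" by (rule sigmoid_family_oval[OF l])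
    show ?thesis unfolding smooth_eq_region[OF l]
      using open_region connected_region region_nonempty by blast
  qed
  show "components (\<Union>l\<in>{1..n}. smooth l) = smooth ` {1..n}"
  proof (rule components_open_unique)
    show "pairwise disjnt (smooth ` {1..n})"
      unfolding pairwise_def disjnt_def using smooth_disjoint by blast
    show "\<Union>(smooth ` {1..n}) = (\<Union>l\<in>{1..n}. smooth l)" ..
    show "open X \<and> connected X \<and> X \<noteq> {}" if "X \<in> smooth ` {1..n}" for X
      using that by (auto simp only: p)
  qed
  have "inj_on smooth {1..n}"
  proof (rule inj_onI, rule ccontr)
    fix l l' assume l: "l \<in> {1..n}" "l' \<in> {1..n}" "smooth l = smooth l'" "l \<noteq> l'"
    then have "smooth l = {}" using smooth_disjoint[OF l(1,2,4)] by (simp only: Int_absorb)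
    then show False using p[OF l(1)] by blast
  qed
  then show "card (smooth ` {1..n}) = n" by (simp add: card_image)
qed

end

section \<open>The trace of the transfer matrix\<close>

text \<open>Signs and orderings are handled on real polynomials, local analysis on their complex
  images.\<close>

definition cpoly :: "real poly \<Rightarrow> complex poly" where
  "cpoly p = map_poly of_real p"

lemma coeff_cpoly [simp]: "coeff (cpoly p) i = of_real (coeff p i)"
  by (simp add: cpoly_def coeff_map_poly)

lemma cpoly_simps:
  "cpoly 0 = 0" "cpoly 1 = 1" "cpoly (pCons a p) = pCons (of_real a) (cpoly p)"
  "cpoly (p + q) = cpoly p + cpoly q" "cpoly (p - q) = cpoly p - cpoly q"
  "cpoly (smult a p) = smult (of_real a) (cpoly p)" "cpoly (p * q) = cpoly p * cpoly q"
  "cpoly (pderiv p) = pderiv (cpoly p)"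
  by (rule poly_eqI; simp add: coeff_pCons coeff_mult coeff_pderiv split: nat.splits)+

lemma cpoly_power: "cpoly (p ^ n) = cpoly p ^ n"
  by (induction n) (simp_all add: cpoly_simps)

lemma cpoly_prod: "cpoly (prod f A) = (\<Prod>i\<in>A. cpoly (f i))"
  by (induction A rule: infinite_finite_induct) (simp_all add: cpoly_simps)

lemma poly_cpoly_of_real: "poly (cpoly p) (of_real s) = of_real (poly p s)"
  by (induction p) (simp_all add: cpoly_simps)

lemma degree_cpoly [simp]: "degree (cpoly p) = degree p"
  by (simp add: cpoly_def degree_map_poly)

lemma cpoly_eq_iff [simp]: "cpoly p = cpoly q \<longleftrightarrow> p = q"
  by (simp add: poly_eq_iff)

text \<open>The ordered product without its scalar prefactor, over an arbitrary list of indices to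
  permit induction.\<close>

definition aztec_prod :: "(nat \<Rightarrow> real) \<Rightarrow> (nat \<Rightarrow> real) \<Rightarrow> complex \<Rightarrow> nat list \<Rightarrow> complex^2^2" where
  "aztec_prod \<alpha> \<beta> z ms = foldr (**) (map (\<lambda>m. aztec_factor (\<alpha> m) z ** aztec_factor (\<beta> m) z) ms) (mat 1)"

lemma aztec_prod_simps:
  "aztec_prod \<alpha> \<beta> z [] = mat 1"
  "aztec_prod \<alpha> \<beta> z (m # ms) = aztec_factor (\<alpha> m) z ** (aztec_factor (\<beta> m) z ** aztec_prod \<alpha> \<beta> z ms)"
  by (simp_all add: aztec_prod_def matrix_mul_assoc)

lemma aztec_factor_nth [simp]:
  "aztec_factor a z $ 1 $ 1 = 1" "aztec_factor a z $ 1 $ 2 = of_real a * inverse z"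
  "aztec_factor a z $ 2 $ 1 = inverse (of_real a)" "aztec_factor a z $ 2 $ 2 = 1"
  by (simp_all add: aztec_factor_def)

lemma matrix_mult_2:
  fixes A B :: "'a::comm_semiring_1^2^2"
  shows "(A ** B) $ i $ j = A $ i $ 1 * B $ 1 $ j + A $ i $ 2 * B $ 2 $ j"
  by (simp add: matrix_matrix_mult_def sum_2)

text \<open>Coefficientwise nonnegativity is preserved by the matrix products. It yields t(1) > 0
  and the exact degree of p.\<close>

definition nonneg_poly :: "real poly \<Rightarrow> bool" where
  "nonneg_poly p \<longleftrightarrow> (\<forall>i. coeff p i \<ge> 0)"

lemma nonneg_poly_add: "nonneg_poly p \<Longrightarrow> nonneg_poly q \<Longrightarrow> nonneg_poly (p + q)"
  by (simp add: nonneg_poly_def)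

lemma nonneg_poly_mult: "nonneg_poly p \<Longrightarrow> nonneg_poly q \<Longrightarrow> nonneg_poly (p * q)"
  by (auto simp: nonneg_poly_def coeff_mult intro!: sum_nonneg)

lemma nonneg_poly_pCons: "a \<ge> 0 \<Longrightarrow> nonneg_poly p \<Longrightarrow> nonneg_poly (pCons a p)"
  by (auto simp: nonneg_poly_def coeff_pCons split: nat.splits)

lemma nonneg_poly_0: "nonneg_poly 0"
  by (simp add: nonneg_poly_def)

text \<open>A pair of factors times z is the matrix with rows (z + a/b, a + b) and (z (1/a + 1/b), z
  + b/a), which has nonnegative coefficients. The vanishing top coefficient of the upper right entry
  is what keeps the lower right one monic in the induction.\<close>

lemma aztec_prod_poly:
  assumes "\<And>m. m \<in> set ms \<Longrightarrow> \<alpha> m > 0 \<and> \<beta> m > 0"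
  shows "\<exists>p11 p12 p21 p22.
    (\<forall>z. z \<noteq> 0 \<longrightarrow> z ^ length ms * aztec_prod \<alpha> \<beta> z ms $ 1 $ 1 = poly (cpoly p11) z \<and>
       z ^ length ms * aztec_prod \<alpha> \<beta> z ms $ 1 $ 2 = poly (cpoly p12) z \<and>
       z ^ length ms * aztec_prod \<alpha> \<beta> z ms $ 2 $ 1 = poly (cpoly p21) z \<and>
       z ^ length ms * aztec_prod \<alpha> \<beta> z ms $ 2 $ 2 = poly (cpoly p22) z) \<and>
    nonneg_poly p11 \<and> nonneg_poly p12 \<and> nonneg_poly p21 \<and> nonneg_poly p22 \<and>
    degree p11 \<le> length ms \<and> degree p12 \<le> length ms \<and> degree p21 \<le> length ms \<and>
    degree p22 \<le> length ms \<and> coeff p11 (length ms) = 1 \<and> coeff p12 (length ms) = 0 \<and>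
    coeff p22 (length ms) = 1"
  using assms
proof (induction ms)
  case Nil
  show ?case
    by (intro exI[of _ 1] exI[of _ 0]) (auto simp: aztec_prod_simps cpoly_simps nonneg_poly_def mat_def coeff_1)
next
  case (Cons m ms)
  define n where "n = length ms"
  define a where "a = \<alpha> m"
  define b where "b = \<beta> m"
  have ab: "a > 0" "b > 0" using Cons.prems[of m] by (auto simp: a_def b_def)
  have "\<And>m. m \<in> set ms \<Longrightarrow> \<alpha> m > 0 \<and> \<beta> m > 0" using Cons.prems by auto
  from Cons.IH[OF this, folded n_def] obtain p11 p12 p21 p22 where
    ev: "\<And>z. z \<noteq> 0 \<Longrightarrow> z ^ n * aztec_prod \<alpha> \<beta> z ms $ 1 $ 1 = poly (cpoly p11) z"
       "\<And>z. z \<noteq> 0 \<Longrightarrow> z ^ n * aztec_prod \<alpha> \<beta> z ms $ 1 $ 2 = poly (cpoly p12) z"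
       "\<And>z. z \<noteq> 0 \<Longrightarrow> z ^ n * aztec_prod \<alpha> \<beta> z ms $ 2 $ 1 = poly (cpoly p21) z"
       "\<And>z. z \<noteq> 0 \<Longrightarrow> z ^ n * aztec_prod \<alpha> \<beta> z ms $ 2 $ 2 = poly (cpoly p22) z"
    and nn: "nonneg_poly p11" "nonneg_poly p12" "nonneg_poly p21" "nonneg_poly p22"
    and dg: "degree p11 \<le> n" "degree p12 \<le> n" "degree p21 \<le> n" "degree p22 \<le> n"
    and cf: "coeff p11 n = 1" "coeff p12 n = 0" "coeff p22 n = 1"
    by blast
  let ?u = "[:a / b, 1:]" and ?v = "[:b / a, 1:]" and ?c = "[:a + b:]" and ?d = "[:0, 1 / a + 1 / b:]"
  have entries: "z ^ (n + Suc 0) * (aztec_factor a z ** (aztec_factor b z ** X)) $ 1 $ j =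
         (z + of_real (a / b)) * (z ^ n * X $ 1 $ j) + of_real (a + b) * (z ^ n * X $ 2 $ j)"
       "z ^ (n + Suc 0) * (aztec_factor a z ** (aztec_factor b z ** X)) $ 2 $ j =
         z * of_real (1 / a + 1 / b) * (z ^ n * X $ 1 $ j) + (z + of_real (b / a)) * (z ^ n * X $ 2 $ j)"
    if "z \<noteq> 0" for z X and j :: 2
    using that ab by (simp_all add: matrix_mult_2 field_simps)
  show ?case
    unfolding aztec_prod_simps list.size(4) a_def[symmetric] b_def[symmetric] n_def[symmetric]
  proof (intro exI conjI allI impI)
    fix z :: complex assume z: "z \<noteq> 0"
    show "z ^ (n + Suc 0) * (aztec_factor a z ** (aztec_factor b z ** aztec_prod \<alpha> \<beta> z ms)) $ 1 $ 1 =
        poly (cpoly (?u * p11 + ?c * p21)) z"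
      unfolding entries(1)[OF z] ev[OF z] by (simp add: cpoly_simps algebra_simps)
    show "z ^ (n + Suc 0) * (aztec_factor a z ** (aztec_factor b z ** aztec_prod \<alpha> \<beta> z ms)) $ 1 $ 2 =
        poly (cpoly (?u * p12 + ?c * p22)) z"
      unfolding entries(1)[OF z] ev[OF z] by (simp add: cpoly_simps algebra_simps)
    show "z ^ (n + Suc 0) * (aztec_factor a z ** (aztec_factor b z ** aztec_prod \<alpha> \<beta> z ms)) $ 2 $ 1 =
        poly (cpoly (?d * p11 + ?v * p21)) z"
      unfolding entries(2)[OF z] ev[OF z] by (simp add: cpoly_simps algebra_simps)
    show "z ^ (n + Suc 0) * (aztec_factor a z ** (aztec_factor b z ** aztec_prod \<alpha> \<beta> z ms)) $ 2 $ 2 =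
        poly (cpoly (?d * p12 + ?v * p22)) z"
      unfolding entries(2)[OF z] ev[OF z] by (simp add: cpoly_simps algebra_simps)
  next
    show "nonneg_poly (?u * p11 + ?c * p21)" "nonneg_poly (?u * p12 + ?c * p22)"
      "nonneg_poly (?d * p11 + ?v * p21)" "nonneg_poly (?d * p12 + ?v * p22)"
      using ab nn by (intro nonneg_poly_add nonneg_poly_mult nonneg_poly_pCons nonneg_poly_0; simp)+
  next
    have d: "degree (pCons x [:y:] * p + pCons x' [:y':] * q) \<le> n + Suc 0"
      if "degree p \<le> n" "degree q \<le> n" for x y x' y' and p q :: "real poly"
      using that by (intro degree_add_le order_trans[OF degree_mult_le] add_mono[of _ n _ "Suc 0", unfolded add.commute[of n]])
         (auto intro!: add_mono order_trans[OF degree_pCons_le] simp: add.commute)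
    show "degree (?u * p11 + ?c * p21) \<le> n + Suc 0" "degree (?u * p12 + ?c * p22) \<le> n + Suc 0"
      "degree (?d * p11 + ?v * p21) \<le> n + Suc 0" "degree (?d * p12 + ?v * p22) \<le> n + Suc 0"
      using d[of p11 p21 "a/b" 1 "a + b" 0] d[of p12 p22 "a/b" 1 "a + b" 0]
        d[of p11 p21 0 "1/a+1/b" "b/a" 1] d[of p12 p22 0 "1/a+1/b" "b/a" 1] dg by simp_all
    have z: "coeff p11 (Suc n) = 0" "coeff p12 (Suc n) = 0" "coeff p21 (Suc n) = 0" "coeff p22 (Suc n) = 0"
      using dg by (simp_all add: coeff_eq_0)
    show "coeff (?u * p11 + ?c * p21) (n + Suc 0) = 1" "coeff (?u * p12 + ?c * p22) (n + Suc 0) = 0"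
      "coeff (?d * p12 + ?v * p22) (n + Suc 0) = 1"
      using cf z by simp_all
  qed
qed

lemma aztec_Phi_nth:
  "aztec_Phi k \<alpha> \<beta> z $ i $ j = 1 / (1 - inverse z) ^ k * aztec_prod \<alpha> \<beta> z [1..<Suc k] $ i $ j"
proof -
  have "(mat c ** A) $ i $ j = c * A $ i $ j" for c :: complex and A :: "complex^2^2"
    using exhaust_2[of i] by (auto simp: matrix_mult_2 mat_def)
  then show ?thesis by (simp add: aztec_Phi_def aztec_prod_def)
qed

text \<open>Multiplied by (z - 1)^k, the prefactor of \<Phi> becomes z^k, exactly the power that
  clears the denominators of k pairs of factors.\<close>

lemma aztec_trace_poly:
  assumes "\<And>m. m \<in> {1..k} \<Longrightarrow> \<alpha> m > 0" "\<And>m. m \<in> {1..k} \<Longrightarrow> \<beta> m > 0"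
  obtains t where "nonneg_poly t" "degree t \<le> k" "coeff t k = 2"
    "\<And>z. z \<noteq> 0 \<Longrightarrow> z \<noteq> 1 \<Longrightarrow> (z - 1) ^ k * trace (aztec_Phi k \<alpha> \<beta> z) = poly (cpoly t) z"
proof -
  have "\<And>m. m \<in> set [1..<Suc k] \<Longrightarrow> \<alpha> m > 0 \<and> \<beta> m > 0"
    using assms by auto
  moreover have len: "length [1..<Suc k] = k" by simp
  ultimately obtain p11 p22 where
    ev: "\<And>z. z \<noteq> 0 \<Longrightarrow> z ^ k * aztec_prod \<alpha> \<beta> z [1..<Suc k] $ 1 $ 1 = poly (cpoly p11) z"
       "\<And>z. z \<noteq> 0 \<Longrightarrow> z ^ k * aztec_prod \<alpha> \<beta> z [1..<Suc k] $ 2 $ 2 = poly (cpoly p22) z"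
    and p: "nonneg_poly p11" "nonneg_poly p22" "degree p11 \<le> k" "degree p22 \<le> k"
      "coeff p11 k = 1" "coeff p22 k = 1"
    using aztec_prod_poly[of "[1..<Suc k]" \<alpha> \<beta>] unfolding len by blast
  show ?thesis
  proof (rule that[of "p11 + p22"])
    fix z :: complex assume z: "z \<noteq> 0" "z \<noteq> 1"
    have "(z - 1) ^ k * (1 / (1 - inverse z) ^ k) = ((z - 1) / (1 - inverse z)) ^ k"
      by (simp add: power_divide)
    also have "(z - 1) / (1 - inverse z) = z" using z by (simp add: field_simps)
    finally have "(z - 1) ^ k * (1 / (1 - inverse z) ^ k) = z ^ k" .
    then have "(z - 1) ^ k * aztec_Phi k \<alpha> \<beta> z $ i $ i = z ^ k * aztec_prod \<alpha> \<beta> z [1..<Suc k] $ i $ i" for i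
      by (simp only: aztec_Phi_nth mult.assoc[symmetric])
    then show "(z - 1) ^ k * trace (aztec_Phi k \<alpha> \<beta> z) = poly (cpoly (p11 + p22)) z"
      by (simp only: trace_def sum_2 distrib_left ev[OF z(1)] cpoly_simps poly_add)
  qed (use p in \<open>auto intro!: nonneg_poly_add degree_add_le\<close>)
qed

text \<open>Each of the 2k factors has determinant 1 - 1/z, and the scalar prefactor enters the
  determinant squared.\<close>

lemma det_aztec_Phi:
  assumes "z \<noteq> 0" "z \<noteq> 1" "\<And>m. m \<in> {1..k} \<Longrightarrow> \<alpha> m > 0" "\<And>m. m \<in> {1..k} \<Longrightarrow> \<beta> m > 0"
  shows "det (aztec_Phi k \<alpha> \<beta> z) = 1"
proof -
  have f: "det (aztec_factor a z) = 1 - inverse z" if "a > 0" for a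
    using that by (simp add: det_2)
  have "det (aztec_prod \<alpha> \<beta> z ms) = (1 - inverse z) ^ (2 * length ms)" 
    if "\<And>m. m \<in> set ms \<Longrightarrow> \<alpha> m > 0 \<and> \<beta> m > 0" for ms
    using that by (induction ms) (auto simp: aztec_prod_simps det_mul f det_I)
  then have d: "det (aztec_prod \<alpha> \<beta> z [1..<Suc k]) = (1 - inverse z) ^ (2 * k)"
    using assms by (force simp del: upt_Suc)
  have nz: "1 - inverse z \<noteq> 0" using assms by (auto simp: inverse_eq_1_iff)
  have "det (aztec_Phi k \<alpha> \<beta> z) = (1 / (1 - inverse z) ^ k)\<^sup>2 * det (aztec_prod \<alpha> \<beta> z [1..<Suc k])"
    by (simp add: det_2 aztec_Phi_nth algebra_simps power2_eq_square del: upt_Suc)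
  also have "\<dots> = 1" unfolding d using nz by (simp add: power_divide power_mult mult.commute)
  finally show ?thesis .
qed

text \<open>With \<open>\<zeta>\<^sup>2 = 1/z\<close> and \<open>Re \<zeta> > 0\<close>, every normalized factor, conjugated by \<open>diag(\<zeta>, 1)\<close>,
  strictly increases the Hermitian form \<open>Re (u * cnj v)\<close>, so the product has no unimodular
  eigenvalue.\<close>
lemma factor_expands:
  fixes u v \<zeta> :: complex
  assumes "Re \<zeta> > 0" "\<zeta> \<noteq> 1" "a > 0" "u \<noteq> 0 \<or> v \<noteq> 0"
  shows "Re ((u + of_real a * \<zeta> * v) * cnj (v + \<zeta> * u / of_real a)) > cmod (1 - \<zeta>\<^sup>2) * Re (u * cnj v)"
proof -
  define R where "R = Re (u * cnj v)"
  define S where "S = a * (cmod v)\<^sup>2 + (cmod u)\<^sup>2 / a"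
  have expand: "Re ((u + of_real a * \<zeta> * v) * cnj (v + \<zeta> * u / of_real a)) =
      (1 + (cmod \<zeta>)\<^sup>2) * R + Re \<zeta> * S"
    using assms(3) unfolding R_def S_def cmod_power2
    by (simp add: field_simps power2_eq_square)
  have Rle: "\<bar>R\<bar> \<le> cmod u * cmod v"
    unfolding R_def using abs_Re_le_cmod[of "u * cnj v"] by (simp add: norm_mult)
  \<comment> \<open>The inequality between arithmetic and geometric mean for the two terms of
    \<open>S\<close>.\<close>
  have "0 \<le> (sqrt a * cmod v - cmod u / sqrt a)\<^sup>2" by simp
  also have "\<dots> = S - 2 * (cmod u * cmod v)"
    using assms(3) by (simp add: S_def power2_diff power_mult_distrib power_divide)
  finally have S2: "S \<ge> 2 * \<bar>R\<bar>" using Rle by simp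
  have S0: "S > 0"
  proof (cases "v = 0")
    case True
    then show ?thesis using assms(3,4) by (simp add: S_def)
  next
    case False
    then show ?thesis using assms(3) unfolding S_def by (intro add_pos_nonneg) auto
  qed
  show ?thesis
  proof (cases "R \<ge> 0")
    case True
    have "cmod (1 - \<zeta>\<^sup>2) \<le> 1 + (cmod \<zeta>)\<^sup>2"
      using norm_triangle_ineq4[of 1 "\<zeta>\<^sup>2"] by (simp add: norm_power)
    then have "cmod (1 - \<zeta>\<^sup>2) * R \<le> (1 + (cmod \<zeta>)\<^sup>2) * R" using True by (rule mult_right_mono)
    moreover have "Re \<zeta> * S > 0" using assms(1) S0 by simp
    ultimately show ?thesis unfolding expand R_def[symmetric] by linarith
  next
    case False
    \<comment> \<open>For negative \<open>R\<close> a lower bound of |1 - \<zeta>^2| is needed. The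
      bound |1 - \<zeta>|^2 is just the factor of \<open>R\<close> that appears when
      \<open>S\<close> is replaced by 2 |R|.\<close>
    have "1 - \<zeta>\<^sup>2 = (1 - \<zeta>) * (1 + \<zeta>)" by (simp add: algebra_simps power2_eq_square)
    then have "cmod (1 - \<zeta>\<^sup>2) = cmod (1 - \<zeta>) * cmod (1 + \<zeta>)" by (simp add: norm_mult)
    moreover have "cmod (1 - \<zeta>) < cmod (1 + \<zeta>)"
      unfolding cmod_def using assms(1) by (intro real_sqrt_less_mono) (simp add: power2_eq_square algebra_simps)
    moreover have "cmod (1 - \<zeta>) > 0" using assms(2) by simp
    ultimately have "cmod (1 - \<zeta>\<^sup>2) > (cmod (1 - \<zeta>))\<^sup>2"
      by (simp add: power2_eq_square)
    also have "(cmod (1 - \<zeta>))\<^sup>2 = 1 + (cmod \<zeta>)\<^sup>2 - 2 * Re \<zeta>"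
      unfolding cmod_power2 by (simp add: power2_eq_square algebra_simps)
    finally have "cmod (1 - \<zeta>\<^sup>2) * R < (1 + (cmod \<zeta>)\<^sup>2 - 2 * Re \<zeta>) * R"
      using False by (intro mult_strict_right_mono_neg) auto
    also have "\<dots> = (1 + (cmod \<zeta>)\<^sup>2) * R + Re \<zeta> * (2 * \<bar>R\<bar>)"
      using False by (simp add: algebra_simps)
    also have "\<dots> \<le> (1 + (cmod \<zeta>)\<^sup>2) * R + Re \<zeta> * S"
      using S2 assms(1) by (intro add_left_mono mult_left_mono) auto
    finally show ?thesis unfolding expand R_def[symmetric] .
  qed
qed

text \<open>In the coordinates u = v1 / \<zeta> and v = v2 a factor acts as (u, v) |-> (u + a
  \<zeta> v, v + \<zeta> u / a), and this is the form Re (u cnj v).\<close>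

definition hform :: "complex \<Rightarrow> complex^2 \<Rightarrow> real" where
  "hform \<zeta> v = Re (v $ 1 / \<zeta> * cnj (v $ 2))"

lemma mat_vec_2:
  fixes A :: "'a::comm_semiring_1^2^2"
  shows "(A *v v) $ i = A $ i $ 1 * v $ 1 + A $ i $ 2 * v $ 2"
  by (simp add: matrix_vector_mult_def sum_2)

lemma vec2_nonzero: "(v :: complex^2) \<noteq> 0 \<longleftrightarrow> v $ 1 \<noteq> 0 \<or> v $ 2 \<noteq> 0"
  by (simp add: vec_eq_iff forall_2)

context
  fixes z \<zeta> :: complex
  assumes z: "z * \<zeta>\<^sup>2 = 1" and re: "Re \<zeta> > 0" and z1: "z \<noteq> 1"
begin

lemma \<zeta>: "\<zeta> \<noteq> 0" "\<zeta> \<noteq> 1" "inverse z = \<zeta>\<^sup>2" "1 - \<zeta>\<^sup>2 \<noteq> 0"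
proof -
  show "inverse z = \<zeta>\<^sup>2" using z by (metis inverse_unique)
  show "\<zeta> \<noteq> 0" "\<zeta> \<noteq> 1" "1 - \<zeta>\<^sup>2 \<noteq> 0" using re z z1 by auto
qed

lemma aztec_factor_vec:
  assumes "a > 0" "v \<noteq> 0"
  shows "aztec_factor a z *v v \<noteq> 0"
    "hform \<zeta> (aztec_factor a z *v v) > cmod (1 - \<zeta>\<^sup>2) * hform \<zeta> v"
proof -
  show "aztec_factor a z *v v \<noteq> 0"
  proof
    assume "aztec_factor a z *v v = 0"
    then have e: "(aztec_factor a z *v v) $ 1 = 0" "(aztec_factor a z *v v) $ 2 = 0" by simp_all
    have v1: "v $ 1 = - of_real a * v $ 2" using e(2) assms(1)
      by (simp add: mat_vec_2 field_simps add_eq_0_iff)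
    then have "of_real a * v $ 2 * (1 - \<zeta>\<^sup>2) = 0" using e(1)
      by (simp add: mat_vec_2 \<zeta>(3) algebra_simps)
    then have "v $ 2 = 0" using assms(1) \<zeta>(4) by simp
    then show False using v1 assms(2) by (simp add: vec2_nonzero)
  qed
  have nz: "v $ 1 / \<zeta> \<noteq> 0 \<or> v $ 2 \<noteq> 0" using assms(2) \<zeta>(1) by (simp add: vec2_nonzero)
  show "hform \<zeta> (aztec_factor a z *v v) > cmod (1 - \<zeta>\<^sup>2) * hform \<zeta> v"
  proof -
    have "(aztec_factor a z *v v) $ 1 / \<zeta> = v $ 1 / \<zeta> + of_real a * \<zeta> * v $ 2"
      using \<zeta>(1) by (simp add: mat_vec_2 \<zeta>(3) add_divide_distrib power2_eq_square)
    moreover have "(aztec_factor a z *v v) $ 2 = v $ 2 + \<zeta> * (v $ 1 / \<zeta>) / of_real a"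
      using \<zeta>(1) by (simp add: mat_vec_2 divide_inverse mult.commute add.commute)
    ultimately show ?thesis
      using factor_expands[OF re \<zeta>(2) assms(1) nz] by (simp only: hform_def)
  qed
qed

text \<open>Every pair of factors contributes |1 - \<zeta>^2|^2. Growth is not strict for the empty
  product, whence the case distinction.\<close>

lemma aztec_prod_vec:
  assumes "\<And>m. m \<in> set ms \<Longrightarrow> \<alpha> m > 0 \<and> \<beta> m > 0" "v \<noteq> 0"
  shows "aztec_prod \<alpha> \<beta> z ms *v v \<noteq> 0 \<and>
    (if ms = [] then hform \<zeta> (aztec_prod \<alpha> \<beta> z ms *v v) = hform \<zeta> v
     else hform \<zeta> (aztec_prod \<alpha> \<beta> z ms *v v) > cmod (1 - \<zeta>\<^sup>2) ^ (2 * length ms) * hform \<zeta> v)"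
  using assms(1)
proof (induction ms)
  case Nil
  then show ?case using assms(2) by (simp add: aztec_prod_simps)
next
  case (Cons m ms)
  let ?x = "aztec_prod \<alpha> \<beta> z ms *v v" and ?c = "cmod (1 - \<zeta>\<^sup>2)"
  have c: "?c > 0" using \<zeta>(4) by simp
  have x: "?x \<noteq> 0" and le: "hform \<zeta> ?x \<ge> ?c ^ (2 * length ms) * hform \<zeta> v"
    using Cons by (auto split: if_splits simp: aztec_prod_simps less_imp_le)
  have pos: "\<alpha> m > 0" "\<beta> m > 0" using Cons.prems[of m] by auto
  let ?y = "aztec_factor (\<beta> m) z *v ?x"
  let ?w = "aztec_factor (\<alpha> m) z *v ?y"
  note y = aztec_factor_vec[OF pos(2) x]
  note w = aztec_factor_vec[OF pos(1) y(1)]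
  have "?c ^ (2 * length (m # ms)) * hform \<zeta> v = ?c * (?c * (?c ^ (2 * length ms) * hform \<zeta> v))"
    by (simp add: algebra_simps)
  also have "\<dots> \<le> ?c * (?c * hform \<zeta> ?x)" using le c by (intro mult_left_mono) auto
  also have "\<dots> < ?c * hform \<zeta> ?y" using y(2) c by (intro mult_strict_left_mono) auto
  also have "\<dots> < hform \<zeta> ?w" by (rule w(2))
  finally show ?case using w(1)
    by (simp add: aztec_prod_simps matrix_vector_mul_assoc)
qed

end

section \<open>Unimodular eigenvalues\<close>

lemma singular_2_kernel:
  fixes A :: "complex^2^2"
  assumes "A $ 1 $ 1 * A $ 2 $ 2 = A $ 1 $ 2 * A $ 2 $ 1"
  obtains v where "v \<noteq> 0" "A *v v = 0"
proof -
  consider "A $ 1 $ 1 \<noteq> 0 \<or> A $ 1 $ 2 \<noteq> 0" | "A $ 2 $ 1 \<noteq> 0 \<or> A $ 2 $ 2 \<noteq> 0"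
    | "A $ 1 $ 1 = 0" "A $ 1 $ 2 = 0" "A $ 2 $ 1 = 0" "A $ 2 $ 2 = 0" by auto
  then show ?thesis
  proof cases
    case 1
    then show ?thesis using assms that[of "vector [A $ 1 $ 2, - A $ 1 $ 1]"]
      by (auto simp: vec_eq_iff forall_2 mat_vec_2 algebra_simps)
  next
    case 2
    then show ?thesis using assms that[of "vector [A $ 2 $ 2, - A $ 2 $ 1]"]
      by (auto simp: vec_eq_iff forall_2 mat_vec_2 algebra_simps)
  next
    case 3
    then show ?thesis using that[of "vector [1, 1]"]
      by (auto simp: vec_eq_iff forall_2 mat_vec_2)
  qed
qed

lemma eigenvector_2:
  fixes A :: "complex^2^2"
  assumes "l\<^sup>2 - trace A * l + det A = 0"
  obtains v where "v \<noteq> 0" "A *v v = l *s v"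
proof -
  have "(A - mat l) $ 1 $ 1 * (A - mat l) $ 2 $ 2 = (A - mat l) $ 1 $ 2 * (A - mat l) $ 2 $ 1"
    using assms by (simp add: mat_def trace_def sum_2 det_2 algebra_simps power2_eq_square)
  then obtain v where v: "v \<noteq> 0" "(A - mat l) *v v = 0" by (rule singular_2_kernel)
  have "(A - mat l) *v v = A *v v - l *s v"
    by (simp add: vec_eq_iff forall_2 mat_vec_2 mat_def algebra_simps)
  then show ?thesis using v that by simp
qed

text \<open>For |c| <= 2 the eigenvalues have product 1 and real sum c, so they lie on the unit
  circle. On an eigenvector \<Phi> would then preserve the form that it strictly increases.\<close>

lemma trace_aztec_Phi_off_band:
  assumes k: "k \<ge> 1" and pos: "\<And>m. m \<in> {1..k} \<Longrightarrow> \<alpha> m > 0" "\<And>m. m \<in> {1..k} \<Longrightarrow> \<beta> m > 0"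
    and z: "z \<notin> \<real>\<^sub>\<le>\<^sub>0" "z \<noteq> 1" and tr: "trace (aztec_Phi k \<alpha> \<beta> z) = of_real c"
  shows "\<bar>c\<bar> > 2"
proof (rule ccontr)
  assume "\<not> \<bar>c\<bar> > 2"
  then have c: "\<bar>c / 2\<bar> \<le> 1" by simp
  define l where "l = cis (arccos (c / 2))"
  have l1: "cmod l = 1" by (simp add: l_def)
  have z0: "z \<noteq> 0" using z by auto
  define s where "s = arccos (c / 2)"
  have cs: "cos s = c / 2" using c by (simp add: s_def cos_arccos_abs)
  have "l\<^sup>2 - of_real c * l + 1 = 0"
  proof -
    have "l + inverse l = of_real c"
      unfolding l_def s_def[symmetric] using cs by (simp add: complex_eq_iff cis_inverse)
    then have "l * l + inverse l * l = of_real c * l" by (metis distrib_right)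
    moreover have "inverse l * l = 1" by (simp add: l_def cis_mult)
    ultimately have "l * l + 1 = of_real c * l" by simp
    moreover have "l\<^sup>2 - of_real c * l + 1 = (l * l + 1) - of_real c * l"
      by (simp add: power2_eq_square)
    ultimately show ?thesis by simp
  qed
  then have "l\<^sup>2 - trace (aztec_Phi k \<alpha> \<beta> z) * l + det (aztec_Phi k \<alpha> \<beta> z) = 0"
    using det_aztec_Phi[OF z0 z(2) pos] tr by simp
  then obtain v where v: "v \<noteq> 0" "aztec_Phi k \<alpha> \<beta> z *v v = l *s v" by (rule eigenvector_2)
  define \<zeta> where "\<zeta> = inverse (csqrt z)"
  \<comment> \<open>Off the nonpositive axis the principal root has positive real part, as the
    growth of the form requires.\<close>
  have re: "Re (csqrt z) > 0"
  proof (rule ccontr)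
    assume "\<not> Re (csqrt z) > 0"
    then have "Re (csqrt z) = 0" using csqrt_principal[of z] by auto
    then have "csqrt z = \<i> * of_real (Im (csqrt z))" by (simp add: complex_eq_iff)
    then have "z = (\<i> * of_real (Im (csqrt z)))\<^sup>2" using power2_csqrt[of z] by metis
    also have "\<dots> = of_real (- (Im (csqrt z))\<^sup>2)" by (simp add: power_mult_distrib)
    finally have "z \<in> \<real>\<^sub>\<le>\<^sub>0" by (metis nonpos_Reals_of_real_iff neg_le_0_iff_le zero_le_power2)
    then show False using z by simp
  qed
  have ze: "z * \<zeta>\<^sup>2 = 1" using z0 by (simp add: \<zeta>_def power_inverse)
  have "Re (inverse w) > 0" if "Re w > 0" for w
    using that by (simp add: add_pos_nonneg)
  from this[OF re] have reze: "Re \<zeta> > 0" unfolding \<zeta>_def .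
  note ze' = \<zeta>[OF ze reze z(2)]
  let ?d = "1 / (1 - inverse z) ^ k" and ?M = "aztec_prod \<alpha> \<beta> z [1..<Suc k]"
  have Mv: "hform \<zeta> (?M *v v) > cmod (1 - \<zeta>\<^sup>2) ^ (2 * k) * hform \<zeta> v"
    using aztec_prod_vec[OF ze reze z(2) _ v(1), of "[1..<Suc k]" \<alpha> \<beta>] pos k
    by (simp del: upt_Suc)
  \<comment> \<open>The form is sesquilinear, so scalars act through their modulus only.\<close>
  have scale: "hform \<zeta> (d *s x) = (cmod d)\<^sup>2 * hform \<zeta> x" for d x
  proof -
    have "hform \<zeta> (d *s x) = Re (d * x $ 1 / \<zeta> * cnj (d * x $ 2))"
      by (simp only: hform_def vector_smult_component)
    also have "d * x $ 1 / \<zeta> * cnj (d * x $ 2) = (d * cnj d) * (x $ 1 / \<zeta> * cnj (x $ 2))"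
      by (simp add: algebra_simps)
    also have "d * cnj d = of_real ((cmod d)\<^sup>2)" by (rule complex_norm_square[symmetric])
    also have "Re (of_real ((cmod d)\<^sup>2) * (x $ 1 / \<zeta> * cnj (x $ 2))) = (cmod d)\<^sup>2 * hform \<zeta> x"
      by (simp only: hform_def times_complex.sel Re_complex_of_real Im_complex_of_real mult_zero_left diff_zero)
    finally show ?thesis .
  qed
  have "aztec_Phi k \<alpha> \<beta> z *v v = ?d *s (?M *v v)"
    by (simp add: vec_eq_iff mat_vec_2 aztec_Phi_nth algebra_simps del: upt_Suc)
  then have "l *s v = ?d *s (?M *v v)" using v by simp
  then have "hform \<zeta> v = (cmod ?d)\<^sup>2 * hform \<zeta> (?M *v v)"
    using scale[of l v] scale[of ?d "?M *v v"] l1 by simp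
  also have "\<dots> > (cmod ?d)\<^sup>2 * (cmod (1 - \<zeta>\<^sup>2) ^ (2 * k) * hform \<zeta> v)"
    using Mv ze'(3,4) by (intro mult_strict_left_mono) auto
  \<comment> \<open>The prefactor exactly compensates the growth factor; the contradiction rests on
    strictness and not on the sign of the form.\<close>
  also have "(cmod ?d)\<^sup>2 * (cmod (1 - \<zeta>\<^sup>2) ^ (2 * k) * hform \<zeta> v) = hform \<zeta> v"
  proof -
    have "(cmod ?d)\<^sup>2 * cmod (1 - \<zeta>\<^sup>2) ^ (2 * k) = (cmod ?d * cmod (1 - \<zeta>\<^sup>2) ^ k)\<^sup>2"
      by (simp only: power_mult_distrib power_mult[symmetric] mult.commute)
    also have "cmod ?d * cmod (1 - \<zeta>\<^sup>2) ^ k = 1"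
      using ze'(3,4) by (simp add: norm_divide norm_power)
    finally show ?thesis by (simp add: mult.assoc[symmetric])
  qed
  finally show False by simp
qed

section \<open>The trace touching the band\<close>

text \<open>The derivative of t / (z - 1)^k is this polynomial divided by (z - 1)^(k + 1).\<close>

definition wronsk :: "nat \<Rightarrow> real poly \<Rightarrow> real poly" where
  "wronsk k t = [:-1, 1:] * pderiv t - smult (of_nat k) t"

lemma poly_wronsk: "poly (wronsk k t) s = (s - 1) * poly (pderiv t) s - of_nat k * poly t s"
  by (simp add: wronsk_def algebra_simps)

lemma poly_cpoly_wronsk:
  "poly (cpoly (wronsk k t)) z = (z - 1) * poly (pderiv (cpoly t)) z - of_nat k * poly (cpoly t) z"
  by (simp add: wronsk_def cpoly_simps algebra_simps)

lemma trace_has_field_derivative: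
  fixes P :: "'a::real_normed_field poly"
  assumes "z \<noteq> 1"
  shows "((\<lambda>z. poly P z / (z - 1) ^ k) has_field_derivative
      ((z - 1) * poly (pderiv P) z - of_nat k * poly P z) / (z - 1) ^ Suc k) (at z within S)"
proof -
  have nz: "(z - 1) ^ k \<noteq> 0" using assms by simp
  have dist: "u * (A * X - B * C) = (u * A) * X - B * (u * C)" for u A X B C :: 'a
    by (simp add: algebra_simps)
  have e: "(z - 1) * (of_nat k * (z - 1) ^ (k - Suc 0)) = of_nat k * (z - 1) ^ k"
    by (cases k) simp_all
  have "((\<lambda>z. poly P z / (z - 1) ^ k) has_field_derivative
      (poly (pderiv P) z * (z - 1) ^ k - poly P z * (of_nat k * (z - 1) ^ (k - Suc 0))) /
        ((z - 1) ^ k * (z - 1) ^ k)) (at z within S)"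
    using nz by (auto intro!: derivative_eq_intros poly_DERIV[THEN DERIV_subset])
  also have "(poly (pderiv P) z * (z - 1) ^ k - poly P z * (of_nat k * (z - 1) ^ (k - Suc 0))) /
        ((z - 1) ^ k * (z - 1) ^ k) =
      ((z - 1) * (poly (pderiv P) z * (z - 1) ^ k - poly P z * (of_nat k * (z - 1) ^ (k - Suc 0)))) /
        ((z - 1) * ((z - 1) ^ k * (z - 1) ^ k))"
    using assms by simp
  also have "(z - 1) * (poly (pderiv P) z * (z - 1) ^ k - poly P z * (of_nat k * (z - 1) ^ (k - Suc 0))) =
     ((z - 1) * poly (pderiv P) z - of_nat k * poly P z) * (z - 1) ^ k"
    unfolding dist e by (simp add: algebra_simps)
  also have "\<dots> / ((z - 1) * ((z - 1) ^ k * (z - 1) ^ k)) =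
      ((z - 1) * poly (pderiv P) z - of_nat k * poly P z) / (z - 1) ^ Suc k"
    using nz by simp
  finally show ?thesis .
qed

text \<open>Let t / (z - 1)^k reach 2 or -2 at \<open>y\<close> to order n >= 2 while staying
  outside (-2, 2) on [b1, b2]. Up to sign and a constant it is locally the n-th power of an open
  map, so a value just inside (-2, 2) is taken at two points near \<open>y\<close>. By
  \<open>off\<close> both are real; lying outside [b1, b2], they are on the same side of
  \<open>y\<close>, where the derivative has no zero nearby.\<close>

lemma no_touching:
  fixes t :: "real poly"
  assumes off: "\<And>z c. z \<notin> \<real>\<^sub>\<le>\<^sub>0 \<Longrightarrow> z \<noteq> 1 \<Longrightarrow> poly (cpoly t) z = of_real c * (z - 1) ^ k \<Longrightarrow> \<bar>c\<bar> > 2"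
    and t1: "poly t 1 \<noteq> 0" and k: "k \<ge> 1"
    and b: "b1 < b2" "b2 < 0" "b1 \<le> y" "y \<le> b2"
    and wide: "\<And>s. b1 \<le> s \<Longrightarrow> s \<le> b2 \<Longrightarrow> (poly t s)\<^sup>2 \<ge> 4 * (s - 1) ^ (2 * k)"
    and ty: "(poly t y)\<^sup>2 = 4 * (y - 1) ^ (2 * k)" and wy: "poly (wronsk k t) y = 0"
  shows False
proof -
  have y: "y < 0" using b by simp
  \<comment> \<open>The sign of the edge that is touched; with it, small negative values of
    \<open>f\<close> are values of the trace inside (-2, 2), whichever edge it is.\<close>
  define sg where "sg = poly t y / (2 * (y - 1) ^ k)"
  have sg2: "sg\<^sup>2 = 1"
    using ty y by (simp add: sg_def power_divide power_mult_distrib power_mult[symmetric] mult.commute)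
  then have sg: "sg = 1 \<or> sg = -1" by (simp add: power2_eq_1_iff)
  define f where "f z = of_real sg * (poly (cpoly t) z / (z - 1) ^ k) - 2" for z :: complex
  define fr where "fr s = sg * (poly t s / (s - 1) ^ k) - 2" for s :: real
  have f_real: "f (of_real s) = of_real (fr s)" for s
    by (simp add: f_def fr_def poly_cpoly_of_real)
  have "poly t y / (y - 1) ^ k = 2 * sg" by (simp add: sg_def)
  then have fry: "fr y = 0" using sg2 by (simp add: fr_def power2_eq_square)
  have df: "(f has_field_derivative of_real sg * (poly (cpoly (wronsk k t)) z / (z - 1) ^ Suc k)) (at z)"
    if "z \<noteq> 1" for z
    unfolding f_def poly_cpoly_wronsk
    by (rule derivative_eq_intros trace_has_field_derivative that refl)+ simp
  have dfr: "(fr has_field_derivative sg * (poly (wronsk k t) s / (s - 1) ^ Suc k)) (at s)"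
    if "s \<noteq> 1" for s
    unfolding fr_def poly_wronsk
    by (rule derivative_eq_intros trace_has_field_derivative that refl)+ simp
  have ball1: "z \<noteq> 1" if "z \<in> ball (of_real y) 1" for z :: complex
  proof
    assume "z = 1"
    then have "norm (of_real y - 1 :: complex) < 1" using that by (simp add: dist_norm)
    moreover have "of_real y - 1 = (of_real (y - 1) :: complex)" by simp
    ultimately have "\<bar>y - 1\<bar> < 1" by (metis norm_of_real)
    then show False using y by simp
  qed
  have hol: "f holomorphic_on ball (of_real y) 1"
    unfolding holomorphic_on_open[OF open_ball] using df ball1 by blast
  have w0: "wronsk k t \<noteq> 0"
  proof
    assume "wronsk k t = 0"
    then have "poly (wronsk k t) 1 = 0" by simp
    then show False using t1 k by (simp add: poly_wronsk)
  qed
  \<comment> \<open>Otherwise \<open>t\<close> would be a multiple of (z - 1)^k and vanish at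
    1.\<close>
  have ex: "\<exists>n>0. (deriv ^^ n) f (of_real y) \<noteq> 0"
  proof (rule ccontr)
    assume "\<not> ?thesis"
    then have all0: "\<And>n. 0 < n \<Longrightarrow> (deriv ^^ n) f (of_real y) = 0" by blast
    have const: "f z = f (of_real y)" if "z \<in> ball (of_real y) 1" for z
      by (rule holomorphic_fun_eq_const_on_connected[OF hol _ _ all0 _ that]) auto
    have fr0: "fr s = 0" if "\<bar>s - y\<bar> < 1" for s
    proof -
      have "norm (of_real y - of_real s :: complex) = \<bar>y - s\<bar>"
        by (simp only: of_real_diff[symmetric] norm_of_real)
      then have "of_real s \<in> ball (of_real y :: complex) 1" using that by (simp add: dist_norm)
      then have "f (of_real s) = f (of_real y)" by (rule const)
      then show ?thesis unfolding f_real using fry by simp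
    qed
    have eq: "poly (t - smult (2 * sg) ([:-1, 1:] ^ k)) s = 0" if "s \<in> {y - 1<..<y}" for s
    proof -
      have "(s - 1) ^ k \<noteq> 0" "fr s = 0" using that y fr0[of s] by auto
      then have "sg * poly t s = 2 * (s - 1) ^ k" by (auto simp: fr_def field_simps)
      then have "sg\<^sup>2 * poly t s = sg * (2 * (s - 1) ^ k)" by (simp add: power2_eq_square)
      then show ?thesis using sg2 by simp
    qed
    have "t - smult (2 * sg) ([:-1, 1:] ^ k) = 0"
    proof (rule ccontr)
      assume "\<not> ?thesis"
      then have "finite {s. poly (t - smult (2 * sg) ([:-1, 1:] ^ k)) s = 0}" by (rule poly_roots_finite)
      moreover have "{y - 1<..<y} \<subseteq> {s. poly (t - smult (2 * sg) ([:-1, 1:] ^ k)) s = 0}" using eq by auto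
      ultimately have "finite {y - 1<..<y}" by (rule rev_finite_subset)
      then show False by (simp add: infinite_Ioo)
    qed
    then have "t = smult (2 * sg) ([:-1, 1:] ^ k)" by simp
    then have "poly t 1 = 0" using k by (simp add: zero_power)
    then show False using t1 by simp
  qed
  define n where "n = (LEAST n. 0 < n \<and> (deriv ^^ n) f (of_real y) \<noteq> 0)"
  have n: "0 < n" "(deriv ^^ n) f (of_real y) \<noteq> 0"
    using LeastI_ex[OF ex] by (auto simp: n_def)
  have least: "(deriv ^^ i) f (of_real y) = 0" if "0 < i" "i < n" for i
    using not_less_Least[of i] that by (auto simp: n_def)
  have "deriv f (of_real y) = 0"
    using df[of "of_real y"] y wy by (intro DERIV_imp_deriv) (auto simp: poly_cpoly_of_real)
  then have "n \<noteq> 1" using n by auto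
  then have n2: "n \<ge> 2" using n by simp
  have cen: "of_real y \<in> ball (of_real y :: complex) 1" by simp
  have "\<exists>g r. 0 < r \<and> g holomorphic_on ball (of_real y) r \<and>
      (\<forall>w\<in>ball (of_real y) r. f w - f (of_real y) = ((w - of_real y) * g w) ^ n) \<and>
      (\<forall>w\<in>ball (of_real y) r. g w \<noteq> 0)"
  proof (rule holomorphic_factor_order_of_zero_strong[OF hol open_ball cen n])
    show "(deriv ^^ i) f (of_real y) = 0" if "0 < i" "i < n" for i by (rule least[OF that])
  next
    fix g r
    assume "0 < r" "g holomorphic_on ball (of_real y) r"
      "\<And>w. w \<in> ball (of_real y) r \<Longrightarrow> f w - f (of_real y) = ((w - of_real y) * g w) ^ n"
      "\<And>w. w \<in> ball (of_real y) r \<Longrightarrow> g w \<noteq> 0"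
    then show ?thesis by (intro exI[of _ g] exI[of _ r] conjI ballI)
  qed
  then obtain g r where r: "0 < r" and g: "g holomorphic_on ball (of_real y) r"
    and fac: "\<And>w. w \<in> ball (of_real y) r \<Longrightarrow> f w - f (of_real y) = ((w - of_real y) * g w) ^ n"
    and gnz: "\<And>w. w \<in> ball (of_real y) r \<Longrightarrow> g w \<noteq> 0"
    by (elim exE conjE) metis
  define A where "A = {s. poly (wronsk k t) s = 0} - {y}"
  have "finite A" using poly_roots_finite[OF w0] by (simp add: A_def)
  then obtain d0 where d0: "d0 > 0" "\<And>s. s \<in> A \<Longrightarrow> d0 \<le> dist y s"
    using finite_set_avoid[of A y] by (metis A_def Diff_iff insertI1)
  \<comment> \<open>The value 1 is a placeholder for an end that coincides with \<open>y\<close> and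
    imposes no condition.\<close>
  define d1 where "d1 = (if b1 < y then y - b1 else 1)"
  define d2 where "d2 = (if y < b2 then b2 - y else 1)"
  have d12: "d1 > 0" "d2 > 0" by (simp_all add: d1_def d2_def)
  \<comment> \<open>Within this radius \<open>f\<close> factors, the points 0 and 1 are avoided,
    \<open>y\<close> is the only critical point of \<open>fr\<close>, and no end of the interval
    other than \<open>y\<close> is passed.\<close>
  define d where "d = min r (min d0 (min 1 (min (- y) (min d1 d2))))"
  have dle: "d \<le> r" "d \<le> d0" "d \<le> 1" "d \<le> - y" "d \<le> d1" "d \<le> d2"
    unfolding d_def by linarith+
  have "d > 0"
    unfolding d_def min_less_iff_conj using r d0(1) y d12 by simp
  then have d: "d > 0" "d \<le> r" "d \<le> d0" "d \<le> 1" "d \<le> - y" "b1 < y \<Longrightarrow> d \<le> y - b1" "y < b2 \<Longrightarrow> d \<le> b2 - y"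
    using dle(1-4) dle(5,6)[unfolded d1_def d2_def] by simp_all
  define phi where "phi w = (w - of_real y) * g w" for w
  have sub: "ball (of_real y) d \<subseteq> ball (of_real y :: complex) r" using d by auto
  have phi_hol: "phi holomorphic_on ball (of_real y) d"
    unfolding phi_def using g sub by (intro holomorphic_intros) (auto elim: holomorphic_on_subset)
  have "\<not> phi constant_on ball (of_real y) d"
  proof
    assume "phi constant_on ball (of_real y) d"
    moreover have "of_real (y + d / 2) \<in> ball (of_real y :: complex) d" "of_real y \<in> ball (of_real y :: complex) d"
      using d by (auto simp: dist_norm)
    ultimately have "phi (of_real (y + d / 2)) = phi (of_real y)"
      unfolding constant_on_def by metis
    moreover have "phi (of_real (y + d / 2)) \<noteq> 0"
      using d gnz[of "of_real (y + d / 2)"] by (auto simp: phi_def dist_norm)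
    ultimately show False by (simp add: phi_def)
  qed
  then have "open (phi ` ball (of_real y) d)"
    by (intro open_mapping_thm[OF phi_hol]) auto
  moreover have "0 \<in> phi ` ball (of_real y) d"
    using d by (intro image_eqI[of _ _ "of_real y"]) (auto simp: phi_def)
  ultimately obtain e0 where e0: "e0 > 0" "ball 0 e0 \<subseteq> phi ` ball (of_real y) d"
    by (rule openE)
  \<comment> \<open>Below 1, so that 2 - e^n lies between 1 and 2 and \<open>off\<close>
    applies.\<close>
  define e where "e = min (e0 / 2) (1 / 2)"
  have e: "0 < e" "e < e0" "e < 1" using e0 by (auto simp: e_def)
  have root: "\<exists>s. \<bar>s - y\<bar> < d \<and> fr s = - (e ^ n) \<and> phi (of_real s) = of_real e * cis x"
    if x: "cis x ^ n = -1" for x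
  proof -
    have "of_real e * cis x \<in> ball 0 e0" using e by (simp add: norm_mult)
    then obtain z where z: "z \<in> ball (of_real y) d" "phi z = of_real e * cis x" using e0 by (metis imageE subsetD)
    have "f z = phi z ^ n"
      using fac[of z] z(1) sub f_real[of y] fry by (auto simp: phi_def)
    also have "\<dots> = of_real (- (e ^ n))" unfolding z(2) power_mult_distrib x by simp
    finally have fz: "f z = of_real (- (e ^ n))" .
    have z1: "z \<noteq> 1" using ball1[of z] z(1) d by auto
    have "of_real sg * (poly (cpoly t) z / (z - 1) ^ k) = of_real (2 - e ^ n)"
      using fz by (simp add: f_def algebra_simps)
    then have "of_real sg * (of_real sg * (poly (cpoly t) z / (z - 1) ^ k)) = of_real sg * of_real (2 - e ^ n)"
      by simp
    moreover have "of_real sg * of_real sg = (1 :: complex)"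
      using sg2 by (metis of_real_mult of_real_1 power2_eq_square)
    ultimately have "poly (cpoly t) z / (z - 1) ^ k = of_real (sg * (2 - e ^ n))"
      by (simp add: mult.assoc[symmetric])
    then have eq: "poly (cpoly t) z = of_real (sg * (2 - e ^ n)) * (z - 1) ^ k"
      using z1 by (simp add: divide_eq_eq)
    have "0 < e ^ n" "e ^ n < 1" using e n by (auto simp: power_less_one_iff)
    then have "\<bar>sg * (2 - e ^ n)\<bar> \<le> 2" using sg by auto
    then have "z \<in> \<real>\<^sub>\<le>\<^sub>0" using off[OF _ z1 eq] by (meson not_less)
    then obtain s where s: "z = of_real s" by (auto elim: nonpos_Reals_cases)
    have "norm (of_real (s - y) :: complex) < d"
      using z(1) unfolding s by (simp add: dist_norm norm_minus_commute)
    then have "\<bar>s - y\<bar> < d" by (simp only: norm_of_real)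
    moreover have "fr s = - (e ^ n)" using fz f_real[of s] unfolding s by (metis of_real_eq_iff)
    ultimately show ?thesis using z(2) s by auto
  qed
  \<comment> \<open>As n >= 2, the roots of -1 with arguments pi/n and -pi/n are not real and lie in
    different half planes, so their preimages under \<open>phi\<close> differ.\<close>
  have pn: "0 < pi / n" "pi / n < pi" using n2 by (auto simp: field_simps)
  have "cis (pi / n) ^ n = cis pi" "cis (- (pi / n)) ^ n = cis (- pi)"
    unfolding Complex.DeMoivre using n(1) by simp_all
  then have cis: "cis (pi / n) ^ n = -1" "cis (- (pi / n)) ^ n = -1"
    by (simp_all add: complex_eq_iff)
  obtain s1 s2 where s: "\<bar>s1 - y\<bar> < d" "\<bar>s2 - y\<bar> < d" "fr s1 = - (e ^ n)" "fr s2 = - (e ^ n)"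
    "phi (of_real s1) = of_real e * cis (pi / n)" "phi (of_real s2) = of_real e * cis (- (pi / n))"
    using root[OF cis(1)] root[OF cis(2)] by blast
  have "Im (of_real e * cis (pi / n)) > 0" "Im (of_real e * cis (- (pi / n))) < 0"
    using sin_gt_zero[OF pn] e by auto
  then have s12: "s1 \<noteq> s2" using s(5,6) by (metis less_asym)
  have en: "0 < e ^ n" "e ^ n < 1" using e n by (auto simp: power_less_one_iff)
  have outside: "\<not> (b1 \<le> s \<and> s \<le> b2)" if "fr s = - (e ^ n)" for s
  proof
    assume bs: "b1 \<le> s \<and> s \<le> b2"
    have "sg * (poly t s / (s - 1) ^ k) = 2 - e ^ n" using that by (simp add: fr_def)
    then have "(sg * (poly t s / (s - 1) ^ k))\<^sup>2 = (2 - e ^ n)\<^sup>2" by (rule arg_cong)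
    then have "(poly t s / (s - 1) ^ k)\<^sup>2 = (2 - e ^ n)\<^sup>2" unfolding power_mult_distrib sg2 by simp
    also have "\<dots> < 2\<^sup>2" using en by (intro power_strict_mono) auto
    finally have "(poly t s)\<^sup>2 / ((s - 1) ^ k)\<^sup>2 < 4" by (simp add: power_divide)
    moreover have "((s - 1) ^ k)\<^sup>2 > 0" using bs b by simp
    ultimately have "(poly t s)\<^sup>2 < 4 * ((s - 1) ^ k)\<^sup>2" by (simp only: pos_divide_less_eq)
    then have "(poly t s)\<^sup>2 < 4 * (s - 1) ^ (2 * k)"
      by (simp add: power_mult[symmetric] mult.commute)
    then show False using wide[of s] bs by simp
  qed
  \<comment> \<open>A critical point between two points on one side of \<open>y\<close> differs from
    \<open>y\<close>, against the choice of \<open>d\<close>.\<close>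
  have rolle: False if "s < s'" "fr s = fr s'" "\<bar>s - y\<bar> < d" "\<bar>s' - y\<bar> < d" "y < s \<or> s' < y" for s s'
  proof -
    have "\<exists>x. s < x \<and> x < s' \<and> sg * (poly (wronsk k t) x / (x - 1) ^ Suc k) = 0"
    proof -
      have ne: "x \<noteq> 1" if "s \<le> x" "x \<le> s'" for x using that \<open>\<bar>s' - y\<bar> < d\<close> d(5) by linarith
      have "\<exists>z>s. z < s' \<and> (fr has_real_derivative 0) (at z)"
      proof (rule Rolle[OF that(1,2)])
        show "continuous_on {s..s'} fr"
          using dfr[OF ne] by (intro DERIV_continuous_on[of _ fr]) (auto intro: has_field_derivative_at_within)
        show "fr differentiable at x" if "s < x" "x < s'" for x
          using dfr[OF ne[of x]] that by (auto simp: real_differentiable_def)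
      qed
      then obtain z where z: "s < z" "z < s'" "(fr has_real_derivative 0) (at z)" by blast
      have "sg * (poly (wronsk k t) z / (z - 1) ^ Suc k) = 0"
        using DERIV_unique[OF dfr[OF ne[of z]] z(3)] z by simp
      then show ?thesis using z by blast
    qed
    then obtain x where x: "s < x" "x < s'" "sg * (poly (wronsk k t) x / (x - 1) ^ Suc k) = 0" by blast
    have "x \<noteq> 1" "x \<noteq> y" "\<bar>x - y\<bar> < d" using x that d y by auto
    then have "x \<in> A" using x(3) sg by (auto simp: A_def)
    then show False using d0(2)[of x] d(3) \<open>\<bar>x - y\<bar> < d\<close> by (simp add: dist_real_def)
  qed
  have out: "\<not> (b1 \<le> s1 \<and> s1 \<le> b2)" "\<not> (b1 \<le> s2 \<and> s2 \<le> b2)"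
    using outside s by auto
  show False
  \<comment> \<open>If b1 < y, then d <= y - b1 keeps the points from leaving the interval on the
    left. Otherwise y = b1, and d <= b2 - y does so on the right.\<close>
  proof (cases "b1 < y")
    case True
    then have "s1 > y" "s2 > y" using out s d(6) b by auto
    then show False
      using rolle[of s1 s2] rolle[of s2 s1] s(1-4) s12 by (cases s1 s2 rule: linorder_cases) auto
  next
    case False
    then have "y < b2" "y = b1" using b by auto
    then have "s1 < y" "s2 < y" using out s d(7) b by auto
    then show False
      using rolle[of s1 s2] rolle[of s2 s1] s(1-4) s12 by (cases s1 s2 rule: linorder_cases) auto
  qed
qed

section \<open>Polynomial data of the Aztec diamond\<close>

lemma prod_linear_dvd:
  fixes g :: "'a::idom poly"
  assumes "finite A" "\<And>a. a \<in> A \<Longrightarrow> poly g a = 0"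
  shows "(\<Prod>a\<in>A. [:- a, 1:]) dvd g"
  using assms
proof (induction A rule: finite_induct)
  case (insert a A)
  then obtain h where h: "g = (\<Prod>a\<in>A. [:- a, 1:]) * h" by (auto elim: dvdE)
  have "poly (\<Prod>a\<in>A. [:- a, 1:]) a \<noteq> 0" using insert by (auto simp: poly_prod)
  moreover have "poly g a = 0" using insert by simp
  ultimately have "poly h a = 0" by (simp add: h)
  then have "[:- a, 1:] dvd h" by (simp add: poly_eq_0_iff_dvd)
  then have "(\<Prod>a\<in>A. [:- a, 1:]) * [:- a, 1:] dvd g" unfolding h by (intro mult_dvd_mono) auto
  then show ?case using insert by (simp add: mult.commute)
qed simp

lemma poly_eq_if_infinite:
  fixes p r :: "'a::idom poly"
  assumes "infinite S" "\<And>z. z \<in> S \<Longrightarrow> poly p z = poly r z"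
  shows "p = r"
proof (rule ccontr)
  assume "p \<noteq> r"
  then have "finite {z. poly (p - r) z = 0}" by (intro poly_roots_finite) simp
  moreover have "S \<subseteq> {z. poly (p - r) z = 0}" using assms(2) by auto
  ultimately show False using assms(1) finite_subset by blast
qed

locale aztec =
  fixes k k' :: nat
    and \<alpha> \<beta> x :: "nat \<Rightarrow> real"
    and p q p0 :: "complex poly"
  assumes k: "k \<ge> 1"
    and \<alpha>: "\<And>m. m \<in> {1..k} \<Longrightarrow> \<alpha> m > 0"
    and \<beta>: "\<And>m. m \<in> {1..k} \<Longrightarrow> \<beta> m > 0"
    and p: "\<And>z. z \<noteq> 0 \<Longrightarrow> z \<noteq> 1 \<Longrightarrow> poly p z = aztec_p k \<alpha> \<beta> z"
    and pq: "p = q\<^sup>2 * p0" and q: "rsquarefree q" and p0: "rsquarefree p0" and q_monic: "lead_coeff q = 1"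
    and k': "k' \<ge> 1"
    and roots: "{z. poly p0 z = 0} = (\<lambda>i. complex_of_real (x i)) ` {..2 * (k' - 1)}"
    and x0: "x 0 = 0"
    and x_dec: "\<And>i. i < 2 * (k' - 1) \<Longrightarrow> x (Suc i) < x i"
begin

section \<open>The trace polynomial and the real form of p\<close>

definition is_t :: "real poly \<Rightarrow> bool" where
  "is_t t \<longleftrightarrow> nonneg_poly t \<and> degree t \<le> k \<and> coeff t k = 2 \<and>
    (\<forall>z. z \<noteq> 0 \<longrightarrow> z \<noteq> 1 \<longrightarrow> (z - 1) ^ k * trace (aztec_Phi k \<alpha> \<beta> z) = poly (cpoly t) z)"

definition t :: "real poly" where "t = (SOME t. is_t t)"

lemma t: "nonneg_poly t" "degree t \<le> k" "coeff t k = 2"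
  "\<And>z. z \<noteq> 0 \<Longrightarrow> z \<noteq> 1 \<Longrightarrow> (z - 1) ^ k * trace (aztec_Phi k \<alpha> \<beta> z) = poly (cpoly t) z"
proof -
  have "\<exists>t. is_t t"
    using aztec_trace_poly[of k \<alpha> \<beta>] \<alpha> \<beta> unfolding is_t_def by metis
  then have "is_t t" unfolding t_def by (rule someI_ex)
  then show "nonneg_poly t" "degree t \<le> k" "coeff t k = 2"
    "\<And>z. z \<noteq> 0 \<Longrightarrow> z \<noteq> 1 \<Longrightarrow> (z - 1) ^ k * trace (aztec_Phi k \<alpha> \<beta> z) = poly (cpoly t) z"
    by (auto simp: is_t_def)
qed

lemma trace_eq: "z \<noteq> 0 \<Longrightarrow> z \<noteq> 1 \<Longrightarrow> trace (aztec_Phi k \<alpha> \<beta> z) = poly (cpoly t) z / (z - 1) ^ k"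
  using t(4)[of z] by (simp add: field_simps)

text \<open>All coefficients are nonnegative and the leading one is 2.\<close>

lemma t_one: "poly t 1 > 0"
proof -
  have nn: "coeff t i \<ge> 0" for i using t(1) by (simp add: nonneg_poly_def)
  have "degree t = k" using t(2,3) by (intro antisym le_degree) auto
  then have "coeff t k \<le> (\<Sum>i\<le>degree t. coeff t i)"
    using nn by (intro member_le_sum) auto
  then show ?thesis using t(3) by (simp add: poly_altdef)
qed

lemma t_off:
  assumes "z \<notin> \<real>\<^sub>\<le>\<^sub>0" "z \<noteq> 1" "poly (cpoly t) z = of_real c * (z - 1) ^ k"
  shows "\<bar>c\<bar> > 2"
proof -
  have "z \<noteq> 0" using assms by auto
  then have "trace (aztec_Phi k \<alpha> \<beta> z) = of_real c" using assms by (simp add: trace_eq)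
  with assms(1,2) show ?thesis
    using trace_aztec_Phi_off_band[of k \<alpha> \<beta> z c] k \<alpha> \<beta> by blast
qed

definition pr :: "real poly" where "pr = t\<^sup>2 - smult 4 ([:-1, 1:] ^ (2 * k))"

lemma poly_pr: "poly pr s = (poly t s)\<^sup>2 - 4 * (s - 1) ^ (2 * k)"
  by (simp add: pr_def)

lemma cpoly_pr: "cpoly pr = (cpoly t)\<^sup>2 - smult 4 ([:-1, 1:] ^ (2 * k))"
  by (simp add: pr_def cpoly_simps cpoly_power)

lemma p_pr: "p = cpoly pr"
proof (rule poly_eq_if_infinite[of "UNIV - {0, 1}"])
  show "infinite (UNIV - {0, 1 :: complex})" by (simp add: infinite_UNIV_char_0)
  fix z :: complex assume "z \<in> UNIV - {0, 1}"
  then show "poly p z = poly (cpoly pr) z"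
    using p[of z] t(4)[of z] by (simp add: aztec_p_def cpoly_pr)
qed

text \<open>With X = (z - 1)^k and s = t - 2 X the polynomial factors as s (s + 4 X). The leading
  terms of s cancel, and its next coefficient is that of t plus 2k, hence positive.\<close>

lemma degree_pr: "degree pr = 2 * k - 1" "lead_coeff pr > 0"
proof -
  define X where "X = ([:-1, 1:] :: real poly) ^ k"
  have X: "degree X = k" "coeff X k = 1" "coeff X (k - 1) = - real k"
    unfolding X_def using k by (simp_all add: degree_linear_power coeff_linear_poly_power binomial_symmetric)
  define s where "s = t - smult 2 X"
  have pr: "pr = s * (s + smult 4 X)"
  proof -
    have "smult 4 X = smult 2 X + smult 2 X" unfolding smult_add_left[symmetric] by simp
    then have "s * (s + smult 4 X) = (t - smult 2 X) * (t + smult 2 X)" by (simp add: s_def)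
    also have "\<dots> = t * t - smult 2 X * smult 2 X" by (simp add: algebra_simps)
    also have "[:-1, 1:] ^ (2 * k) = X * X"
      unfolding X_def by (simp add: mult_2 power_add)
    then have "t * t - smult 2 X * smult 2 X = pr" by (simp add: pr_def power2_eq_square)
    finally show ?thesis by simp
  qed
  have s1: "coeff s (k - 1) > 0"
    using t(1) k X by (simp add: s_def nonneg_poly_def add_nonneg_pos)
  have "degree s \<le> k" unfolding s_def using t(2) X by (intro degree_diff_le order_trans[OF degree_smult_le]) auto
  moreover have "coeff s k = 0" using t(3) X by (simp add: s_def)
  ultimately have "degree s < k" using k
    by (metis le_neq_implies_less leading_coeff_0_iff degree_0 less_one not_less_eq_eq One_nat_def not_le zero_less_one)
  moreover have "k - 1 \<le> degree s" using s1 by (intro le_degree) simp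
  ultimately have ds: "degree s = k - 1" by simp
  have "degree (s + smult 4 X) = degree (smult 4 X)"
    using ds X k by (intro degree_add_eq_right) simp
  then have d4: "degree (s + smult 4 X) = k" using X by simp
  have l4: "coeff (s + smult 4 X) k = 4" using ds k X by (simp add: coeff_eq_0)
  have "s \<noteq> 0" "s + smult 4 X \<noteq> 0" using s1 l4 by (metis coeff_0 less_irrefl, metis coeff_0 zero_neq_numeral)
  then show "degree pr = 2 * k - 1" using ds d4 k by (simp add: pr degree_mult_eq)
  show "lead_coeff pr > 0" unfolding pr lead_coeff_mult using ds d4 l4 s1 by simp
qed

section \<open>Real forms of q and p0\<close>

definition n :: nat where "n = k' - 1"
definition Q :: "real poly" where "Q = (\<Prod>z | poly q z = 0. [:- Re z, 1:])"
definition P :: "real poly" where "P = smult (lead_coeff pr) (\<Prod>i\<le>2 * n. [:- x i, 1:])"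

lemma q0: "q \<noteq> 0" and p00: "p0 \<noteq> 0"
  using q p0 by (auto simp: rsquarefree_def)

text \<open>At a root of q the trace is 2 or -2, which is only possible on the nonpositive
  axis.\<close>

lemma q_root_real:
  assumes "poly q z = 0"
  shows "z = of_real (Re z)"
proof -
  have "poly p z = 0" using assms by (simp add: pq)
  then have "(poly (cpoly t) z)\<^sup>2 = (2 * (z - 1) ^ k)\<^sup>2"
    by (simp add: p_pr cpoly_pr power_mult_distrib power_mult[symmetric] mult.commute)
  then have e: "poly (cpoly t) z = of_real 2 * (z - 1) ^ k \<or> poly (cpoly t) z = of_real (-2) * (z - 1) ^ k"
    unfolding power2_eq_iff by simp
  have "z \<noteq> 1"
  proof
    assume "z = 1"
    then have "poly (cpoly t) (of_real 1) = 0" using e k by auto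
    then show False using t_one unfolding poly_cpoly_of_real by simp
  qed
  then have "z \<in> \<real>\<^sub>\<le>\<^sub>0" using t_off[of z 2] t_off[of z "-2"] e by fastforce
  then show ?thesis by (auto elim: nonpos_Reals_cases)
qed

lemma cpoly_Q: "cpoly Q = q"
proof -
  have "cpoly Q = (\<Prod>z | poly q z = 0. [:- of_real (Re z), 1:])"
    by (simp add: Q_def cpoly_prod cpoly_simps)
  also have "\<dots> = (\<Prod>z | poly q z = 0. [:- z, 1:])"
    using q_root_real by (intro prod.cong) auto
  also have "\<dots> = q" using complex_poly_decompose_rsquarefree[OF q] q_monic by simp
  finally show ?thesis .
qed

lemma x_less: "i < j \<Longrightarrow> j \<le> 2 * n \<Longrightarrow> x j < x i"
proof (induction j)
  case (Suc j)
  have "x (Suc j) < x j" using Suc.prems(2) unfolding n_def by (intro x_dec) linarith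
  moreover have "x j \<le> x i" using Suc by (cases "i = j") auto
  ultimately show ?case by linarith
qed simp

lemma x_inj: "inj_on x {..2 * n}"
proof (rule inj_onI)
  fix i j assume "i \<in> {..2 * n}" "j \<in> {..2 * n}" "x i = x j"
  then show "i = j" using x_less[of i j] x_less[of j i] by (cases i j rule: linorder_cases) auto
qed

lemma cpoly_P: "cpoly P = p0"
proof -
  have "inj_on (\<lambda>i. complex_of_real (x i)) {..2 * n}" using x_inj by (auto simp: inj_on_def)
  then have "(\<Prod>i\<le>2 * n. [:- complex_of_real (x i), 1:]) = (\<Prod>z | poly p0 z = 0. [:- z, 1:])"
    unfolding roots n_def by (subst prod.reindex) auto
  moreover have "lead_coeff p0 = of_real (lead_coeff pr)"
  proof -
    have "lead_coeff p = lead_coeff p0" unfolding pq lead_coeff_mult lead_coeff_power q_monic by simp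
    then show ?thesis unfolding p_pr by simp
  qed
  ultimately show ?thesis
    using complex_poly_decompose_rsquarefree[OF p0]
    by (simp add: P_def cpoly_simps cpoly_prod)
qed

lemma pr_eq: "pr = Q\<^sup>2 * P"
proof -
  have "cpoly pr = cpoly (Q\<^sup>2 * P)"
    unfolding cpoly_simps cpoly_power cpoly_Q cpoly_P using pq p_pr by simp
  then show ?thesis by simp
qed

lemma QP0: "Q \<noteq> 0" "P \<noteq> 0"
  using cpoly_Q cpoly_P q0 p00 by (auto simp: cpoly_simps)

lemma degree_P: "degree P = 2 * n + 1"
proof -
  have "degree (\<Prod>i\<le>2 * n. [:- x i, 1:]) = (\<Sum>i\<le>2 * n. degree [:- x i, 1:])"
    by (intro degree_prod_eq_sum_degree) auto
  moreover have "pr \<noteq> 0" using degree_pr(2) by auto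
  ultimately show ?thesis by (simp add: P_def)
qed

lemma degree_Q: "degree Q = k - k'" "k' \<le> k"
proof -
  have "2 * k - 1 = 2 * degree Q + (2 * n + 1)"
    using degree_pr(1) QP0 unfolding pr_eq by (simp add: degree_mult_eq degree_power_eq degree_P)
  then show "degree Q = k - k'" "k' \<le> k" using k k' by (auto simp: n_def)
qed

lemma P_root: "i \<le> 2 * n \<Longrightarrow> poly P (x i) = 0"
  by (auto simp: P_def poly_prod)

text \<open>Exactly the 2l roots x_0, ..., x_(2l-1) lie to the right of \<open>s\<close>, so an even
  number of linear factors is negative.\<close>

lemma P_pos:
  assumes l: "l \<in> {1..n}" and s: "x (2 * l) < s" "s < x (2 * l - 1)"
  shows "poly P s > 0"
proof -
  have "(\<Prod>i\<le>2 * n. s - x i) = (\<Prod>i<2 * l. s - x i) * (\<Prod>i=2 * l..2 * n. s - x i)"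
    using l by (subst prod.union_disjoint[symmetric]) (auto intro!: prod.cong)
  also have "(\<Prod>i<2 * l. s - x i) = (\<Prod>i<2 * l. (-1) * (x i - s))" by (simp add: algebra_simps)
  also have "\<dots> = (\<Prod>i<2 * l. x i - s)" unfolding prod.distrib by simp
  finally have "poly P s = lead_coeff pr * ((\<Prod>i<2 * l. x i - s) * (\<Prod>i=2 * l..2 * n. s - x i))"
    by (simp add: P_def poly_prod)
  moreover have "(\<Prod>i<2 * l. x i - s) > 0"
  proof (rule prod_pos)
    fix i assume "i \<in> {..<2 * l}"
    then have "i = 2 * l - 1 \<or> i < 2 * l - 1" by auto
    moreover have "2 * l - 1 \<le> 2 * n" using l by auto
    ultimately have "x (2 * l - 1) \<le> x i" using x_less[of i "2 * l - 1"] by auto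
    then show "0 < x i - s" using s by simp
  qed
  moreover have "(\<Prod>i=2 * l..2 * n. s - x i) > 0"
  proof (rule prod_pos)
    fix i assume "i \<in> {2 * l..2 * n}"
    then have "i = 2 * l \<or> 2 * l < i" "i \<le> 2 * n" by auto
    then have "x i \<le> x (2 * l)" using x_less[of "2 * l" i] by auto
    then show "0 < s - x i" using s by simp
  qed
  ultimately show ?thesis using degree_pr(2) by (simp add: mult_pos_pos)
qed

section \<open>The cofactor h and its sign change\<close>

definition G :: "real poly" where "G = wronsk k t"
definition h :: "real poly" where "h = G div Q"

text \<open>The operator (z - 1) d/dz - 2k annihilates (z - 1)^(2k), so applied to \<open>pr\<close>
  it only sees the square of t.\<close>

lemma two_t_G: "smult 2 t * G = [:-1, 1:] * pderiv pr - smult (2 * of_nat k) pr"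
proof -
  have "pderiv ([:-1, 1:] ^ (2 * k) :: real poly) = smult (of_nat (2 * k)) ([:-1, 1:] ^ (2 * k - 1))"
    using k by (subst pderiv_power) (simp add: pderiv_pCons)
  then have e: "[:-1, 1:] * pderiv ([:-1, 1:] ^ (2 * k) :: real poly) = smult (of_nat (2 * k)) ([:-1, 1:] ^ (2 * k))"
    using k by (cases "2 * k") simp_all
  have "[:-1, 1:] * pderiv pr = smult 2 (t * ([:-1, 1:] * pderiv t)) - smult 4 ([:-1, 1:] * pderiv ([:-1, 1:] ^ (2 * k)))"
    unfolding pr_def pderiv_diff pderiv_smult power2_eq_square pderiv_mult
    by (simp only: smult_diff_right mult_smult_right mult_smult_left right_diff_distrib)
       (simp add: algebra_simps flip: numeral_mult_conv_smult)
  also have "\<dots> = smult 2 (t * ([:-1, 1:] * pderiv t)) - smult (2 * of_nat k) (smult 4 ([:-1, 1:] ^ (2 * k)))"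
    unfolding e by simp
  finally show ?thesis
    unfolding G_def wronsk_def pr_def power2_eq_square
    by (simp add: smult_diff_right right_diff_distrib mult_smult_right mult.commute)
qed

lemma Q_root_t: "poly Q s = 0 \<Longrightarrow> poly t s \<noteq> 0"
proof
  assume a: "poly Q s = 0" "poly t s = 0"
  have "poly pr s = 0" using a by (simp add: pr_eq)
  then have "(s - 1) ^ (2 * k) = 0" using a k by (simp add: poly_pr)
  then have "s = 1" by simp
  then show False using a t_one by simp
qed

lemma two_t_G': "smult 2 t * G = Q * ([:-1, 1:] * (smult 2 (pderiv Q * P) + Q * pderiv P) - smult (2 * of_nat k) (Q * P))"
  unfolding two_t_G pr_eq power2_eq_square pderiv_mult
  by (simp add: algebra_simps flip: numeral_mult_conv_smult)

text \<open>At a root of \<open>Q\<close> the polynomial \<open>pr\<close> has a multiple zero, so t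
  G vanishes there. But t does not, and the roots of \<open>Q\<close> are simple.\<close>

lemma G_eq: "G = Q * h"
proof -
  have "Q dvd G" unfolding Q_def
  proof -
    have "Q = (\<Prod>s\<in>Re ` {z. poly q z = 0}. [:- s, 1:])"
    proof -
      have "inj_on Re {z. poly q z = 0}" using q_root_real by (intro inj_onI) (metis mem_Collect_eq)
      then show ?thesis by (simp add: Q_def prod.reindex)
    qed
    moreover have "poly G s = 0" if s: "s \<in> Re ` {z. poly q z = 0}" for s
    proof -
      obtain z where z: "poly q z = 0" "s = Re z" using s by blast
      then have "poly (cpoly Q) (of_real s) = 0" using q_root_real[of z] by (simp add: cpoly_Q)
      then have Qs: "poly Q s = 0" unfolding poly_cpoly_of_real by simp
      have "poly (smult 2 t * G) s = 0" unfolding two_t_G' using Qs by simp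
      then show ?thesis using Q_root_t[OF Qs] by simp
    qed
    moreover have "finite (Re ` {z. poly q z = 0})" using poly_roots_finite[OF q0] by simp
    ultimately show "(\<Prod>z | poly q z = 0. [:- Re z, 1:]) dvd G"
      using prod_linear_dvd[of "Re ` {z. poly q z = 0}" G] by (simp add: Q_def)
  qed
  then show ?thesis by (simp add: h_def)
qed

text \<open>This form gives \<open>h\<close> at the ends of an oval, where \<open>P\<close>
  vanishes, and at 1, where all derivative terms drop out.\<close>

lemma two_t_h:
  "2 * poly t s * poly h s = (s - 1) * (2 * poly (pderiv Q) s * poly P s + poly Q s * poly (pderiv P) s)
      - 2 * real k * poly Q s * poly P s"
proof -
  have "Q * (smult 2 t * h) =
      Q * ([:-1, 1:] * (smult 2 (pderiv Q * P) + Q * pderiv P) - smult (2 * of_nat k) (Q * P))"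
    unfolding two_t_G'[symmetric] G_eq by (simp add: algebra_simps)
  then have "smult 2 t * h = [:-1, 1:] * (smult 2 (pderiv Q * P) + Q * pderiv P) - smult (2 * of_nat k) (Q * P)"
    by (rule mult_left_cancel[OF QP0(1), THEN iffD1])
  then have "poly (smult 2 t * h) s =
      poly ([:-1, 1:] * (smult 2 (pderiv Q * P) + Q * pderiv P) - smult (2 * of_nat k) (Q * P)) s" by simp
  then show ?thesis by (simp add: algebra_simps)
qed

lemma G_one: "poly G 1 \<noteq> 0"
  using t_one k by (simp add: G_def poly_wronsk)

text \<open>The terms 2k z^k of (z - 1) t' and k t cancel, so \<open>G\<close> has degree at most k
  - 1, of which \<open>Q\<close> takes k - k'.\<close>

lemma degree_h: "degree h \<le> n"
proof -
  have G0: "G \<noteq> 0" using G_one by auto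
  have "coeff (pderiv t) (k - 1) = of_nat k * coeff t k" using k by (simp add: coeff_pderiv)
  moreover have "coeff (pderiv t) k = 0" using t(2) by (simp add: coeff_pderiv coeff_eq_0)
  moreover have "coeff ([:-1, 1:] * D) j = coeff D (j - 1) - coeff D j" if "j \<ge> 1" for D :: "real poly" and j
    using that by (cases j) simp_all
  ultimately have "coeff G k = 0"
    using k unfolding G_def wronsk_def coeff_diff coeff_smult by simp
  moreover have "degree G \<le> k"
  proof -
    have "degree (pderiv t) \<le> k - 1" using t(2) by (simp add: degree_pderiv)
    then have "degree ([:-1, 1:] * pderiv t) \<le> k"
      using k by (intro order_trans[OF degree_mult_le]) simp
    then show ?thesis unfolding G_def wronsk_def
      using t(2) by (intro degree_diff_le order_trans[OF degree_smult_le])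
  qed
  ultimately have "degree G \<noteq> k" using G0 by (metis leading_coeff_0_iff)
  then have "degree G \<le> k - 1" using \<open>degree G \<le> k\<close> by simp
  moreover have "degree G = degree Q + degree h"
    using G0 unfolding G_eq by (intro degree_mult_eq) auto
  ultimately show ?thesis using degree_Q k' by (simp add: n_def)
qed

text \<open>At 1 the relations reduce to t^2 = Q^2 P and t h = - k Q P.\<close>

lemma h_one: "(poly h 1)\<^sup>2 = (real k)\<^sup>2 * poly P 1"
proof -
  have "(poly t 1 * poly h 1)\<^sup>2 = (real k)\<^sup>2 * (poly Q 1)\<^sup>2 * (poly P 1)\<^sup>2"
    using two_t_h[of 1] by (simp add: power_mult_distrib)
  moreover have "(poly t 1)\<^sup>2 = (poly Q 1)\<^sup>2 * poly P 1"
    using poly_pr[of 1] k by (simp add: pr_eq)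
  moreover have "(real k)\<^sup>2 * (poly Q 1)\<^sup>2 * (poly P 1)\<^sup>2 = ((poly Q 1)\<^sup>2 * poly P 1) * ((real k)\<^sup>2 * poly P 1)"
    by (simp add: power2_eq_square)
  ultimately have "(poly t 1)\<^sup>2 * (poly h 1)\<^sup>2 = (poly t 1)\<^sup>2 * ((real k)\<^sup>2 * poly P 1)"
    by (simp only: power_mult_distrib)
  then show ?thesis using t_one by simp
qed

lemma P_nonneg:
  assumes l: "l \<in> {1..n}" and s: "x (2 * l) \<le> s" "s \<le> x (2 * l - 1)"
  shows "poly P s \<ge> 0"
  using P_pos[OF l, of s] P_root[of "2 * l"] P_root[of "2 * l - 1"] l s
  by (cases "s = x (2 * l) \<or> s = x (2 * l - 1)") auto

lemma ends: assumes l: "l \<in> {1..n}" shows "x (2 * l) < x (2 * l - 1)" "x (2 * l - 1) < 0"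
  using x_less[of "2 * l - 1" "2 * l"] x_less[of 0 "2 * l - 1"] x0 l by auto

text \<open>\<open>P\<close> is nonnegative on the oval and keeps the trace outside (-2, 2), so a
  root of \<open>Q\<close> would be a touching point.\<close>

lemma Q_nonzero:
  assumes l: "l \<in> {1..n}" and s: "x (2 * l) \<le> s" "s \<le> x (2 * l - 1)"
  shows "poly Q s \<noteq> 0"
proof
  assume Q: "poly Q s = 0"
  show False
  proof (rule no_touching[OF t_off _ k ends[OF l] s])
    show "poly t 1 \<noteq> 0" using t_one by simp
    show "(poly t s)\<^sup>2 = 4 * (s - 1) ^ (2 * k)" using poly_pr[of s] Q by (simp add: pr_eq)
    show "poly (wronsk k t) s = 0" using G_eq Q by (simp add: G_def)
    fix s assume "x (2 * l) \<le> s" "s \<le> x (2 * l - 1)"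
    then have "poly pr s \<ge> 0" using P_nonneg[OF l] by (simp add: pr_eq)
    then show "(poly t s)\<^sup>2 \<ge> 4 * (s - 1) ^ (2 * k)" by (simp add: poly_pr)
  qed
qed

lemma t_nonzero:
  assumes l: "l \<in> {1..n}" and s: "x (2 * l) \<le> s" "s \<le> x (2 * l - 1)"
  shows "poly t s \<noteq> 0"
proof
  assume "poly t s = 0"
  moreover have "poly pr s \<ge> 0" using P_nonneg[OF l s] by (simp add: pr_eq)
  ultimately have "((s - 1) ^ k)\<^sup>2 \<le> 0" by (simp add: poly_pr power_mult[symmetric] mult.commute)
  then have "(s - 1) ^ k = 0" by simp
  then show False using s ends[OF l] by simp
qed

lemma P_simple: "poly P s = 0 \<Longrightarrow> poly (pderiv P) s \<noteq> 0"
proof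
  assume "poly P s = 0" "poly (pderiv P) s = 0"
  then have "poly p0 (of_real s) = 0" "poly (pderiv p0) (of_real s) = 0"
    unfolding cpoly_P[symmetric] cpoly_simps[symmetric] poly_cpoly_of_real by auto
  then show False using p0 rsquarefree_roots[of p0] by blast
qed

lemma same_sign:
  assumes "a < b" "\<And>s. a \<le> s \<Longrightarrow> s \<le> b \<Longrightarrow> poly R s \<noteq> (0::real)"
  shows "poly R a * poly R b > 0"
proof (rule ccontr)
  assume "\<not> ?thesis"
  moreover have "poly R a * poly R b \<noteq> 0" using assms by simp
  ultimately have "poly R a * poly R b < 0" by linarith
  then show False using poly_IVT[OF assms(1)] assms(2) by (meson less_imp_le)
qed

text \<open>At the ends 2 t h = (s - 1) Q P'. The factors t, Q and s - 1 keep their signs along the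
  oval, whereas P rises from zero at the left end and falls to zero at the right one.\<close>

lemma h_sign:
  assumes l: "l \<in> {1..n}"
  shows "poly h (x (2 * l)) * poly h (x (2 * l - 1)) < 0"
proof -
  let ?a = "x (2 * l)" and ?b = "x (2 * l - 1)"
  note e = ends[OF l]
  have P0: "poly P ?a = 0" "poly P ?b = 0" using P_root[of "2 * l"] P_root[of "2 * l - 1"] l by auto
  have t: "poly t ?a * poly t ?b > 0" using same_sign[OF e(1)] t_nonzero[OF l] by blast
  have Q: "poly Q ?a * poly Q ?b > 0" using same_sign[OF e(1)] Q_nonzero[OF l] by blast
  have Pa: "poly (pderiv P) ?a > 0"
  proof (rule ccontr)
    assume "\<not> ?thesis"
    then have "poly (pderiv P) ?a < 0" using P_simple[OF P0(1)] by linarith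
    then obtain d where d: "d > 0" "\<And>h. 0 < h \<Longrightarrow> h < d \<Longrightarrow> poly P (?a + h) < poly P ?a"
      using DERIV_neg_dec_right[OF poly_DERIV] by blast
    define h where "h = min (d / 2) ((?b - ?a) / 2)"
    have "0 < h" "h < d" "h < ?b - ?a" using d e by (auto simp: h_def min_def)
    then have "poly P (?a + h) < 0" "poly P (?a + h) > 0"
      using d(2)[of h] P0 P_pos[OF l, of "?a + h"] by auto
    then show False by simp
  qed
  have Pb: "poly (pderiv P) ?b < 0"
  proof (rule ccontr)
    assume "\<not> ?thesis"
    then have "poly (pderiv P) ?b > 0" using P_simple[OF P0(2)] by linarith
    then obtain d where d: "d > 0" "\<And>h. 0 < h \<Longrightarrow> h < d \<Longrightarrow> poly P (?b - h) < poly P ?b"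
      using DERIV_pos_inc_left[OF poly_DERIV] by blast
    define h where "h = min (d / 2) ((?b - ?a) / 2)"
    have "0 < h" "h < d" "h < ?b - ?a" using d e by (auto simp: h_def min_def)
    then have "poly P (?b - h) < 0" "poly P (?b - h) > 0"
      using d(2)[of h] P0 P_pos[OF l, of "?b - h"] by auto
    then show False by simp
  qed
  have ha: "2 * poly t ?a * poly h ?a = (?a - 1) * (poly Q ?a * poly (pderiv P) ?a)"
    using two_t_h[of ?a] P0 by simp
  have hb: "2 * poly t ?b * poly h ?b = (?b - 1) * (poly Q ?b * poly (pderiv P) ?b)"
    using two_t_h[of ?b] P0 by simp
  have "(4 * (poly t ?a * poly t ?b)) * (poly h ?a * poly h ?b) =
      (2 * poly t ?a * poly h ?a) * (2 * poly t ?b * poly h ?b)" by (simp only: mult_ac)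
  also have "\<dots> = (poly Q ?a * poly Q ?b) * ((?a - 1) * (?b - 1)) * (poly (pderiv P) ?a * poly (pderiv P) ?b)"
    unfolding ha hb by (simp only: mult_ac)
  also have "\<dots> < 0"
    using e by (intro mult_pos_neg[OF mult_pos_pos[OF Q mult_neg_neg] mult_pos_neg[OF Pa Pb]]) auto
  finally show ?thesis
    using t mult_nonneg_nonneg[of "4 * (poly t ?a * poly t ?b)" "poly h ?a * poly h ?b"] by linarith
qed

text \<open>Multiplying dF by 4/k normalizes the term in eta and turns the coefficient chi / 2 of d
  log rho into 2 chi / k.\<close>

definition H :: "real poly" where "H = smult (2 / real k) h"

sublocale oval_data n x P H
proof
  show "x 0 = 0" by (rule x0)
  show "x (Suc i) < x i" if "i < 2 * n" for i using x_dec that by (simp add: n_def)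
  show "degree P \<le> 2 * n + 1" by (simp add: degree_P)
  show "degree H \<le> n" unfolding H_def by (rule order_trans[OF degree_smult_le degree_h])
  show "poly P (x i) = 0" if "i \<le> 2 * n" for i using P_root that .
  show "poly P s > 0" if "l \<in> {1..n}" "x (2 * l) < s" "s < x (2 * l - 1)" for l s
    using P_pos that .
  show "poly H (x (2 * l)) * poly H (x (2 * l - 1)) < 0" if "l \<in> {1..n}" for l
  proof -
    have "poly H (x (2 * l)) * poly H (x (2 * l - 1)) =
        (2 / real k)\<^sup>2 * (poly h (x (2 * l)) * poly h (x (2 * l - 1)))"
      unfolding H_def poly_smult power2_eq_square by (simp only: mult_ac)
    also have "\<dots> < 0" using k by (intro mult_pos_neg[OF _ h_sign[OF that]]) simp
    finally show ?thesis .
  qed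
  show "(poly H 1)\<^sup>2 = 4 * poly P 1"
    using h_one k by (simp add: H_def power_mult_distrib power_divide)
qed

end

section \<open>Critical points on the curve\<close>

text \<open>Here z is a coordinate and w = w0 sqrt (p0(z) / p0(z0)); the quotient stays near 1,
  where the principal root is holomorphic.\<close>

lemma local_parametrization_unramified:
  assumes "poly p0 z0 = w0\<^sup>2" "w0 \<noteq> 0"
  shows "\<exists>Z W. local_parametrization p0 (z0, w0) Z W"
proof -
  let ?f = "\<lambda>t. poly p0 (z0 + t) / poly p0 z0"
  have p0: "poly p0 z0 \<noteq> 0" using assms by simp
  have "isCont ?f 0" using p0 by (intro continuous_intros) auto
  moreover have "?f 0 = 1" using p0 by simp
  ultimately obtain d where d: "d > 0" "\<And>t. dist t 0 < d \<Longrightarrow> dist (?f t) 1 < 1"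
    unfolding continuous_at_eps_delta by (metis zero_less_one)
  have pos: "?f t \<notin> \<real>\<^sub>\<le>\<^sub>0" if "t \<in> ball 0 d" for t
  proof
    assume "?f t \<in> \<real>\<^sub>\<le>\<^sub>0"
    then obtain r where r: "?f t = of_real r" "r \<le> 0" by (auto elim: nonpos_Reals_cases)
    have "dist (?f t) 1 = norm (of_real (r - 1) :: complex)" unfolding r by (simp add: dist_norm)
    also have "\<dots> = \<bar>r - 1\<bar>" by (rule norm_of_real)
    also have "\<dots> \<ge> 1" using r(2) by simp
    finally show False using d(2)[of t] that by (simp add: dist_norm)
  qed
  have "local_parametrization p0 (z0, w0) (\<lambda>t. z0 + t) (\<lambda>t. w0 * csqrt (?f t))"
    unfolding local_parametrization_def
  proof (intro conjI exI[of _ d] ballI)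
    show "d > 0" by fact
    show "(\<lambda>t. z0 + t) holomorphic_on ball 0 d" by (intro holomorphic_intros)
    show "(\<lambda>t. w0 * csqrt (?f t)) holomorphic_on ball 0 d"
      using pos p0 by (intro holomorphic_intros) auto
    show "(z0 + t, w0 * csqrt (?f t)) \<in> curve p0" for t
      using p0 assms(1) by (simp add: curve_def power_mult_distrib)
    show "(z0 + 0, w0 * csqrt (?f 0)) = (z0, w0)" using p0 by simp
    have "deriv (\<lambda>t. z0 + t) 0 = 1" by (intro DERIV_imp_deriv) (auto intro!: derivative_eq_intros)
    then show "deriv (\<lambda>t. z0 + t) 0 \<noteq> 0 \<or> deriv (\<lambda>t. w0 * csqrt (?f t)) 0 \<noteq> 0" by simp
  qed
  then show ?thesis by blast
qed

text \<open>Near a simple root p0 is invertible, and its inverse at w^2 expresses z by the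
  coordinate w.\<close>

lemma local_parametrization_branch:
  assumes "poly p0 z0 = 0" "poly (pderiv p0) z0 \<noteq> 0"
  shows "\<exists>Z W. local_parametrization p0 (z0, 0) Z W"
proof -
  have hol: "poly p0 holomorphic_on S" for S by (intro holomorphic_intros)
  have "deriv (poly p0) z0 \<noteq> 0" using assms(2) by (simp add: DERIV_imp_deriv[OF poly_DERIV])
  then obtain r where r: "r > 0" "inj_on (poly p0) (ball z0 r)"
    using has_complex_derivative_locally_injective[OF hol UNIV_I open_UNIV] by blast
  obtain g where g: "g holomorphic_on (poly p0 ` ball z0 r)" "\<And>z. z \<in> ball z0 r \<Longrightarrow> g (poly p0 z) = z"
    using holomorphic_has_inverse[OF hol open_ball r(2)] by metis
  have "open (poly p0 ` ball z0 r)" using open_mapping_thm3[OF hol open_ball r(2)] .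
  moreover have "0 \<in> poly p0 ` ball z0 r" using assms(1) r(1) by (intro image_eqI[of _ _ z0]) auto
  ultimately obtain d where d: "d > 0" "ball 0 d \<subseteq> poly p0 ` ball z0 r" by (rule openE)
  define e where "e = min d 1"
  have sq: "t\<^sup>2 \<in> ball 0 d" if "t \<in> ball 0 e" for t :: complex
  proof -
    have "norm t < 1" "norm t < d" using that by (auto simp: e_def)
    then have "norm t * norm t \<le> norm t * 1" by (intro mult_left_mono) auto
    then show ?thesis using \<open>norm t < d\<close> by (simp add: norm_mult power2_eq_square)
  qed
  have "local_parametrization p0 (z0, 0) (\<lambda>t. g (t\<^sup>2)) (\<lambda>t. t)"
    unfolding local_parametrization_def
  proof (intro conjI exI[of _ e] ballI)
    show "e > 0" using d by (simp add: e_def)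
    have "(g \<circ> (\<lambda>t. t\<^sup>2)) holomorphic_on ball 0 e"
      using g(1) sq d(2) by (intro holomorphic_on_compose_gen[of _ _ _ "poly p0 ` ball z0 r"] holomorphic_intros) auto
    then show "(\<lambda>t. g (t\<^sup>2)) holomorphic_on ball 0 e" by (simp add: o_def)
    show "(\<lambda>t. t) holomorphic_on ball 0 e" by (intro holomorphic_intros)
    show "(g (t\<^sup>2), t) \<in> curve p0" if t: "t \<in> ball 0 e" for t
    proof -
      obtain z where z: "z \<in> ball z0 r" "t\<^sup>2 = poly p0 z" using sq[OF t] d(2) by blast
      then show ?thesis using g(2)[OF z(1)] by (simp add: curve_def)
    qed
    show "(g (0\<^sup>2), 0) = (z0, 0)" using g(2)[of z0] r(1) assms(1) by simp
    show "deriv (\<lambda>t. g (t\<^sup>2)) 0 \<noteq> 0 \<or> deriv (\<lambda>t. t) (0 :: complex) \<noteq> 0" by simp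
  qed
  then show ?thesis by blast
qed

context aztec
begin

section \<open>The differential in local coordinates\<close>

lemma eval_real:
  "poly q (of_real s) = of_real (poly Q s)" "poly (pderiv q) (of_real s) = of_real (poly (pderiv Q) s)"
  "poly p0 (of_real s) = of_real (poly P s)" "poly (pderiv p0) (of_real s) = of_real (poly (pderiv P) s)"
  "poly (pderiv (cpoly r)) (of_real s) = of_real (poly (pderiv r) s)"
  by (metis cpoly_Q cpoly_P cpoly_simps(8) poly_cpoly_of_real)+

text \<open>On the curve (t + q w) (t - q w) = t^2 - p = 4 (z - 1)^(2k), so the numerator has no
  zero away from z = 1.\<close>

lemma curve_rho:
  assumes "w\<^sup>2 = poly p0 z" "z \<noteq> 0" "z \<noteq> 1"
  shows "aztec_rho k \<alpha> \<beta> q z w = (poly (cpoly t) z + poly q z * w) / (2 * (z - 1) ^ k)"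
    and "(poly (cpoly t) z + poly q z * w) / (2 * (z - 1) ^ k) \<noteq> 0"
proof -
  show "aztec_rho k \<alpha> \<beta> q z w = (poly (cpoly t) z + poly q z * w) / (2 * (z - 1) ^ k)"
    using assms by (simp add: aztec_rho_def trace_eq add_divide_distrib mult.commute)
  have "poly p z = (poly (cpoly t) z)\<^sup>2 - 4 * (z - 1) ^ (2 * k)" by (simp add: p_pr cpoly_pr)
  then have "(poly q z)\<^sup>2 * w\<^sup>2 = (poly (cpoly t) z)\<^sup>2 - 4 * (z - 1) ^ (2 * k)"
    unfolding assms(1) by (simp add: pq)
  then have "(poly (cpoly t) z + poly q z * w) * (poly (cpoly t) z - poly q z * w) = 4 * (z - 1) ^ (2 * k)"
    by (simp add: algebra_simps power2_eq_square)
  then have "poly (cpoly t) z + poly q z * w \<noteq> 0" using assms(3) by force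
  then show "(poly (cpoly t) z + poly q z * w) / (2 * (z - 1) ^ k) \<noteq> 0" using assms(3) by simp
qed

text \<open>Away from branch points, clearing denominators in dF with d log rho = h dz / ((z - 1) w)
  gives the equation. At a branch point, dz vanishes and the differential is evaluated through
  dw.\<close>

lemma param_critical:
  fixes s v :: real
  assumes l: "l \<in> {1..n}" and s: "ea l \<le> s" "s \<le> eb l" and v: "v\<^sup>2 = poly P s"
    and lp: "local_parametrization p0 (of_real s, of_real v) Z W"
  shows "(aztec_dF k \<alpha> \<beta> q chi eta Z W \<longlongrightarrow> 0) (at 0) \<longleftrightarrow>
      (eta * (s - 1) - (s + 1)) * v = chi * s * poly H s"
proof -
  define z where "z = complex_of_real s"
  define w where "w = complex_of_real v"
  obtain e where e: "e > 0" "Z holomorphic_on ball 0 e" "W holomorphic_on ball 0 e"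
    and cv: "\<And>t. t \<in> ball 0 e \<Longrightarrow> (W t)\<^sup>2 = poly p0 (Z t)"
    and ZW: "Z 0 = z" "W 0 = w" and nz: "deriv Z 0 \<noteq> 0 \<or> deriv W 0 \<noteq> 0"
    using lp unfolding local_parametrization_def curve_def z_def w_def by auto
  have s0: "s < 0" using s ab[OF l] by linarith
  have z0: "z \<noteq> 0" "z \<noteq> 1" using s0 by (auto simp: z_def)
  have "isCont Z 0"
    using holomorphic_on_imp_continuous_on[OF e(2)] by (rule continuous_on_interior) (simp add: e(1))
  then obtain d1 d2 where "d1 > 0" "\<And>t. dist 0 t < d1 \<Longrightarrow> Z t \<noteq> 0" "d2 > 0" "\<And>t. dist 0 t < d2 \<Longrightarrow> Z t \<noteq> 1"
    using continuous_at_avoid[of 0 Z 0] continuous_at_avoid[of 0 Z 1] z0 unfolding ZW by blast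
  then have d0: "min d1 d2 > 0" "\<And>t. dist 0 t < min d1 d2 \<Longrightarrow> Z t \<noteq> 0 \<and> Z t \<noteq> 1" by auto
  define d where "d = min e (min d1 d2)"
  have d: "d > 0" "ball 0 d \<subseteq> ball (0::complex) e" using e d0 by (auto simp: d_def)
  have Zne: "Z t \<noteq> 0" "Z t \<noteq> 1" if "t \<in> ball 0 d" for t using d0(2)[of t] that by (auto simp: d_def)
  have Zh: "Z holomorphic_on ball 0 d" and Wh: "W holomorphic_on ball 0 d"
    using e d(2) by (auto elim: holomorphic_on_subset)
  define N where "N t = poly (cpoly local.t) (Z t) + poly q (Z t) * W t" for t
  define D where "D t = 2 * (Z t - 1) ^ k" for t
  define R where "R t = N t / D t" for t
  have Rh: "R holomorphic_on ball 0 d"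
    unfolding R_def N_def D_def using Zne by (intro holomorphic_intros Zh Wh) auto
  have Rne: "R t \<noteq> 0" and rho: "aztec_rho k \<alpha> \<beta> q (Z t) (W t) = R t" if "t \<in> ball 0 d" for t
    using curve_rho[OF cv Zne[OF that], of] that d(2) by (auto simp: R_def N_def D_def)
  \<comment> \<open>On the oval z is neither 0 nor 1 and rho has neither zero nor pole, so dF
    extends holomorphically and its limit is the value of \<open>E\<close> at 0.\<close>
  define E where "E t = of_nat k / 4 * (of_real eta + 1) * (deriv Z t / Z t)
     - of_nat k / 2 * (deriv Z t / (Z t - 1)) - of_real chi / 2 * (deriv R t / R t)" for t
  have dF: "aztec_dF k \<alpha> \<beta> q chi eta Z W t = E t" if t: "t \<in> ball 0 d" for t
  proof -
    have "(Z has_field_derivative deriv Z t) (at t)" using Zh t by (rule holomorphic_derivI[OF _ open_ball])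
    then have "deriv (\<lambda>s. Z s - 1) t = deriv Z t"
      by (intro DERIV_imp_deriv) (auto intro!: derivative_eq_intros)
    moreover have "deriv (\<lambda>s. aztec_rho k \<alpha> \<beta> q (Z s) (W s)) t = deriv R t"
    proof (rule deriv_cong_ev)
      have "eventually (\<lambda>s. s \<in> ball 0 d) (nhds t)" using t by (intro eventually_nhds_in_open) auto
      then show "\<forall>\<^sub>F s in nhds t. aztec_rho k \<alpha> \<beta> q (Z s) (W s) = R s"
        by eventually_elim (rule rho)
    qed simp
    ultimately show ?thesis using rho[OF t] by (simp add: aztec_dF_def dlog_def E_def)
  qed
  have Eh: "E holomorphic_on ball 0 d"
    unfolding E_def using Zne Rne
    by (intro holomorphic_intros Zh Rh holomorphic_deriv) auto
  have "isCont E 0"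
    using holomorphic_on_imp_continuous_on[OF Eh] by (rule continuous_on_interior) (simp add: d(1))
  then have Elim: "(E \<longlongrightarrow> E 0) (at 0)" by (simp add: isCont_def)
  have "eventually (\<lambda>t. t \<in> ball 0 d) (at 0)" using d(1) by (intro eventually_at_in_open') auto
  then have "eventually (\<lambda>t. aztec_dF k \<alpha> \<beta> q chi eta Z W t = E t) (at 0)"
    by eventually_elim (rule dF)
  then have lim: "(aztec_dF k \<alpha> \<beta> q chi eta Z W \<longlongrightarrow> 0) (at 0) \<longleftrightarrow> (E \<longlongrightarrow> 0) (at 0)"
    by (rule tendsto_cong)
  have limE: "(E \<longlongrightarrow> 0) (at 0) \<longleftrightarrow> E 0 = 0"
    using Elim tendsto_unique[OF _ Elim, of 0] by auto

  define Z' where "Z' = deriv Z 0"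
  define W' where "W' = deriv W 0"
  define R' where "R' = deriv R 0"
  have in0: "(0::complex) \<in> ball 0 d" using d by simp
  have dZ: "(Z has_field_derivative Z') (at 0)" unfolding Z'_def using Zh in0 by (rule holomorphic_derivI[OF _ open_ball])
  have dW: "(W has_field_derivative W') (at 0)" unfolding W'_def using Wh in0 by (rule holomorphic_derivI[OF _ open_ball])
  have dR: "(R has_field_derivative R') (at 0)" unfolding R'_def using Rh in0 by (rule holomorphic_derivI[OF _ open_ball])
  have ev0: "eventually (\<lambda>t. t \<in> ball 0 d) (nhds (0::complex))" using in0 by (intro eventually_nhds_in_open) auto
  have dpoly: "((\<lambda>t. poly p (Z t)) has_field_derivative poly (pderiv p) z * Z') (at 0)" for p
    using DERIV_chain2[OF poly_DERIV dZ, of p] ZW by simp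
  define T where "T = complex_of_real (poly t s)"
  define T' where "T' = complex_of_real (poly (pderiv t) s)"
  define qq where "qq = complex_of_real (poly Q s)"
  define qq' where "qq' = complex_of_real (poly (pderiv Q) s)"
  define pp where "pp = complex_of_real (poly P s)"
  define pp' where "pp' = complex_of_real (poly (pderiv P) s)"
  define hh where "hh = complex_of_real (poly h s)"
  have ev: "poly (cpoly t) z = T" "poly (pderiv (cpoly t)) z = T'" "poly q z = qq" "poly (pderiv q) z = qq'"
    "poly p0 z = pp" "poly (pderiv p0) z = pp'"
    by (simp_all add: z_def eval_real poly_cpoly_of_real T_def T'_def qq_def qq'_def pp_def pp'_def)
  have wp: "w\<^sup>2 = pp" using v by (simp add: w_def pp_def flip: of_real_power)
  have qne: "qq \<noteq> 0" using Q_nonzero[OF l, of s] s by (simp add: qq_def ea_def eb_def)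
  have hT: "2 * T * hh = (z - 1) * (2 * qq' * pp + qq * pp') - 2 * of_nat k * qq * pp"
    using arg_cong[OF two_t_h[of s], of complex_of_real]
    by (simp add: T_def hh_def z_def qq_def qq'_def pp_def pp'_def)
  have hG: "(z - 1) * T' - of_nat k * T = qq * hh"
  proof -
    have "(s - 1) * poly (pderiv t) s - real k * poly t s = poly Q s * poly h s"
      using poly_wronsk[of k t s] by (simp add: G_def[symmetric] G_eq)
    from arg_cong[OF this, of complex_of_real] show ?thesis
      by (simp add: T_def hh_def z_def qq_def T'_def)
  qed
  have curve': "2 * w * W' = pp' * Z'"
  proof -
    have "((\<lambda>t. (W t)\<^sup>2) has_field_derivative 2 * w * W') (at 0)"
      using dW ZW by (auto intro!: derivative_eq_intros)
    moreover have cong: "eventually (\<lambda>t. (W t)\<^sup>2 = poly p0 (Z t)) (nhds 0)"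
      using ev0 by eventually_elim (use cv d(2) in auto)
    ultimately have "((\<lambda>t. poly p0 (Z t)) has_field_derivative 2 * w * W') (at 0)"
      by (simp only: DERIV_cong_ev[OF refl cong refl])
    from DERIV_unique[OF this dpoly] show ?thesis by (simp add: ev)
  qed
  define DD where "DD = (z - 1) ^ k"
  have DD: "DD \<noteq> 0" using z0 by (simp add: DD_def)
  have R0: "2 * DD * R 0 = T + qq * w" using DD by (simp add: R_def N_def D_def ZW ev DD_def)
  have R': "2 * of_nat k * DD * Z' * R 0 + 2 * (z - 1) * DD * R' = (z - 1) * (T' * Z' + qq' * Z' * w + qq * W')"
  proof -
    have "((\<lambda>t. D t * R t) has_field_derivative
        2 * (of_nat k * Z' * (z - 1) ^ (k - Suc 0)) * R 0 + D 0 * R') (at 0)"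
      unfolding D_def using dZ dR ZW by (auto intro!: derivative_eq_intros)
    moreover have cong: "eventually (\<lambda>t. D t * R t = N t) (nhds 0)"
      using ev0 by eventually_elim (use Zne in \<open>auto simp: R_def D_def\<close>)
    ultimately have 1: "(N has_field_derivative
        2 * (of_nat k * Z' * (z - 1) ^ (k - Suc 0)) * R 0 + D 0 * R') (at 0)"
      by (simp only: DERIV_cong_ev[OF refl cong refl])
    have 2: "(N has_field_derivative T' * Z' + (qq' * Z' * w + qq * W')) (at 0)"
      unfolding N_def using DERIV_add[OF dpoly[of "cpoly local.t"] DERIV_mult[OF dpoly[of q] dW]]
      by (simp add: ev ZW mult.commute)
    have e: "(z - 1) * (z - 1) ^ (k - Suc 0) = DD" using k by (cases k) (simp_all add: DD_def)
    have "2 * of_nat k * ((z - 1) * (z - 1) ^ (k - Suc 0)) * Z' * R 0 + (z - 1) * D 0 * R' =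
        (z - 1) * (2 * (of_nat k * Z' * (z - 1) ^ (k - Suc 0)) * R 0 + D 0 * R')"
      by (simp add: algebra_simps)
    also have "\<dots> = (z - 1) * (T' * Z' + (qq' * Z' * w + qq * W'))"
      using DERIV_unique[OF 1 2] by simp
    finally show ?thesis unfolding e by (simp add: D_def ZW DD_def algebra_simps)
  qed
  \<comment> \<open>The formula for d log rho, multiplied out so as to make sense for w = 0 too.
    Cancelling q uses that it has no zero on the oval.\<close>
  have main: "w * (z - 1) * R' = hh * Z' * R 0"
  proof -
    have "(2 * DD * qq) * (w * (z - 1) * R') = w * qq * (2 * (z - 1) * DD * R')" by (simp add: algebra_simps)
    also have "2 * (z - 1) * DD * R' = (z - 1) * (T' * Z' + qq' * Z' * w + qq * W') - of_nat k * Z' * (2 * DD * R 0)"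
      using R' by (simp add: algebra_simps)
    also have "w * qq * \<dots> = qq * w * Z' * ((z - 1) * T' - of_nat k * T) + qq * (Z' * w\<^sup>2 * ((z - 1) * qq' - of_nat k * qq)
        + (z - 1) * qq * (2 * w * W') / 2)"
      unfolding R0 by (simp add: algebra_simps power2_eq_square add_divide_distrib diff_divide_distrib)
    also have "\<dots> = qq * w * Z' * (qq * hh) + qq * Z' * (2 * T * hh) / 2"
      unfolding hG hT curve' wp by (simp add: algebra_simps add_divide_distrib diff_divide_distrib)
    also have "\<dots> = qq * hh * Z' * (2 * DD * R 0)" unfolding R0 by (simp add: algebra_simps)
    also have "\<dots> = (2 * DD * qq) * (hh * Z' * R 0)" by (simp add: algebra_simps)
    finally show ?thesis using DD qne by simp
  qed
  have R0ne: "R 0 \<noteq> 0" using Rne[OF in0] .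
  have E0: "E 0 = of_nat k / 4 * (of_real eta + 1) * (Z' / z) - of_nat k / 2 * (Z' / (z - 1)) - of_real chi / 2 * (R' / R 0)"
    by (simp add: E_def Z'_def R'_def ZW)
  have Hs: "complex_of_real (poly H s) = 2 / of_nat k * hh" by (simp add: H_def hh_def)
  have "E 0 = 0 \<longleftrightarrow> (eta * (s - 1) - (s + 1)) * v = chi * s * poly H s"
  proof (cases "v = 0")
    case False
    then have w: "w \<noteq> 0" by (simp add: w_def)
    have Z': "Z' \<noteq> 0"
    proof
      assume "Z' = 0"
      then have "W' = 0" using curve' w by simp
      then show False using nz \<open>Z' = 0\<close> by (simp add: Z'_def W'_def)
    qed
    have RR: "R' / R 0 = hh * Z' / (w * (z - 1))" using main R0ne w z0 by (simp add: field_simps)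
    define K where "K = (of_nat k :: complex)"
    have K: "K \<noteq> 0" using k by (simp add: K_def)
    \<comment> \<open>Clears all denominators; (eta + 1) (z - 1) - 2 z = eta (z - 1) - (z + 1) then
      gives the coefficient of w.\<close>
    define C where "C = 4 * z * (z - 1) * w / (K * Z')"
    have C: "C \<noteq> 0" using w z0 Z' K by (simp add: C_def)
    have "K / 4 * (of_real eta + 1) * (Z' / z) * C = (of_real eta + 1) * (z - 1) * w"
      using w z0 Z' K by (simp add: C_def)
    moreover have "K / 2 * (Z' / (z - 1)) * C = 2 * z * w"
      using w z0 Z' K by (simp add: C_def field_simps)
    moreover have "of_real chi / 2 * (hh * Z' / (w * (z - 1))) * C = of_real chi * z * (2 / K * hh)"
      using w z0 Z' K by (simp add: C_def)
    ultimately have "E 0 * C = (of_real eta + 1) * (z - 1) * w - 2 * z * w - of_real chi * z * (2 / of_nat k * hh)"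
      unfolding E0 RR K_def[symmetric] left_diff_distrib by simp
    also have "\<dots> = of_real ((eta * (s - 1) - (s + 1)) * v - chi * s * poly H s)"
      unfolding Hs[symmetric] by (simp add: z_def w_def algebra_simps)
    finally have "E 0 * C = of_real ((eta * (s - 1) - (s + 1)) * v - chi * s * poly H s)" .
    moreover have "E 0 = 0 \<longleftrightarrow> E 0 * C = 0" using C by simp
    ultimately have "E 0 = 0 \<longleftrightarrow> complex_of_real ((eta * (s - 1) - (s + 1)) * v - chi * s * poly H s) = 0"
      by simp
    then show ?thesis unfolding of_real_eq_0_iff by simp
  next
    case True
    \<comment> \<open>At a branch point dz = 0 and dw is nonzero, so only the rho term survives and
      dF vanishes iff chi = 0. As w = 0 and \<open>H\<close> is nonzero at the ends, the equation
      says the same.\<close>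
    then have Ps: "poly P s = 0" using v by simp
    have w: "w = 0" using True by (simp add: w_def)
    have "pp' \<noteq> 0" using P_simple[OF Ps] by (simp add: pp'_def)
    then have Z': "Z' = 0" using curve' w by simp
    then have W': "W' \<noteq> 0" using nz by (simp add: Z'_def W'_def)
    have "2 * (z - 1) * DD * R' = (z - 1) * (qq * W')" using R' Z' by simp
    then have "R' \<noteq> 0" using z0 qne W' by auto
    then have "E 0 = 0 \<longleftrightarrow> chi = 0" using R0ne by (simp add: E0 Z')
    moreover have "s = ea l \<or> s = eb l" using P_pos'[OF l, of s] Ps s by linarith
    then have "poly H s \<noteq> 0" using H_end[OF l] by auto
    ultimately show ?thesis using True s0 by simp
  qed
  then show ?thesis using lim limE by simp
qed

text \<open>The criterion is the same in all local parametrizations, but being critical asks for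
  one, so their existence is needed.\<close>

lemma critical_iff:
  fixes s v :: real
  assumes l: "l \<in> {1..n}" and s: "ea l \<le> s" "s \<le> eb l" and v: "v\<^sup>2 = poly P s"
  shows "aztec_critical_point k \<alpha> \<beta> q p0 chi eta (of_real s, of_real v) \<longleftrightarrow>
      (eta * (s - 1) - (s + 1)) * v = chi * s * poly H s"
proof -
  have p0s: "poly p0 (of_real s) = (complex_of_real v)\<^sup>2"
    by (simp add: eval_real v[symmetric])
  have "\<exists>Z W. local_parametrization p0 (of_real s, of_real v) Z W"
  proof (cases "v = 0")
    case False
    then show ?thesis by (intro local_parametrization_unramified p0s) simp
  next
    case True
    then have "poly P s = 0" using v by simp
    then have "poly (pderiv P) s \<noteq> 0" by (rule P_simple)
    then have "poly (pderiv p0) (of_real s) \<noteq> 0"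
      by (simp add: eval_real)
    then show ?thesis using local_parametrization_branch[of p0 "of_real s"] p0s True by simp
  qed
  then show ?thesis
    unfolding aztec_critical_point_def using param_critical[OF l s v] by blast
qed

text \<open>\<open>P\<close> is nonnegative on the oval, so w is real and real coordinates lose no
  point.\<close>

lemma oval_crit:
  assumes l: "l \<in> {1..n}"
  shows "{R \<in> oval p0 (x (2 * l)) (x (2 * l - 1)). aztec_critical_point k \<alpha> \<beta> q p0 chi eta R} =
    (\<lambda>(s, v). (complex_of_real s, complex_of_real v)) ` crit l chi eta" (is "?L = ?R")
proof
  show "?R \<subseteq> ?L"
  proof (rule image_subsetI)
    fix y assume y: "y \<in> crit l chi eta"
    obtain s v where sv: "y = (s, v)" by (cases y)
    then have s: "ea l \<le> s" "s \<le> eb l" "v\<^sup>2 = poly P s" using y by (auto simp: crit_def)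
    have "(complex_of_real v)\<^sup>2 = poly p0 (of_real s)"
      by (simp add: eval_real s(3)[symmetric])
    then show "(\<lambda>(s, v). (complex_of_real s, complex_of_real v)) y \<in> ?L"
      using s y critical_iff[OF l s] by (auto simp: sv oval_def curve_def crit_def ea_def eb_def)
  qed
  show "?L \<subseteq> ?R"
  proof (rule subrelI)
    fix z w
    assume "(z, w) \<in> ?L"
    then have o: "(z, w) \<in> oval p0 (x (2 * l)) (x (2 * l - 1))"
      and c: "aztec_critical_point k \<alpha> \<beta> q p0 chi eta (z, w)" by auto
    obtain s where s: "z = of_real s" "ea l \<le> s" "s \<le> eb l"
      using o by (auto simp: oval_def ea_def eb_def)
    have Ps: "poly P s \<ge> 0" using P_nonneg[OF l] s by (simp add: ea_def eb_def)
    have "w\<^sup>2 = of_real (poly P s)"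
      using o by (simp add: oval_def curve_def s(1) eval_real)
    also have "\<dots> = (of_real (sqrt (poly P s)))\<^sup>2"
      using Ps by (simp flip: of_real_power)
    finally have "w = of_real (sqrt (poly P s)) \<or> w = of_real (- sqrt (poly P s))"
      by (simp add: power2_eq_iff)
    then obtain v where v: "w = of_real v" "v\<^sup>2 = poly P s" using Ps by force
    have "(s, v) \<in> crit l chi eta"
      using critical_iff[OF l s(2,3) v(2), of chi eta] c s v by (simp add: crit_def)
    then show "(z, w) \<in> ?R" using s v by force
  qed
qed

lemma smooth_region_eq: "smooth_region k \<alpha> \<beta> q p0 k' x = (\<Union>l\<in>{1..n}. smooth l)"
proof -
  have "card {R \<in> oval p0 (x (2 * l)) (x (2 * l - 1)). aztec_critical_point k \<alpha> \<beta> q p0 chi eta R} =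
      card (crit l chi eta)" if "l \<in> {1..n}" for l chi eta
    unfolding oval_crit[OF that] by (intro card_image) (auto simp: inj_on_def)
  then show ?thesis
    unfolding smooth_region_def smooth_def n_def[symmetric] by auto
qed

end

theorem theorem2p8:
  fixes k k' :: nat
    and \<alpha> \<beta> x :: "nat \<Rightarrow> real"
    and p q p0 :: "complex poly"
  assumes "k \<ge> 1"
    and "\<And>m. m \<in> {1..k} \<Longrightarrow> \<alpha> m > 0"
    and "\<And>m. m \<in> {1..k} \<Longrightarrow> \<beta> m > 0"
    and "(\<Prod>m=1..k. \<alpha> m) = (\<Prod>m=1..k. \<beta> m)"
    and "\<And>z. z \<noteq> 0 \<Longrightarrow> z \<noteq> 1 \<Longrightarrow> poly p z = aztec_p k \<alpha> \<beta> z"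
    and "p = q\<^sup>2 * p0" "rsquarefree q" "rsquarefree p0" "lead_coeff q = 1"
    and "k' \<ge> 1"
    and "{z. poly p0 z = 0} = (\<lambda>i. complex_of_real (x i)) ` {..2 * (k' - 1)}"
    and "x 0 = 0"
    and "\<And>i. i < 2 * (k' - 1) \<Longrightarrow> x (Suc i) < x i"
  shows "finite (components (smooth_region k \<alpha> \<beta> q p0 k' x)) \<and>
         card (components (smooth_region k \<alpha> \<beta> q p0 k' x)) = k' - 1"
proof -
  interpret aztec k k' \<alpha> \<beta> x p q p0
    using assms(1-3,5-13) by unfold_locales
  show ?thesis
    unfolding smooth_region_eq components_smooth(1) using components_smooth(2) by (simp add: n_def)
qed

end
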